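(* Fix $\alpha>0$ and let $X=\{(\lambda,m_\lambda)\}_{\lambda\in\Lambda}$ denote a divisor. (a) If $X$ is an interpolating divisor for $\mathcal F^2_\alpha$, then there exists $C=C(M_X)>0$ (depending only on the interpolation constant $M_X$) such that the discs $\{D(\lambda,\sqrt{m_\lambda/\alpha}-C)\}_{\lambda\in\Lambda,\ m_\lambda>\alpha C^2}$ are pairwise disjoint. (b) Conversely, if for some $C>0$ the discs $\{D(\lambda,\sqrt{m_\lambda/\alpha}+C)\}_{\lambda\in\Lambda}$ are pairwise disjoint, then $X$ is an interpolating divisor for $\mathcal F^2_\alpha$.
   Context: $D(z,r)$ is the open disc of radius $r$ centered at $z\in\mathbb C$; $dm$ is Lebesgue area measure. For $\alpha>0$, $\mathcal F^2_\alpha$ is the Hilbert space of entire functions $f$ with $\|f\|_2^2=\frac{\alpha}{\pi}\int_{\mathbb C}|f(z)|^2e^{-\alpha|z|^2}dm(z)<\infty$, with inner product $\langle f,g\rangle=\frac{\alpha}{\pi}\int_{\mathbb C} f\overline g\, e^{-\alpha|z|^2}dm$. Its monomial orthonormal basis is $e_k(z)=\sqrt{\alpha^k/k!}\,z^k$, $k\ge 0$. For $\lambda\in\mathbb C$, the translation $T_\lambda f(\zeta)=e^{\alpha\bar\lambda\zeta-\frac{\alpha}{2}|\lambda|^2}f(\zeta-\lambda)$ acts isometrically on $\mathcal F^2_\alpha$. A divisor is $X=\{(\lambda,m_\lambda)\}_{\lambda\in\Lambda}$, where $\Lambda$ is a sequence of (distinct) points in $\mathbb C$ and $m_\lambda\in\{1,2,3,\dots\}$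 is the multiplicity associated with $\lambda$. $X$ is called interpolating for $\mathcal F^2_\alpha$ if for every family of complex numbers $v=(v^{(k)}_\lambda)_{\lambda\in\Lambda,\,0\le k<m_\lambda}$ with $\|v\|_2^2:=\sum_{\lambda\in\Lambda}\sum_{k=0}^{m_\lambda-1}|v^{(k)}_\lambda|^2<\infty$ there exists $f\in\mathcal F^2_\alpha$ such that $\langle f,T_\lambda e_k\rangle=v^{(k)}_\lambda$ for all $\lambda\in\Lambda$, $0\le k<m_\lambda$. In that case (open mapping theorem) there is $C'>0$ such that $f$ can always be chosen with $\|f\|_2\le C'\|v\|_2$; the minimal such $C'$ is the interpolation constant $M_X$ of $X$. *)

theory Defs
  imports "HOL-Complex_Analysis.Complex_Analysis"
begin

definition fock_space :: "real \<Rightarrow> (complex \<Rightarrow> complex) set" where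
  "fock_space \<alpha> = {f. f holomorphic_on UNIV \<and>
     integrable lborel (\<lambda>z. (cmod (f z))\<^sup>2 * exp (- \<alpha> * (cmod z)\<^sup>2))}"

definition fock_norm :: "real \<Rightarrow> (complex \<Rightarrow> complex) \<Rightarrow> real" where
  "fock_norm \<alpha> f =
     sqrt (\<alpha> / pi * (LINT z|lborel. (cmod (f z))\<^sup>2 * exp (- \<alpha> * (cmod z)\<^sup>2)))"

definition fock_inner :: "real \<Rightarrow> (complex \<Rightarrow> complex) \<Rightarrow> (complex \<Rightarrow> complex) \<Rightarrow> complex" where
  "fock_inner \<alpha> f g =
     of_real (\<alpha> / pi) * (LINT z|lborel. f z * cnj (g z) * of_real (exp (- \<alpha> * (cmod z)\<^sup>2)))"

definition fock_basis :: "real \<Rightarrow> nat \<Rightarrow> complex \<Rightarrow> complex" where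
  "fock_basis \<alpha> k z = of_real (sqrt (\<alpha> ^ k / fact k)) * z ^ k"

definition fock_translation :: "real \<Rightarrow> complex \<Rightarrow> (complex \<Rightarrow> complex) \<Rightarrow> complex \<Rightarrow> complex" where
  "fock_translation \<alpha> l f \<zeta> =
     exp (of_real \<alpha> * cnj l * \<zeta> - of_real (\<alpha> / 2 * (cmod l)\<^sup>2)) * f (\<zeta> - l)"

text \<open>A divisor is given by its set of points \<open>\<Lambda>\<close> (finite or countably infinite) and a multiplicity
  function \<open>m\<close>, of which only the values on \<open>\<Lambda>\<close> matter.\<close>

definition divisor :: "complex set \<Rightarrow> (complex \<Rightarrow> nat) \<Rightarrow> bool" where
  "divisor \<Lambda> m \<longleftrightarrow> countable \<Lambda> \<and> (\<forall>l\<in>\<Lambda>. m l \<ge> 1)"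

definition divisor_index :: "complex set \<Rightarrow> (complex \<Rightarrow> nat) \<Rightarrow> (complex \<times> nat) set" where
  "divisor_index \<Lambda> m = (SIGMA l:\<Lambda>. {..<m l})"

text \<open>Data \<open>v l k\<close> stand for the target value with upper index \<open>k\<close> at the point \<open>l\<close>; only the
  pairs in \<open>divisor_index \<Lambda> m\<close> matter.\<close>

definition l2_data :: "complex set \<Rightarrow> (complex \<Rightarrow> nat) \<Rightarrow> (complex \<Rightarrow> nat \<Rightarrow> complex) \<Rightarrow> bool" where
  "l2_data \<Lambda> m v \<longleftrightarrow> (\<lambda>(l, k). (cmod (v l k))\<^sup>2) summable_on divisor_index \<Lambda> m"

definition data_norm :: "complex set \<Rightarrow> (complex \<Rightarrow> nat) \<Rightarrow> (complex \<Rightarrow> nat \<Rightarrow> complex) \<Rightarrow> real" where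
  "data_norm \<Lambda> m v = sqrt (\<Sum>\<^sub>\<infinity>(l, k)\<in>divisor_index \<Lambda> m. (cmod (v l k))\<^sup>2)"

definition interpolates ::
  "real \<Rightarrow> complex set \<Rightarrow> (complex \<Rightarrow> nat) \<Rightarrow> (complex \<Rightarrow> complex) \<Rightarrow> (complex \<Rightarrow> nat \<Rightarrow> complex) \<Rightarrow> bool"
where
  "interpolates \<alpha> \<Lambda> m f v \<longleftrightarrow>
     (\<forall>l\<in>\<Lambda>. \<forall>k<m l. fock_inner \<alpha> f (fock_translation \<alpha> l (fock_basis \<alpha> k)) = v l k)"

definition interpolating :: "real \<Rightarrow> complex set \<Rightarrow> (complex \<Rightarrow> nat) \<Rightarrow> bool" where
  "interpolating \<alpha> \<Lambda> m \<longleftrightarrow>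
     (\<forall>v. l2_data \<Lambda> m v \<longrightarrow> (\<exists>f\<in>fock_space \<alpha>. interpolates \<alpha> \<Lambda> m f v))"

text \<open>For a nonempty interpolating divisor the infimum is attained (by the solutions of minimal
  norm), so it is the minimal admissible constant; for the empty divisor it is \<open>0\<close>.\<close>

definition interpolation_constant :: "real \<Rightarrow> complex set \<Rightarrow> (complex \<Rightarrow> nat) \<Rightarrow> real" where
  "interpolation_constant \<alpha> \<Lambda> m =
     Inf {K. K > 0 \<and> (\<forall>v. l2_data \<Lambda> m v \<longrightarrow>
       (\<exists>f\<in>fock_space \<alpha>. interpolates \<alpha> \<Lambda> m f v \<and> fock_norm \<alpha> f \<le> K * data_norm \<Lambda> m v))}"

end

theory Submission
  imports Defs
begin

text \<open>
  Necessity is a statement about coherent states. If \<open>w\<close> lies in both shrunken discs, then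
  \<open>T\<^sub>w e\<^sub>0\<close> is, up to a Poisson tail \<open>exp (- \<alpha> C\<^sup>2)\<close>, a combination of
  the \<open>T\<^sub>\<lambda> e\<^sub>k\<close>, \<open>k < m\<^sub>\<lambda>\<close>, and also of the \<open>T\<^sub>\<mu> e\<^sub>k\<close>, \<open>k < m\<^sub>\<mu>\<close>. The difference of
  the two combinations is small although its coefficients are not, which contradicts the
  interpolation bound once \<open>C\<close> is large.

  For sufficiency, weak compactness reduces everything to a lower Riesz bound
  \<open>\<parallel>c\<parallel> \<le> K \<parallel>f\<parallel>\<close> for finite sums \<open>f = \<Sum> c T\<^sub>\<lambda> e\<^sub>k\<close>, uniform over finite subdivisors. It
  is obtained by duality from the \<open>L\<^sup>2\<close> theory of the Cauchy--Riemann operator, with no equation to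
  be solved: the conjugate of \<open>f\<close> times the Gaussian is the \<open>z\<close>-conjugate derivative
  of an explicit function \<open>W\<close> with poles at the \<open>\<lambda>\<close>, the principal parts of which carry the
  coefficients \<open>c\<close>. Each disc of radius \<open>\<surd>(m\<^sub>\<lambda>/\<alpha>) + C\<close> has more than the mass \<open>m\<^sub>\<lambda>\<close>, so
  there is a subharmonic weight, dominated by \<open>\<alpha> \<bar>z\<bar>\<^sup>2\<close>, with logarithmic poles \<open>2 m\<^sub>\<lambda> log \<bar>z - \<lambda>\<bar>\<close>
  that cancel the poles of \<open>W\<close>, and with Laplacian bounded below on annuli around the
  \<open>\<lambda>\<close>. The basic weighted estimate then bounds \<open>W\<close> on these annuli by \<open>f\<close>, and \<open>c\<close> is recovered
  from \<open>W\<close> there by integrating against a cut-off.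
\<close>

subsection \<open>Integration over the plane\<close>

text \<open>The obstacle is that multiplicities are unbounded, so no constant may depend on
  \<open>m\<close>. Both halves live on the square root scale. A coherent state at w has, in
  coordinates centred at l, Poisson coefficients of mean \<alpha> |w - l|^2, and a Poisson law has
  bounded spread after taking square roots; hence a fixed margin c in the radius leaves a tail of at
  most exp (-\<alpha> c^2), whatever \<open>m\<close> is. This is the origin of sqrt (m/\<alpha>).
  For sufficiency put r = sqrt (m/\<alpha>) and R = r + C. In the variable s = |z - l|^2 the annulus
  has width R^2 - r^2 = C (R + r), which grows like the radius. A cut-off across it has slope of
  order 1/(C R), and multiplied by |z - l| \<le> R this is of order 1/C. Likewise the swept-out
  weight changes between s = r^2 and s = R^2 by at most a factor that depends on \<alpha> and C. So
  the Riesz bound depends on \<alpha> and C alone, and finite subdivisors suffice because their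
  constants agree.\<close>

lemma integrable_compact_support:
  fixes f :: "'a::euclidean_space \<Rightarrow> 'b::{banach, second_countable_topology}"
  assumes "continuous_on UNIV f" "\<And>x. norm x > R \<Longrightarrow> f x = 0"
  shows "integrable lborel f"
proof -
  have "integrable lborel (\<lambda>x. indicator (cball 0 R) x *\<^sub>R f x)"
    by (intro borel_integrable_compact continuous_on_subset[OF assms(1)]) auto
  also have "(\<lambda>x. indicator (cball 0 R) x *\<^sub>R f x) = f"
    using assms(2) by (auto simp: indicator_def not_le)
  finally show ?thesis .
qed

lemma bounded_compact_support:
  fixes f :: "'a::euclidean_space \<Rightarrow> 'b::real_normed_vector"
  assumes "continuous_on UNIV f" "\<And>x. norm x > R \<Longrightarrow> f x = 0"
  obtains B where "B > 0" "\<And>x. norm (f x) \<le> B"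
proof -
  have "compact (f ` cball 0 R)"
    by (intro compact_continuous_image continuous_on_subset[OF assms(1)]) auto
  then obtain B where B: "B > 0" "\<And>x. norm x \<le> R \<Longrightarrow> norm (f x) \<le> B"
    by (auto dest!: compact_imp_bounded simp: bounded_pos)
  have "norm (f x) \<le> B" for x
    using B assms(2)[of x] by (cases "norm x \<le> R") auto
  with B(1) show thesis by (rule that)
qed

lemma integrable_translate:
  fixes f :: "'a::euclidean_space \<Rightarrow> 'b::{banach, second_countable_topology}"
  shows "integrable lborel (\<lambda>x. f (x + c)) \<longleftrightarrow> integrable lborel f"
proof -
  have *: "integrable lborel (\<lambda>x. f (x + c))" if "integrable lborel f" for f :: "'a \<Rightarrow> 'b" and c
    using that integrable_distr[of "(+) c" lborel borel f]
    by (simp add: lborel_distr_plus add.commute)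
  from *[of f c] *[of "\<lambda>x. f (x + c)" "-c"] show ?thesis by auto
qed

lemma integral_translate:
  fixes f :: "'a::euclidean_space \<Rightarrow> 'b::{banach, second_countable_topology}"
  shows "(LINT x|lborel. f (x + c)) = (LINT x|lborel. f x)"
proof (cases "integrable lborel f")
  case True
  then have "f \<in> borel_measurable borel" by auto
  then have "integral\<^sup>L (distr lborel borel ((+) c)) f = (LINT x|lborel. f (c + x))"
    by (intro integral_distr) auto
  then show ?thesis by (simp add: lborel_distr_plus add.commute)
next
  case False
  then show ?thesis
    by (simp add: integrable_translate not_integrable_integral_eq)
qed

text \<open>Translation invariance replaces Fubini: every difference quotient of \<open>f\<close>
  has integral 0, and by the mean value inequality these quotients are dominated by a constant on a
  fixed ball.\<close>

lemma integral_directional_derivative_eq_0: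
  fixes f :: "'a::euclidean_space \<Rightarrow> 'b::{banach, second_countable_topology}"
  assumes deriv: "\<And>x. (f has_derivative f' x) (at x)"
    and cont: "continuous_on UNIV (\<lambda>x. f' x v)"
    and supp: "\<And>x. norm x > R \<Longrightarrow> f x = 0"
  shows "(LINT x|lborel. f' x v) = 0"
proof -
  have contf: "continuous_on UNIV f"
    using deriv by (meson has_derivative_continuous continuous_at_imp_continuous_on)
  have line: "((\<lambda>t. f (x + t *\<^sub>R v)) has_vector_derivative f' (x + t *\<^sub>R v) v) (at t)" for x t
  proof -
    have "((\<lambda>t. f (x + t *\<^sub>R v)) has_derivative (\<lambda>h. f' (x + t *\<^sub>R v) (h *\<^sub>R v))) (at t)"
      by (rule has_derivative_compose[OF _ deriv, of "\<lambda>t. x + t *\<^sub>R v" "\<lambda>h. h *\<^sub>R v"])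
         (auto intro!: derivative_eq_intros)
    moreover have "f' (x + t *\<^sub>R v) (h *\<^sub>R v) = h *\<^sub>R f' (x + t *\<^sub>R v) v" for h
      using deriv[of "x + t *\<^sub>R v"] by (simp add: linear_simps has_derivative_bounded_linear)
    ultimately show ?thesis by (simp add: has_vector_derivative_def)
  qed
  have supp': "f' x v = 0" if "norm x > R" for x
  proof -
    have "eventually (\<lambda>y. f y = 0) (at x)"
    proof -
      have "open {y::'a. norm y > R}" by (intro open_Collect_less continuous_intros)
      then have "eventually (\<lambda>y. y \<in> {y. norm y > R}) (at x)"
        using that by (intro eventually_at_in_open') auto
      then show ?thesis by eventually_elim (auto simp: supp)
    qed
    then have "(f has_derivative (\<lambda>_. 0)) (at x)"
      by (intro has_derivative_transform_eventually[OF has_derivative_const[of 0]])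
         (auto simp: supp that elim!: eventually_mono)
    with deriv have "f' x = (\<lambda>_. 0)" by (rule has_derivative_unique)
    then show ?thesis by simp
  qed
  obtain B where B: "B > 0" "\<And>x. norm (f' x v) \<le> B"
    using bounded_compact_support[OF cont supp'] by blast
  define h where "h n = 1 / real (Suc n)" for n
  have h: "0 < h n" "h n \<le> 1" for n by (auto simp: h_def)
  define g where "g n x = (f (x + h n *\<^sub>R v) - f x) /\<^sub>R h n" for n x
  have g_bound: "norm (g n x) \<le> B" for n x
  proof -
    have "norm (f (x + h n *\<^sub>R v) - f (x + 0 *\<^sub>R v)) \<le> B * h n - B * 0"
    proof (rule differentiable_bound_general[where f'="\<lambda>t. f' (x + t *\<^sub>R v) v" and \<phi>'="\<lambda>_. B" and \<phi>="\<lambda>t. B * t"])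
      show "continuous_on {0..h n} (\<lambda>t. f (x + t *\<^sub>R v))"
        by (intro continuous_on_compose2[OF contf] continuous_intros) auto
    qed (use h B line in \<open>auto intro!: continuous_intros derivative_eq_intros simp: has_vector_derivative_def\<close>)
    then show ?thesis using h[of n]
      by (simp add: g_def divide_inverse_commute[symmetric] pos_divide_le_eq mult.commute)
  qed
  \<comment> \<open>Since \<open>h n\<close> \<le> 1, all quotients live on one ball, enlarged by
    \<open>norm v\<close>.\<close>
  have g_zero: "g n x = 0" if "norm x > R + norm v" for n x
  proof -
    have "h n * norm v \<le> norm v"
      using h[of n] by (simp add: mult_left_le_one_le)
    moreover have "norm x \<le> norm (x + h n *\<^sub>R v) + norm (h n *\<^sub>R v)"
      by (metis add_diff_cancel_right' norm_triangle_ineq4)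
    ultimately have "norm (x + h n *\<^sub>R v) > R" using that h[of n] by simp
    moreover have "norm x > R" using that norm_ge_zero[of v] by linarith
    ultimately show ?thesis by (simp add: g_def supp)
  qed
  have int_f: "integrable lborel f" by (rule integrable_compact_support[OF contf supp])
  have "(\<lambda>n. LINT x|lborel. g n x) \<longlonglongrightarrow> (LINT x|lborel. f' x v)"
  proof (rule integral_dominated_convergence[where w="\<lambda>x. B * indicator (cball 0 (R + norm v)) x"])
    show "(\<lambda>x. f' x v) \<in> borel_measurable lborel"
      using cont by (simp add: borel_measurable_continuous_onI)
    show "g n \<in> borel_measurable lborel" for n
      unfolding g_def
      by (auto intro!: borel_measurable_continuous_onI continuous_intros continuous_on_compose2[OF contf])
    show "integrable lborel (\<lambda>x. B * indicator (cball 0 (R + norm v)) x :: real)"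
      by (intro integrable_mult_right integrable_real_indicator) (use emeasure_lborel_cball_finite in auto)
    show "AE x in lborel. norm (g n x) \<le> B * indicator (cball 0 (R + norm v)) x" for n
      using g_bound g_zero by (auto simp: indicator_def not_le)
    show "AE x in lborel. (\<lambda>n. g n x) \<longlonglongrightarrow> f' x v"
    proof (rule AE_I2)
      fix x
      have "((\<lambda>t. (f (x + t *\<^sub>R v) - f (x + 0 *\<^sub>R v)) /\<^sub>R (t - 0)) \<longlongrightarrow> f' (x + 0 *\<^sub>R v) v) (at 0)"
      proof (subst LIM_zero_iff[symmetric], rule tendsto_norm_zero_cancel)
        have "((\<lambda>t. norm (f (x + t *\<^sub>R v) - f (x + 0 *\<^sub>R v) - (t - 0) *\<^sub>R f' (x + 0 *\<^sub>R v) v) / norm (t - 0)) \<longlongrightarrow> 0) (at 0)"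
          using line[of x 0] unfolding has_vector_derivative_def has_derivative_iff_norm by auto
        then show "((\<lambda>t. norm ((f (x + t *\<^sub>R v) - f (x + 0 *\<^sub>R v)) /\<^sub>R (t - 0) - f' (x + 0 *\<^sub>R v) v)) \<longlongrightarrow> 0) (at 0)"
        proof (rule Lim_transform_eventually)
          have "norm (a - t *\<^sub>R b) / norm t = norm (a /\<^sub>R t - b)" if "t \<noteq> 0" for a b :: 'b and t :: real
          proof -
            have "a /\<^sub>R t - b = (a - t *\<^sub>R b) /\<^sub>R t" using that by (simp add: algebra_simps)
            then show ?thesis by (simp add: divide_inverse mult.commute)
          qed
          then show "\<forall>\<^sub>F t in at 0. norm (f (x + t *\<^sub>R v) - f (x + 0 *\<^sub>R v) - (t - 0) *\<^sub>R f' (x + 0 *\<^sub>R v) v) / norm (t - 0) =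
             norm ((f (x + t *\<^sub>R v) - f (x + 0 *\<^sub>R v)) /\<^sub>R (t - 0) - f' (x + 0 *\<^sub>R v) v)"
            by (auto simp: eventually_at_filter)
        qed
      qed
      moreover have "filterlim h (at 0) sequentially"
        unfolding h_def using LIMSEQ_inverse_real_of_nat
        by (intro filterlim_atI) (auto simp: inverse_eq_divide)
      ultimately have "(\<lambda>n. (f (x + h n *\<^sub>R v) - f (x + 0 *\<^sub>R v)) /\<^sub>R (h n - 0)) \<longlonglongrightarrow> f' (x + 0 *\<^sub>R v) v"
        by (rule filterlim_compose)
      then show "(\<lambda>n. g n x) \<longlonglongrightarrow> f' x v" by (simp add: g_def)
    qed
  qed
  moreover have "(LINT x|lborel. g n x) = 0" for n
    using int_f by (simp add: g_def integrable_translate integral_translate)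
  ultimately show ?thesis by (simp add: LIMSEQ_const_iff)
qed

text \<open>The disc |z|^2 < t has area pi t, which is linear in t. So |z|^2 is a radial variable
  without Jacobian, and half-lines form an intersection-stable generator on which the two measures
  agree.\<close>

lemma distr_cmod_power2:
  "distr lborel borel (\<lambda>z. (cmod z)\<^sup>2) = density lborel (\<lambda>s. ennreal pi * indicator {0..} s)"
proof (rule measure_eqI_generator_eq[where E="range (lessThan :: real \<Rightarrow> real set)" and \<Omega>=UNIV
      and A="\<lambda>i. {..<real i}"])
  have eq: "emeasure (distr lborel borel (\<lambda>z. (cmod z)\<^sup>2)) {..<t} = ennreal (pi * max 0 t)" for t
  proof -
    have "(\<lambda>z. (cmod z)\<^sup>2) -` {..<t} \<inter> space lborel = ball 0 (sqrt (max 0 t))"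
      by (auto simp: real_less_rsqrt max_def not_less dest: power2_less_imp_less)
         (smt (verit) real_sqrt_pow2 real_sqrt_less_iff real_sqrt_abs norm_ge_zero zero_le_power2)+
    moreover have "emeasure lborel (ball (0::complex) (sqrt (max 0 t))) = ennreal (pi * max 0 t)"
      by (subst emeasure_ball) (auto simp: unit_ball_vol_2)
    ultimately show ?thesis by (subst emeasure_distr) auto
  qed
  show "Int_stable (range (lessThan :: real \<Rightarrow> real set))"
  proof (clarsimp simp: Int_stable_def)
    fix a b :: real
    have "{..<a} \<inter> {..<b} = {..<min a b}" by auto
    then show "{..<a} \<inter> {..<b} \<in> range lessThan" by simp
  qed
  show "emeasure (distr lborel borel (\<lambda>z. (cmod z)\<^sup>2)) X =
        emeasure (density lborel (\<lambda>s. ennreal pi * indicator {0..} s)) X"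
    if range: "X \<in> range lessThan" for X
  proof -
    obtain t where X: "X = {..<t}" using range by auto
    have "emeasure (density lborel (\<lambda>s. ennreal pi * indicator {0..} s)) {..<t} =
        (\<integral>\<^sup>+ s. ennreal pi * indicator {0..<t} s \<partial>lborel)"
      by (subst emeasure_density) (auto intro!: nn_integral_cong simp: indicator_def)
    also have "\<dots> = ennreal pi * ennreal (max 0 t)"
      by (subst nn_integral_cmult_indicator) (auto simp: max_def)
    finally show ?thesis by (simp add: X eq ennreal_mult)
  qed
  show "emeasure (distr lborel borel (\<lambda>z. (cmod z)\<^sup>2)) {..<real i} \<noteq> \<infinity>" for i
    by (simp add: eq)
  show "sets (distr lborel borel (\<lambda>z. (cmod z)\<^sup>2)) = sigma_sets UNIV (range (lessThan :: real \<Rightarrow> real set))"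
    by (simp add: borel_eq_lessThan eucl_lessThan)
  show "sets (density lborel (\<lambda>s. ennreal pi * indicator {0..} s)) = sigma_sets UNIV (range (lessThan :: real \<Rightarrow> real set))"
    by (simp add: borel_eq_lessThan eucl_lessThan)
qed (auto intro: reals_Archimedean2)

lemma nn_integral_radial:
  assumes [measurable]: "f \<in> borel_measurable borel"
  shows "(\<integral>\<^sup>+z. f ((cmod z)\<^sup>2) \<partial>lborel) = ennreal pi * (\<integral>\<^sup>+s. f s * indicator {0..} s \<partial>lborel)"
proof -
  have "(\<integral>\<^sup>+z. f ((cmod z)\<^sup>2) \<partial>lborel) = (\<integral>\<^sup>+s. f s \<partial>distr lborel borel (\<lambda>z. (cmod z)\<^sup>2))"
    by (subst nn_integral_distr) auto
  also have "\<dots> = (\<integral>\<^sup>+s. ennreal pi * indicator {0..} s * f s \<partial>lborel)"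
    unfolding distr_cmod_power2 by (subst nn_integral_density) auto
  also have "\<dots> = ennreal pi * (\<integral>\<^sup>+s. f s * indicator {0..} s \<partial>lborel)"
    by (subst nn_integral_cmult[symmetric]) (auto intro!: nn_integral_cong simp: mult_ac)
  finally show ?thesis .
qed

lemma integral_radial:
  fixes f :: "real \<Rightarrow> real"
  assumes [measurable]: "f \<in> borel_measurable borel"
  shows "(LINT z|lborel. f ((cmod z)\<^sup>2)) = pi * (LINT s|lborel. indicator {0..} s * f s)"
proof -
  have "(LINT z|lborel. f ((cmod z)\<^sup>2)) = (LINT s|distr lborel borel (\<lambda>z. (cmod z)\<^sup>2). f s)"
    by (subst integral_distr) auto
  also have "\<dots> = (LINT s|density lborel (\<lambda>s. ennreal (pi * indicator {0..} s)). f s)"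
    unfolding distr_cmod_power2 by (simp add: ennreal_mult ennreal_indicator)
  also have "\<dots> = (LINT s|lborel. (pi * indicator {0..} s) *\<^sub>R f s)"
    by (subst integral_density) auto
  finally show ?thesis by (simp add: mult_ac)
qed

text \<open>The fundamental theorem of calculus in the radial variable \<open>s = \<bar>z\<bar>\<^sup>2\<close>.\<close>

lemma integral_radial_derivative:
  fixes F f :: "real \<Rightarrow> real"
  assumes deriv: "\<And>s. (F has_real_derivative f s) (at s)"
    and cont: "continuous_on UNIV f"
    and supp: "\<And>s. s > R \<Longrightarrow> F s = 0" "\<And>s. s > R \<Longrightarrow> f s = 0"
  shows "(LINT z|lborel. f ((cmod z)\<^sup>2)) = - pi * F 0"
proof -
  define T where "T = max 0 R + 1"
  have "(LINT z|lborel. f ((cmod z)\<^sup>2)) = pi * (LINT s|lborel. indicator {0..} s * f s)"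
    using cont by (intro integral_radial) (simp add: borel_measurable_continuous_onI)
  also have "(LINT s|lborel. indicator {0..} s * f s) = (LINT s|lborel. f s * indicator {0..T} s)"
    using supp(2) by (intro Bochner_Integration.integral_cong) (auto simp: indicator_def T_def)
  also have "\<dots> = F T - F 0"
    using deriv cont by (intro integral_FTC_Icc_real)
      (auto simp: T_def continuous_on_eq_continuous_at)
  also have "F T = 0" by (rule supp) (simp add: T_def)
  finally show ?thesis by simp
qed

subsection \<open>Wirtinger derivatives\<close>

text \<open>\<open>p\<close> and \<open>q\<close> are the derivatives of \<open>f\<close> in z and
  in conjugate z, read off from the real derivative. As a relation it carries differentiability
  along, so sum, product and chain rules need no side conditions.\<close>

definition wirtinger :: "(complex \<Rightarrow> complex) \<Rightarrow> complex \<Rightarrow> complex \<Rightarrow> complex \<Rightarrow> bool" where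
  "wirtinger f p q z \<longleftrightarrow> (f has_derivative (\<lambda>h. p * h + q * cnj h)) (at z)"

lemma wirtinger_const: "wirtinger (\<lambda>_. c) 0 0 z"
  by (simp add: wirtinger_def)

lemma wirtinger_cnj:
  assumes "wirtinger f p q z"
  shows "wirtinger (\<lambda>z. cnj (f z)) (cnj q) (cnj p) z"
proof -
  have "((\<lambda>z. cnj (f z)) has_derivative (\<lambda>h. cnj (p * h + q * cnj h))) (at z)"
    using assms unfolding wirtinger_def by (rule has_derivative_cnj)
  then show ?thesis by (simp add: wirtinger_def add.commute)
qed

lemma wirtinger_add:
  assumes "wirtinger f p q z" "wirtinger g p' q' z"
  shows "wirtinger (\<lambda>z. f z + g z) (p + p') (q + q') z"
  using has_derivative_add[OF assms[unfolded wirtinger_def]]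
  by (simp add: wirtinger_def algebra_simps)

lemma wirtinger_mult:
  assumes "wirtinger f p q z" "wirtinger g p' q' z"
  shows "wirtinger (\<lambda>z. f z * g z) (p * g z + f z * p') (q * g z + f z * q') z"
  using has_derivative_mult[OF assms[unfolded wirtinger_def]]
  by (simp add: wirtinger_def algebra_simps)

lemma wirtinger_holomorphic:
  assumes "(f has_field_derivative p) (at z)"
  shows "wirtinger f p 0 z"
  using assms by (simp add: wirtinger_def has_field_derivative_def)

lemma wirtinger_holomorphic_deriv:
  assumes "f holomorphic_on UNIV"
  shows "wirtinger f (deriv f z) 0 z"
  using assms by (intro wirtinger_holomorphic holomorphic_derivI[of f UNIV]) auto

lemma wirtinger_radial:
  assumes "(g has_real_derivative g') (at ((cmod (z - l))\<^sup>2))"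
  shows "wirtinger (\<lambda>z. of_real (g ((cmod (z - l))\<^sup>2)))
           (of_real g' * cnj (z - l)) (of_real g' * (z - l)) z"
proof -
  have 1: "((\<lambda>z. (cmod (z - l))\<^sup>2) has_derivative (\<lambda>h. 2 * inner (z - l) h)) (at z)"
    unfolding power2_norm_eq_inner
    by (auto intro!: derivative_eq_intros simp: inner_commute)
  have "((\<lambda>z. g ((cmod (z - l))\<^sup>2)) has_derivative (\<lambda>h. g' * (2 * inner (z - l) h))) (at z)"
    by (rule has_derivative_compose[OF 1 assms[unfolded has_field_derivative_def]])
  then have "((\<lambda>z. complex_of_real (g ((cmod (z - l))\<^sup>2))) has_derivative
      (\<lambda>h. of_real (g' * (2 * inner (z - l) h)))) (at z)"
    by (rule has_derivative_of_real)
  moreover have "complex_of_real (g' * (2 * inner (z - l) h)) =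
      of_real g' * cnj (z - l) * h + of_real g' * (z - l) * cnj h" for h
    by (simp add: complex_eq_iff inner_complex_def algebra_simps)
  ultimately show ?thesis by (simp add: wirtinger_def)
qed

lemma wirtinger_exp:
  assumes "wirtinger f p q z"
  shows "wirtinger (\<lambda>z. exp (f z)) (exp (f z) * p) (exp (f z) * q) z"
proof -
  have "((\<lambda>z. exp (f z)) has_derivative (\<lambda>h. exp (f z) * (p * h + q * cnj h))) (at z)"
    by (rule has_derivative_compose[OF assms[unfolded wirtinger_def] DERIV_exp[unfolded has_field_derivative_def]])
  then show ?thesis by (simp add: wirtinger_def algebra_simps)
qed

lemma wirtinger_transform:
  assumes "wirtinger f p q z" "open S" "z \<in> S" "\<And>w. w \<in> S \<Longrightarrow> f w = g w"
  shows "wirtinger g p q z"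
  using assms unfolding wirtinger_def by (meson has_derivative_transform_within_open)

lemma continuous_on_wirtinger:
  assumes "\<And>z. wirtinger f (p z) (q z) z"
  shows "continuous_on UNIV f"
  using assms unfolding wirtinger_def
  by (meson continuous_at_imp_continuous_on has_derivative_continuous)

text \<open>Stokes' theorem for compact support: the derivatives in the directions 1 and i are p + q
  and i (p - q), and both integrate to 0.\<close>

lemma integral_wirtinger_eq_0:
  assumes w: "\<And>z. wirtinger f (p z) (q z) z"
    and p: "continuous_on UNIV p" and q: "continuous_on UNIV q"
    and supp: "\<And>z. cmod z > R \<Longrightarrow> f z = 0"
  shows "integrable lborel p" "integrable lborel q"
    "(LINT z|lborel. p z) = 0" "(LINT z|lborel. q z) = 0"
proof -
  have *: "p z = 0 \<and> q z = 0" if "cmod z > R" for z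
  proof -
    have "wirtinger f 0 0 z"
      by (rule wirtinger_transform[OF wirtinger_const[of 0], of "{z. cmod z > R}"])
         (use that supp in \<open>auto intro!: open_Collect_less continuous_intros\<close>)
    with w[of z] have "(\<lambda>h. p z * h + q z * cnj h) = (\<lambda>h. 0 * h + 0 * cnj h)"
      unfolding wirtinger_def by (rule has_derivative_unique)
    then have "p z * h + q z * cnj h = 0" for h by (metis add.left_neutral mult_zero_left)
    from this[of 1] this[of \<i>] show ?thesis
      by (simp add: complex_eq_iff)
  qed
  show ip: "integrable lborel p" and iq: "integrable lborel q"
    using * by (auto intro!: integrable_compact_support[OF p] integrable_compact_support[OF q])
  have "(LINT z|lborel. p z * v + q z * cnj v) = 0" for v
    by (rule integral_directional_derivative_eq_0[where f=f and R=R])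
       (use w supp in \<open>auto simp: wirtinger_def intro!: continuous_intros p q\<close>)
  from this[of 1] this[of \<i>] ip iq
  show "(LINT z|lborel. p z) = 0" "(LINT z|lborel. q z) = 0"
    by (auto simp: complex_eq_iff)
qed

subsection \<open>Taylor coefficients as radially weighted integrals\<close>

lemma antiderivative_nonneg:
  fixes f :: "real \<Rightarrow> real"
  assumes "continuous_on UNIV f"
  obtains F where "\<And>s. s \<ge> 0 \<Longrightarrow> (F has_real_derivative f s) (at s)"
proof
  fix s :: real
  assume "s \<ge> 0"
  \<comment> \<open>Starting at -1 instead of 0 makes the derivative at s = 0 two-sided.\<close>
  have "((\<lambda>u. integral {-1..u} f) has_real_derivative f s) (at s within {-1..s+1})"
    by (rule integral_has_real_derivative[OF continuous_on_subset[OF assms]]) (use \<open>s \<ge> 0\<close> in auto)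
  then show "((\<lambda>u. integral {-1..u} f) has_real_derivative f s) (at s)"
    using \<open>s \<ge> 0\<close> by (simp add: at_within_Icc_at)
qed

text \<open>With \<open>N\<close> the antiderivative of \<kappa> that vanishes for large s, the
  integrand is the conjugate-z derivative of q N(|z|^2), a function of compact support. This does
  the work of integrating over the angle.\<close>

lemma integral_radial_orthogonal:
  assumes q: "q holomorphic_on UNIV"
    and cont: "continuous_on UNIV \<kappa>" and supp: "\<And>s. s > R \<Longrightarrow> \<kappa> s = 0"
  shows "(LINT z|lborel. q z * z * of_real (\<kappa> ((cmod z)\<^sup>2))) = 0"
proof -
  define T where "T = max 0 R + 1"
  have \<kappa>T: "\<kappa> s = 0" if "s \<ge> T" for s using supp[of s] that by (simp add: T_def)
  obtain F where F: "\<And>s. s \<ge> 0 \<Longrightarrow> (F has_real_derivative \<kappa> s) (at s)"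
    using antiderivative_nonneg[OF cont] by blast
  define N where "N s = F s - F T" for s
  have N: "(N has_real_derivative \<kappa> s) (at s)" if "s \<ge> 0" for s
    unfolding N_def using F[OF that] by (auto intro!: derivative_eq_intros)
  have N0: "N s = 0" if "s \<ge> T" for s
  proof (cases "s = T")
    case False
    have T: "T > 0" by (simp add: T_def)
    have "F s = F T"
    proof (rule DERIV_isconst_end[where f=F and a=T and b=s])
      show "T < s" using that False by simp
      show "continuous_on {T..s} F"
      proof (intro continuous_at_imp_continuous_on ballI)
        show "isCont F x" if "x \<in> {T..s}" for x using DERIV_isCont[OF F[of x]] that T by simp
      qed
      show "(F has_real_derivative 0) (at x)" if "T < x" "x < s" for x
        using F[of x] \<kappa>T[of x] that T by simp
    qed
    then show ?thesis by (simp add: N_def)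
  qed (simp add: N_def)
  have w: "wirtinger (\<lambda>z. q z * of_real (N ((cmod z)\<^sup>2)))
     (deriv q z * of_real (N ((cmod z)\<^sup>2)) + q z * (of_real (\<kappa> ((cmod z)\<^sup>2)) * cnj z))
     (q z * z * of_real (\<kappa> ((cmod z)\<^sup>2))) z" for z
    using wirtinger_mult[OF wirtinger_holomorphic_deriv[OF q] wirtinger_radial[of N "\<kappa> ((cmod z)\<^sup>2)" z 0]] N
    by (simp add: mult_ac)
  have cq: "continuous_on UNIV q" and cdq: "continuous_on UNIV (deriv q)"
    using q by (auto intro!: holomorphic_on_imp_continuous_on holomorphic_deriv)
  have "continuous_on {0..} N"
    using N by (meson DERIV_isCont atLeast_iff continuous_at_imp_continuous_on)
  then have cN: "continuous_on UNIV (\<lambda>z. N ((cmod z)\<^sup>2))"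
    by (rule continuous_on_compose2) (auto intro!: continuous_intros)
  have c\<kappa>: "continuous_on UNIV (\<lambda>z. \<kappa> ((cmod z)\<^sup>2))"
    by (rule continuous_on_compose2[OF cont]) (auto intro!: continuous_intros)
  show ?thesis
  proof (rule integral_wirtinger_eq_0(4)[OF w])
    show "q z * of_real (N ((cmod z)\<^sup>2)) = 0" if "cmod z > T" for z
    proof -
      have "T \<ge> 1" by (simp add: T_def)
      then have "T * 1 \<le> cmod z * cmod z" using that by (intro mult_mono) auto
      then show ?thesis by (simp add: N0 power2_eq_square)
    qed
  qed (intro continuous_intros cq cdq cN c\<kappa>)+
qed

lemma power_mult_power_cnj: "z ^ k * cnj z ^ k = of_real (((cmod z)\<^sup>2) ^ k)"
proof -
  have "z * cnj z = of_real ((cmod z)\<^sup>2)" by (rule complex_norm_square[symmetric])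
  then show ?thesis by (simp only: power_mult_distrib[symmetric] of_real_power)
qed

text \<open>Splitting off finitely many Taylor terms avoids interchanging an infinite series with an
  integral; the remainder has the form that \<open>integral_radial_orthogonal\<close> kills.\<close>

lemma entire_Taylor_remainder:
  assumes f: "f holomorphic_on UNIV"
  obtains q where "q holomorphic_on UNIV"
    "\<And>z. f z = (\<Sum>j<n. (deriv ^^ j) f 0 / fact j * z ^ j) + z ^ n * q z"
proof -
  define c where "c j = (deriv ^^ j) f 0 / fact j" for j
  have sums: "(\<lambda>j. c j * z ^ j) sums f z" for z
    using holomorphic_power_series[of f 0 "cmod z + 1" z] holomorphic_on_subset[OF f]
    by (simp add: c_def)
  define q where "q z = (if z = 0 then c n else (f z - (\<Sum>j<n. c j * z ^ j)) / z ^ n)" for z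
  have "(\<lambda>j. c (j + n) * z ^ j) sums q z" for z
  proof (cases "z = 0")
    case True
    then show ?thesis using powser_sums_zero[of "\<lambda>j. c (j + n)"]
      by (simp add: q_def)
  next
    case False
    have "(\<lambda>j. c (j + n) * z ^ (j + n) / z ^ n) sums ((f z - (\<Sum>j<n. c j * z ^ j)) / z ^ n)"
      by (intro sums_divide sums_split_initial_segment[OF sums])
    then show ?thesis using False by (simp add: q_def power_add)
  qed
  then have "q holomorphic_on ball 0 r" for r
    by (intro power_series_holomorphic[where a="\<lambda>j. c (j + n)"]) auto
  then have "q holomorphic_on (\<Union>r::real. ball 0 r)"
    by (intro holomorphic_on_UN_open) auto
  moreover have "(\<Union>r::real. ball 0 r) = (UNIV :: complex set)"
    by (auto intro: gt_ex)
  ultimately have "q holomorphic_on UNIV" by simp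
  moreover have "f z = (\<Sum>j<n. c j * z ^ j) + z ^ n * q z" for z
  proof (cases "z = 0 \<and> n > 0")
    case True
    then obtain m where "n = Suc m" by (cases n) auto
    with True show ?thesis
      by (simp add: sum.lessThan_Suc_shift c_def del: sum.lessThan_Suc)
  qed (use sums[of 0] in \<open>auto simp: q_def c_def\<close>)
  ultimately show thesis using that by (simp add: c_def)
qed

context
  fixes \<kappa> :: "real \<Rightarrow> real" and R :: real
  assumes cont: "continuous_on UNIV \<kappa>" and supp: "\<And>s. s > R \<Longrightarrow> \<kappa> s = 0"
begin

lemma continuous_on_radial: "continuous_on UNIV (\<lambda>z::complex. \<kappa> ((cmod z)\<^sup>2))"
  by (rule continuous_on_compose2[OF cont]) (auto intro!: continuous_intros)

lemma radial_compact_support: "cmod z > max 1 R \<Longrightarrow> \<kappa> ((cmod z)\<^sup>2) = 0"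
proof (rule supp)
  assume *: "cmod z > max 1 R"
  then have "max 1 R * 1 < cmod z * cmod z" by (intro mult_strict_mono) auto
  then show "R < (cmod z)\<^sup>2" by (simp add: power2_eq_square)
qed

lemma integrable_mult_radial:
  assumes "continuous_on UNIV (h :: complex \<Rightarrow> complex)"
  shows "integrable lborel (\<lambda>z. h z * of_real (\<kappa> ((cmod z)\<^sup>2)))"
  using radial_compact_support
  by (intro integrable_compact_support[where R="max 1 R"] continuous_intros assms continuous_on_radial) auto

lemma integral_monomials_radial:
  assumes "j \<noteq> k"
  shows "(LINT z|lborel. z ^ j * cnj z ^ k * of_real (\<kappa> ((cmod z)\<^sup>2))) = 0"
proof -
  \<comment> \<open>For j > k the factor |z|^(2 k) is moved into the radial weight and at least one
    z is left over; the case j < k follows by conjugation.\<close>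
  have *: "(LINT z|lborel. z ^ j * cnj z ^ k * of_real (\<kappa> ((cmod z)\<^sup>2))) = 0" if "j > k" for j k :: nat
  proof -
    have "z ^ j * cnj z ^ k * of_real (\<kappa> ((cmod z)\<^sup>2)) =
          z ^ (j - k - 1) * z * of_real (((cmod z)\<^sup>2) ^ k * \<kappa> ((cmod z)\<^sup>2))" for z
    proof -
      have "z ^ j = z ^ (Suc (j - k - 1) + k)" using that by simp
      also have "\<dots> = z ^ (j - k - 1) * z * z ^ k" by (simp only: power_add power_Suc2)
      finally have "z ^ j * cnj z ^ k = z ^ (j - k - 1) * z * (z ^ k * cnj z ^ k)" by (simp only: mult_ac)
      then show ?thesis by (simp only: power_mult_power_cnj of_real_mult mult.assoc)
    qed
    moreover have "(LINT z|lborel. z ^ (j - k - 1) * z * of_real (((cmod z)\<^sup>2) ^ k * \<kappa> ((cmod z)\<^sup>2))) = 0"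
      by (rule integral_radial_orthogonal[where \<kappa>="\<lambda>s. s ^ k * \<kappa> s" and R=R])
         (auto intro!: holomorphic_intros continuous_intros cont supp)
    ultimately show ?thesis by (simp only:)
  qed
  show ?thesis
  proof (cases "j > k")
    case False
    then have "(LINT z|lborel. z ^ k * cnj z ^ j * of_real (\<kappa> ((cmod z)\<^sup>2))) = 0"
      using assms by (intro *) auto
    then have "cnj (LINT z|lborel. z ^ k * cnj z ^ j * of_real (\<kappa> ((cmod z)\<^sup>2))) = 0" by simp
    then have "(LINT z|lborel. cnj (z ^ k * cnj z ^ j * of_real (\<kappa> ((cmod z)\<^sup>2)))) = 0"
      by (subst Bochner_Integration.integral_cnj)
    moreover have "cnj (z ^ k * cnj z ^ j * of_real (\<kappa> ((cmod z)\<^sup>2))) =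
        z ^ j * cnj z ^ k * of_real (\<kappa> ((cmod z)\<^sup>2))" for z by simp
    ultimately show ?thesis by (simp only:)
  qed (rule *)
qed

text \<open>The mean value property for all Taylor coefficients: lower terms are orthogonal to the
  k-th monomial, and the remainder times the conjugate k-th power is q z |z|^(2 k), which has
  integral 0 as well.\<close>

lemma integral_entire_radial:
  assumes f: "f holomorphic_on UNIV"
  shows "(LINT z|lborel. f z * cnj z ^ k * of_real (\<kappa> ((cmod z)\<^sup>2))) =
    (deriv ^^ k) f 0 / fact k * of_real (LINT z|lborel. ((cmod z)\<^sup>2) ^ k * \<kappa> ((cmod z)\<^sup>2))"
proof -
  define c where "c j = (deriv ^^ j) f 0 / fact j" for j
  obtain q where q: "q holomorphic_on UNIV" "\<And>z. f z = (\<Sum>j<Suc k. c j * z ^ j) + z ^ Suc k * q z"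
    using entire_Taylor_remainder[OF f, of "Suc k"] by (auto simp: c_def)
  let ?K = "\<lambda>z. of_real (\<kappa> ((cmod z)\<^sup>2)) :: complex"
  have cq: "continuous_on UNIV q" using q(1) by (rule holomorphic_on_imp_continuous_on)
  note zk = power_mult_power_cnj
  define A where "A j z = z ^ j * cnj z ^ k * ?K z" for j z
  define D where "D z = q z * z * of_real (((cmod z)\<^sup>2) ^ k * \<kappa> ((cmod z)\<^sup>2))" for z
  have zk': "z ^ Suc k * q z * cnj z ^ k * ?K z = D z" for z
  proof -
    have "z ^ Suc k * q z * cnj z ^ k * ?K z = q z * z * (z ^ k * cnj z ^ k) * ?K z"
      by (simp only: power_Suc mult_ac)
    then show ?thesis by (simp only: D_def zk of_real_mult mult.assoc)
  qed
  have eq: "f z * cnj z ^ k * ?K z = (\<Sum>j<Suc k. c j * A j z) + D z" for z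
    unfolding q(2)[of z] distrib_right sum_distrib_right zk' A_def by (simp only: mult.assoc)
  have intA: "integrable lborel (A j)" for j
    unfolding A_def by (intro integrable_mult_radial continuous_intros)
  have intD: "integrable lborel D"
    unfolding D_def of_real_mult mult.assoc[symmetric]
    by (intro integrable_mult_radial continuous_intros cq)
  have "(LINT z|lborel. f z * cnj z ^ k * ?K z) = (\<Sum>j<Suc k. c j * integral\<^sup>L lborel (A j)) + integral\<^sup>L lborel D"
  proof -
    have int: "integrable lborel (\<lambda>z. c j * A j z)" for j
      using intA by (rule integrable_mult_right)
    have "(LINT z|lborel. f z * cnj z ^ k * ?K z) = (LINT z|lborel. (\<Sum>j<Suc k. c j * A j z) + D z)"
      by (simp only: eq)
    also have "\<dots> = (LINT z|lborel. (\<Sum>j<Suc k. c j * A j z)) + integral\<^sup>L lborel D"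
      by (intro Bochner_Integration.integral_add Bochner_Integration.integrable_sum int intD)
    also have "(LINT z|lborel. (\<Sum>j<Suc k. c j * A j z)) = (\<Sum>j<Suc k. LINT z|lborel. c j * A j z)"
      by (intro Bochner_Integration.integral_sum int)
    finally show ?thesis by (simp only: integral_mult_right_zero)
  qed
  also have "integral\<^sup>L lborel D = 0"
    unfolding D_def
    by (rule integral_radial_orthogonal[where \<kappa>="\<lambda>s. s ^ k * \<kappa> s" and R=R])
       (auto intro!: q continuous_intros cont supp)
  also have "(\<Sum>j<Suc k. c j * integral\<^sup>L lborel (A j)) = c k * integral\<^sup>L lborel (A k)"
  proof -
    have "integral\<^sup>L lborel (A j) = 0" if "j < k" for j
      unfolding A_def by (rule integral_monomials_radial) (use that in auto)
    then show ?thesis by simp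
  qed
  also have "integral\<^sup>L lborel (A k) = of_real (LINT z|lborel. ((cmod z)\<^sup>2) ^ k * \<kappa> ((cmod z)\<^sup>2))"
    unfolding A_def zk of_real_mult[symmetric] by (rule integral_complex_of_real)
  finally show ?thesis by (simp only: c_def add_0_right)
qed

end

lemma integral_entire_radial':
  fixes w :: "real \<Rightarrow> real"
  assumes f: "f holomorphic_on UNIV" and cont: "continuous_on UNIV w"
    and int: "integrable lborel (\<lambda>z. f z * cnj z ^ k * of_real (w ((cmod z)\<^sup>2)))"
    and int': "integrable lborel (\<lambda>z::complex. ((cmod z)\<^sup>2) ^ k * w ((cmod z)\<^sup>2))"
  shows "(LINT z|lborel. f z * cnj z ^ k * of_real (w ((cmod z)\<^sup>2))) =
    (deriv ^^ k) f 0 / fact k * of_real (LINT z|lborel. ((cmod z)\<^sup>2) ^ k * w ((cmod z)\<^sup>2))"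
proof -
  \<comment> \<open>Tents that increase to 1: continuity of the weight is all that the compactly
    supported case asks for.\<close>
  define t where "t n s = max 0 (1 - s / real (Suc n))" for n s
  have t: "\<bar>t n ((cmod z)\<^sup>2)\<bar> \<le> 1" for n z by (simp add: t_def)
  have t_lim: "(\<lambda>n. t n s) \<longlonglongrightarrow> 1" for s
  proof -
    have "(\<lambda>n. max 0 (1 - s * inverse (real (Suc n)))) \<longlonglongrightarrow> max 0 (1 - s * 0)"
      by (intro tendsto_intros LIMSEQ_inverse_real_of_nat)
    then show ?thesis by (simp add: t_def divide_inverse)
  qed
  have cont_t: "continuous_on UNIV (t n)" for n
    unfolding t_def by (intro continuous_intros) auto
  have *: "(LINT z|lborel. f z * cnj z ^ k * of_real (t n ((cmod z)\<^sup>2) * w ((cmod z)\<^sup>2))) =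
    (deriv ^^ k) f 0 / fact k * of_real (LINT z|lborel. ((cmod z)\<^sup>2) ^ k * (t n ((cmod z)\<^sup>2) * w ((cmod z)\<^sup>2)))" for n
    by (rule integral_entire_radial[where R="real (Suc n)"])
       (auto intro!: continuous_intros cont cont_t f simp: t_def field_simps)
  have cw: "continuous_on UNIV (\<lambda>z::complex. w ((cmod z)\<^sup>2))"
    by (rule continuous_on_compose2[OF cont]) (auto intro!: continuous_intros)
  have ct: "continuous_on UNIV (\<lambda>z::complex. t n ((cmod z)\<^sup>2))" for n
    by (rule continuous_on_compose2[OF cont_t]) (auto intro!: continuous_intros)
  have cf: "continuous_on UNIV f" using f by (rule holomorphic_on_imp_continuous_on)
  have bd: "\<bar>t n ((cmod z)\<^sup>2) * x\<bar> \<le> \<bar>x\<bar>" for n z x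
    using t[of n z] by (simp add: abs_mult mult_left_le_one_le)
  have L1: "(\<lambda>n. LINT z|lborel. f z * cnj z ^ k * of_real (t n ((cmod z)\<^sup>2) * w ((cmod z)\<^sup>2)))
      \<longlonglongrightarrow> (LINT z|lborel. f z * cnj z ^ k * of_real (w ((cmod z)\<^sup>2)))"
  proof (rule integral_dominated_convergence[where w="\<lambda>z. cmod (f z * cnj z ^ k * of_real (w ((cmod z)\<^sup>2)))"])
    show "AE z in lborel. (\<lambda>n. f z * cnj z ^ k * of_real (t n ((cmod z)\<^sup>2) * w ((cmod z)\<^sup>2)))
        \<longlonglongrightarrow> f z * cnj z ^ k * of_real (w ((cmod z)\<^sup>2))"
      by (intro AE_I2 tendsto_mult tendsto_const tendsto_of_real)
         (use tendsto_mult[OF t_lim tendsto_const] in auto)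
    show "AE z in lborel. cmod (f z * cnj z ^ k * of_real (t n ((cmod z)\<^sup>2) * w ((cmod z)\<^sup>2)))
         \<le> cmod (f z * cnj z ^ k * of_real (w ((cmod z)\<^sup>2)))" for n
      using bd by (auto simp: norm_mult simp del: of_real_mult intro!: mult_left_mono)
  qed (use int in \<open>auto intro!: borel_measurable_continuous_onI continuous_intros ct cw cf\<close>)
  have L2: "(\<lambda>n. LINT z|lborel. ((cmod z)\<^sup>2) ^ k * (t n ((cmod z)\<^sup>2) * w ((cmod z)\<^sup>2)))
      \<longlonglongrightarrow> (LINT z|lborel. ((cmod z)\<^sup>2) ^ k * w ((cmod z)\<^sup>2))"
  proof (rule integral_dominated_convergence[where w="\<lambda>z. \<bar>((cmod z)\<^sup>2) ^ k * w ((cmod z)\<^sup>2)\<bar>"])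
    show "AE z in lborel. (\<lambda>n. ((cmod z)\<^sup>2) ^ k * (t n ((cmod z)\<^sup>2) * w ((cmod z)\<^sup>2)))
        \<longlonglongrightarrow> ((cmod z)\<^sup>2) ^ k * w ((cmod z)\<^sup>2)"
      by (intro AE_I2 tendsto_mult tendsto_const)
         (use tendsto_mult[OF t_lim tendsto_const] in auto)
    show "AE z in lborel. norm (((cmod z)\<^sup>2) ^ k * (t n ((cmod z)\<^sup>2) * w ((cmod z)\<^sup>2)))
         \<le> \<bar>((cmod z)\<^sup>2) ^ k * w ((cmod z)\<^sup>2)\<bar>" for n
      using bd by (auto simp: abs_mult intro!: mult_left_mono)
  qed (use int' in \<open>auto intro!: borel_measurable_continuous_onI continuous_intros ct cw\<close>)
  show ?thesis
    by (rule LIMSEQ_unique[OF L1]) (unfold *, intro tendsto_intros L2)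
qed

subsection \<open>The Fock space\<close>

lemma fock_spaceD:
  assumes "f \<in> fock_space \<alpha>"
  shows "f holomorphic_on UNIV" "continuous_on UNIV f"
    "integrable lborel (\<lambda>z. (cmod (f z))\<^sup>2 * exp (- \<alpha> * (cmod z)\<^sup>2))"
  using assms by (auto simp: fock_space_def holomorphic_on_imp_continuous_on)

lemma fock_space_zero: "(\<lambda>_. 0) \<in> fock_space \<alpha>"
  by (simp add: fock_space_def)

lemma fock_space_scale: "f \<in> fock_space \<alpha> \<Longrightarrow> (\<lambda>z. c * f z) \<in> fock_space \<alpha>"
  by (auto simp: fock_space_def norm_mult power_mult_distrib mult.assoc intro!: holomorphic_intros)

lemma fock_space_add:
  assumes "f \<in> fock_space \<alpha>" "g \<in> fock_space \<alpha>"
  shows "(\<lambda>z. f z + g z) \<in> fock_space \<alpha>"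
proof -
  note f = fock_spaceD[OF assms(1)] and g = fock_spaceD[OF assms(2)]
  have "integrable lborel (\<lambda>z. (cmod (f z + g z))\<^sup>2 * exp (- \<alpha> * (cmod z)\<^sup>2))"
  proof (rule Bochner_Integration.integrable_bound)
    show "integrable lborel (\<lambda>z. 2 * ((cmod (f z))\<^sup>2 * exp (- \<alpha> * (cmod z)\<^sup>2)) +
        2 * ((cmod (g z))\<^sup>2 * exp (- \<alpha> * (cmod z)\<^sup>2)))"
      using f(3) g(3) by (intro Bochner_Integration.integrable_add integrable_mult_right)
    show "AE z in lborel. norm ((cmod (f z + g z))\<^sup>2 * exp (- \<alpha> * (cmod z)\<^sup>2)) \<le>
        norm (2 * ((cmod (f z))\<^sup>2 * exp (- \<alpha> * (cmod z)\<^sup>2)) + 2 * ((cmod (g z))\<^sup>2 * exp (- \<alpha> * (cmod z)\<^sup>2)))"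
    proof (rule AE_I2)
      fix z
      have "(cmod (f z + g z))\<^sup>2 \<le> (cmod (f z) + cmod (g z))\<^sup>2"
        by (intro power_mono norm_triangle_ineq) auto
      also have "\<dots> \<le> 2 * (cmod (f z))\<^sup>2 + 2 * (cmod (g z))\<^sup>2"
        using sum_squares_bound[of "cmod (f z)" "cmod (g z)"] by (simp add: power2_sum)
      finally have "(cmod (f z + g z))\<^sup>2 * exp (- \<alpha> * (cmod z)\<^sup>2) \<le>
          (2 * (cmod (f z))\<^sup>2 + 2 * (cmod (g z))\<^sup>2) * exp (- \<alpha> * (cmod z)\<^sup>2)"
        by (rule mult_right_mono) auto
      then show "norm ((cmod (f z + g z))\<^sup>2 * exp (- \<alpha> * (cmod z)\<^sup>2)) \<le>
        norm (2 * ((cmod (f z))\<^sup>2 * exp (- \<alpha> * (cmod z)\<^sup>2)) + 2 * ((cmod (g z))\<^sup>2 * exp (- \<alpha> * (cmod z)\<^sup>2)))"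
        by (simp add: distrib_right mult.assoc)
    qed
  qed (auto intro!: borel_measurable_continuous_onI continuous_intros f g)
  then show ?thesis using f(1) g(1) by (auto simp: fock_space_def intro!: holomorphic_intros)
qed

lemma fock_space_sum:
  assumes "\<And>i. i \<in> I \<Longrightarrow> f i \<in> fock_space \<alpha>"
  shows "(\<lambda>z. \<Sum>i\<in>I. f i z) \<in> fock_space \<alpha>"
  using assms
  by (induction I rule: infinite_finite_induct) (auto intro: fock_space_zero fock_space_add)

lemma integrable_fock_inner:
  assumes "f \<in> fock_space \<alpha>" "g \<in> fock_space \<alpha>"
  shows "integrable lborel (\<lambda>z. f z * cnj (g z) * of_real (exp (- \<alpha> * (cmod z)\<^sup>2)))"
proof -
  note f = fock_spaceD[OF assms(1)] and g = fock_spaceD[OF assms(2)]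
  show ?thesis
  proof (rule Bochner_Integration.integrable_bound)
    show "integrable lborel (\<lambda>z. (cmod (f z))\<^sup>2 * exp (- \<alpha> * (cmod z)\<^sup>2) + (cmod (g z))\<^sup>2 * exp (- \<alpha> * (cmod z)\<^sup>2))"
      using f(3) g(3) by (intro Bochner_Integration.integrable_add)
    show "AE z in lborel. norm (f z * cnj (g z) * of_real (exp (- \<alpha> * (cmod z)\<^sup>2))) \<le>
        norm ((cmod (f z))\<^sup>2 * exp (- \<alpha> * (cmod z)\<^sup>2) + (cmod (g z))\<^sup>2 * exp (- \<alpha> * (cmod z)\<^sup>2))"
    proof (rule AE_I2)
      fix z
      have "cmod (f z) * cmod (g z) * 1 \<le> cmod (f z) * cmod (g z) * 2"
        by (intro mult_left_mono) auto
      also have "\<dots> \<le> (cmod (f z))\<^sup>2 + (cmod (g z))\<^sup>2"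
        using sum_squares_bound[of "cmod (f z)" "cmod (g z)"] by simp
      finally have "cmod (f z) * cmod (g z) * exp (- \<alpha> * (cmod z)\<^sup>2) \<le>
          ((cmod (f z))\<^sup>2 + (cmod (g z))\<^sup>2) * exp (- \<alpha> * (cmod z)\<^sup>2)"
        by (intro mult_right_mono) auto
      then show "norm (f z * cnj (g z) * of_real (exp (- \<alpha> * (cmod z)\<^sup>2))) \<le>
        norm ((cmod (f z))\<^sup>2 * exp (- \<alpha> * (cmod z)\<^sup>2) + (cmod (g z))\<^sup>2 * exp (- \<alpha> * (cmod z)\<^sup>2))"
        by (simp add: norm_mult distrib_right del: of_real_exp)
    qed
  qed (auto intro!: borel_measurable_continuous_onI continuous_intros f g)
qed

lemma fock_inner_add_left:
  assumes "f \<in> fock_space \<alpha>" "g \<in> fock_space \<alpha>" "h \<in> fock_space \<alpha>"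
  shows "fock_inner \<alpha> (\<lambda>z. f z + g z) h = fock_inner \<alpha> f h + fock_inner \<alpha> g h"
  using Bochner_Integration.integral_add[OF integrable_fock_inner[OF assms(1,3)] integrable_fock_inner[OF assms(2,3)]]
  by (simp add: fock_inner_def distrib_right distrib_left)

lemma fock_inner_scale_left: "fock_inner \<alpha> (\<lambda>z. c * f z) h = c * fock_inner \<alpha> f h"
  by (simp add: fock_inner_def mult.assoc)

lemma fock_inner_sum_left:
  assumes "\<And>i. i \<in> I \<Longrightarrow> f i \<in> fock_space \<alpha>" "h \<in> fock_space \<alpha>"
  shows "fock_inner \<alpha> (\<lambda>z. \<Sum>i\<in>I. f i z) h = (\<Sum>i\<in>I. fock_inner \<alpha> (f i) h)"
  using assms
proof (induction I rule: infinite_finite_induct)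
  case (insert i I)
  then show ?case by (simp add: fock_inner_add_left fock_space_sum)
qed (simp_all add: fock_inner_def)

lemma fock_inner_cnj: "cnj (fock_inner \<alpha> f g) = fock_inner \<alpha> g f"
proof -
  have "cnj (LINT z|lborel. f z * cnj (g z) * of_real (exp (- \<alpha> * (cmod z)\<^sup>2))) =
      (LINT z|lborel. cnj (f z * cnj (g z) * of_real (exp (- \<alpha> * (cmod z)\<^sup>2))))"
    by (rule Bochner_Integration.integral_cnj[symmetric])
  also have "(\<lambda>z. cnj (f z * cnj (g z) * of_real (exp (- \<alpha> * (cmod z)\<^sup>2)))) =
      (\<lambda>z. g z * cnj (f z) * of_real (exp (- \<alpha> * (cmod z)\<^sup>2)))"
    by (simp add: mult_ac del: of_real_exp)
  finally show ?thesis by (simp add: fock_inner_def)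
qed

lemma fock_inner_scale_right: "fock_inner \<alpha> f (\<lambda>z. c * h z) = cnj c * fock_inner \<alpha> f h"
  by (metis fock_inner_cnj fock_inner_scale_left complex_cnj_mult)

lemma fock_inner_add_right:
  assumes "f \<in> fock_space \<alpha>" "g \<in> fock_space \<alpha>" "h \<in> fock_space \<alpha>"
  shows "fock_inner \<alpha> h (\<lambda>z. f z + g z) = fock_inner \<alpha> h f + fock_inner \<alpha> h g"
  by (metis fock_inner_cnj fock_inner_add_left[OF assms] complex_cnj_add)

lemma fock_inner_sum_right:
  assumes "\<And>i. i \<in> I \<Longrightarrow> f i \<in> fock_space \<alpha>" "h \<in> fock_space \<alpha>"
  shows "fock_inner \<alpha> h (\<lambda>z. \<Sum>i\<in>I. f i z) = (\<Sum>i\<in>I. fock_inner \<alpha> h (f i))"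
proof -
  have "fock_inner \<alpha> h (\<lambda>z. \<Sum>i\<in>I. f i z) = cnj (fock_inner \<alpha> (\<lambda>z. \<Sum>i\<in>I. f i z) h)"
    by (rule fock_inner_cnj[symmetric])
  also have "\<dots> = (\<Sum>i\<in>I. cnj (fock_inner \<alpha> (f i) h))"
    by (subst fock_inner_sum_left[OF assms]) auto
  finally show ?thesis by (simp add: fock_inner_cnj)
qed

section \<open>Norm, Cauchy-Schwarz inequality and translations\<close>

lemma integral_fock_inner_self:
  "(LINT z|lborel. f z * cnj (f z) * of_real (exp (- \<alpha> * (cmod z)\<^sup>2))) =
    of_real (LINT z|lborel. (cmod (f z))\<^sup>2 * exp (- \<alpha> * (cmod z)\<^sup>2))"
  by (simp only: complex_norm_square[symmetric] of_real_mult[symmetric] integral_complex_of_real)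

context
  fixes \<alpha> :: real
  assumes \<alpha>: "\<alpha> > 0"
begin

lemma fock_norm_nonneg: "fock_norm \<alpha> f \<ge> 0"
  using \<alpha> by (simp add: fock_norm_def)

lemma fock_norm_power2:
  "(fock_norm \<alpha> f)\<^sup>2 = \<alpha> / pi * (LINT z|lborel. (cmod (f z))\<^sup>2 * exp (- \<alpha> * (cmod z)\<^sup>2))"
  using \<alpha> by (simp add: fock_norm_def)

lemma fock_inner_self: "fock_inner \<alpha> f f = of_real ((fock_norm \<alpha> f)\<^sup>2)"
  unfolding fock_inner_def fock_norm_power2 integral_fock_inner_self by (rule of_real_mult[symmetric])

lemma fock_norm_scale: "fock_norm \<alpha> (\<lambda>z. c * f z) = cmod c * fock_norm \<alpha> f"
proof -
  have "of_real ((fock_norm \<alpha> (\<lambda>z. c * f z))\<^sup>2) = complex_of_real ((cmod c * fock_norm \<alpha> f)\<^sup>2)"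
    unfolding fock_inner_self[symmetric] fock_inner_scale_left fock_inner_scale_right power_mult_distrib of_real_mult
      complex_norm_square by (simp only: mult.assoc mult.left_commute)
  then have "(fock_norm \<alpha> (\<lambda>z. c * f z))\<^sup>2 = (cmod c * fock_norm \<alpha> f)\<^sup>2" by (simp only: of_real_eq_iff)
  then show ?thesis using fock_norm_nonneg by (simp add: power2_eq_iff_nonneg)
qed

lemma fock_Cauchy_Schwarz:
  assumes f: "f \<in> fock_space \<alpha>" and g: "g \<in> fock_space \<alpha>"
  shows "cmod (fock_inner \<alpha> f g) \<le> fock_norm \<alpha> f * fock_norm \<alpha> g"
proof -
  define a where "a = fock_inner \<alpha> f g"
  \<comment> \<open>Expand 0 \<le> ||f - s a g||^2 with a = <f, g>; the factor a makes the cross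
    term real.\<close>
  have *: "2 * s * (cmod a)\<^sup>2 \<le> (fock_norm \<alpha> f)\<^sup>2 + s\<^sup>2 * (cmod a)\<^sup>2 * (fock_norm \<alpha> g)\<^sup>2" for s :: real
  proof -
    define t where "t = - of_real s * a"
    have tg: "(\<lambda>z. t * g z) \<in> fock_space \<alpha>" using g by (rule fock_space_scale)
    have "of_real ((fock_norm \<alpha> (\<lambda>z. f z + t * g z))\<^sup>2) =
        fock_inner \<alpha> f f + cnj t * a + t * cnj a + t * cnj t * fock_inner \<alpha> g g"
      unfolding fock_inner_self[symmetric] fock_inner_add_left[OF f tg fock_space_add[OF f tg]]
        fock_inner_add_right[OF f tg f] fock_inner_add_right[OF f tg tg] fock_inner_add_right[OF f tg g] fock_inner_scale_left
        fock_inner_scale_right a_def fock_inner_cnj by (simp add: algebra_simps)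
    also have "\<dots> = of_real ((fock_norm \<alpha> f)\<^sup>2 - 2 * s * (cmod a)\<^sup>2 + s\<^sup>2 * (cmod a)\<^sup>2 * (fock_norm \<alpha> g)\<^sup>2)"
      unfolding fock_inner_self of_real_diff of_real_add of_real_mult complex_norm_square
      by (simp add: t_def power2_eq_square algebra_simps)
    finally have "(fock_norm \<alpha> (\<lambda>z. f z + t * g z))\<^sup>2 =
        (fock_norm \<alpha> f)\<^sup>2 - 2 * s * (cmod a)\<^sup>2 + s\<^sup>2 * (cmod a)\<^sup>2 * (fock_norm \<alpha> g)\<^sup>2"
      by (simp only: of_real_eq_iff)
    then show ?thesis using zero_le_power2[of "fock_norm \<alpha> (\<lambda>z. f z + t * g z)"] by linarith
  qed
  have "(cmod a)\<^sup>2 \<le> (fock_norm \<alpha> f * fock_norm \<alpha> g)\<^sup>2"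
  proof (cases "fock_norm \<alpha> g = 0")
    case True
    have "(cmod a)\<^sup>2 = 0"
    proof (rule ccontr)
      assume "(cmod a)\<^sup>2 \<noteq> 0"
      \<comment> \<open>When ||g|| = 0 the inequality is linear in s, and this s is large enough to
        violate it.\<close>
      then show False using *[of "((fock_norm \<alpha> f)\<^sup>2 + 1) / (2 * (cmod a)\<^sup>2)"] True by simp
    qed
    then show ?thesis by simp
  next
    case False
    then show ?thesis using *[of "1 / (fock_norm \<alpha> g)\<^sup>2"] fock_norm_nonneg[of g]
      by (simp add: power2_eq_square field_simps)
  qed
  then show ?thesis
    unfolding a_def using fock_norm_nonneg by (simp add: abs_le_square_iff[symmetric] abs_mult)
qed

lemma fock_norm_triangle:
  assumes f: "f \<in> fock_space \<alpha>" and g: "g \<in> fock_space \<alpha>"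
  shows "fock_norm \<alpha> (\<lambda>z. f z + g z) \<le> fock_norm \<alpha> f + fock_norm \<alpha> g"
proof -
  have "of_real ((fock_norm \<alpha> (\<lambda>z. f z + g z))\<^sup>2) =
      fock_inner \<alpha> f f + fock_inner \<alpha> g g + (fock_inner \<alpha> f g + cnj (fock_inner \<alpha> f g))"
    unfolding fock_inner_self[symmetric] fock_inner_add_left[OF f g fock_space_add[OF f g]]
      fock_inner_add_right[OF f g f] fock_inner_add_right[OF f g g] fock_inner_cnj by (simp add: algebra_simps)
  also have "\<dots> = of_real ((fock_norm \<alpha> f)\<^sup>2 + (fock_norm \<alpha> g)\<^sup>2 + 2 * Re (fock_inner \<alpha> f g))"
    by (simp add: fock_inner_self complex_add_cnj)
  finally have "(fock_norm \<alpha> (\<lambda>z. f z + g z))\<^sup>2 =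
      (fock_norm \<alpha> f)\<^sup>2 + (fock_norm \<alpha> g)\<^sup>2 + 2 * Re (fock_inner \<alpha> f g)"
    by (simp only: of_real_eq_iff)
  also have "Re (fock_inner \<alpha> f g) \<le> fock_norm \<alpha> f * fock_norm \<alpha> g"
    using complex_Re_le_cmod fock_Cauchy_Schwarz[OF f g] by (rule order_trans)
  finally have "(fock_norm \<alpha> (\<lambda>z. f z + g z))\<^sup>2 \<le> (fock_norm \<alpha> f + fock_norm \<alpha> g)\<^sup>2"
    by (simp add: power2_sum)
  then show ?thesis
    by (rule power2_le_imp_le) (intro add_nonneg_nonneg fock_norm_nonneg)
qed

text \<open>Completing the square: the exponential factor of the translation turns the Gaussian at 0
  into the Gaussian at \<open>l\<close>. The isometry thus holds already for the integrands.\<close>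

lemma fock_translation_inner_integrand:
  "fock_translation \<alpha> l f z * cnj (fock_translation \<alpha> l g z) * of_real (exp (- \<alpha> * (cmod z)\<^sup>2)) =
    f (z - l) * cnj (g (z - l)) * of_real (exp (- \<alpha> * (cmod (z - l))\<^sup>2))"
proof -
  have "of_real \<alpha> * cnj l * z - of_real (\<alpha> / 2 * (cmod l)\<^sup>2) + cnj (of_real \<alpha> * cnj l * z - of_real (\<alpha> / 2 * (cmod l)\<^sup>2))
      + of_real (- \<alpha> * (cmod z)\<^sup>2) = complex_of_real (- \<alpha> * (cmod (z - l))\<^sup>2)"
    unfolding of_real_mult complex_norm_square by (simp add: algebra_simps)
  then have "exp (of_real \<alpha> * cnj l * z - of_real (\<alpha> / 2 * (cmod l)\<^sup>2)) *
      cnj (exp (of_real \<alpha> * cnj l * z - of_real (\<alpha> / 2 * (cmod l)\<^sup>2))) * of_real (exp (- \<alpha> * (cmod z)\<^sup>2)) =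
      complex_of_real (exp (- \<alpha> * (cmod (z - l))\<^sup>2))"
    by (simp only: exp_cnj exp_add[symmetric] exp_of_real[symmetric])
  then show ?thesis
    unfolding fock_translation_def complex_cnj_mult
    by (metis (no_types, lifting) mult.assoc mult.left_commute)
qed

lemma fock_inner_translation:
  "fock_inner \<alpha> (fock_translation \<alpha> l f) (fock_translation \<alpha> l g) = fock_inner \<alpha> f g"
  unfolding fock_inner_def fock_translation_inner_integrand
  using integral_translate[of "\<lambda>z. f z * cnj (g z) * of_real (exp (- \<alpha> * (cmod z)\<^sup>2))" "- l"] by simp

lemma fock_translation_space:
  assumes f: "f \<in> fock_space \<alpha>"
  shows "fock_translation \<alpha> l f \<in> fock_space \<alpha>"
proof -
  have "(cmod (fock_translation \<alpha> l f z))\<^sup>2 * exp (- \<alpha> * (cmod z)\<^sup>2) =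
      (cmod (f (z - l)))\<^sup>2 * exp (- \<alpha> * (cmod (z - l))\<^sup>2)" for z
    using fock_translation_inner_integrand[of l f z f]
    by (simp only: complex_norm_square[symmetric] of_real_mult[symmetric] of_real_eq_iff)
  moreover have "integrable lborel (\<lambda>z. (cmod (f (z - l)))\<^sup>2 * exp (- \<alpha> * (cmod (z - l))\<^sup>2))"
    using integrable_translate[of "\<lambda>z. (cmod (f z))\<^sup>2 * exp (- \<alpha> * (cmod z)\<^sup>2)" "- l"] fock_spaceD(3)[OF f] by simp
  moreover have "fock_translation \<alpha> l f holomorphic_on UNIV"
  proof -
    have "(f \<circ> (\<lambda>z. z - l)) holomorphic_on UNIV"
      by (rule holomorphic_on_compose_gen[OF _ fock_spaceD(1)[OF f]]) (auto intro!: holomorphic_intros)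
    then show ?thesis unfolding fock_translation_def o_def by (intro holomorphic_intros)
  qed
  ultimately show ?thesis by (simp add: fock_space_def)
qed

lemma fock_norm_translation: "fock_norm \<alpha> (fock_translation \<alpha> l f) = fock_norm \<alpha> f"
  using fock_inner_translation[of l f f] fock_norm_nonneg
  by (simp only: fock_inner_self of_real_eq_iff power2_eq_iff_nonneg)

lemma fock_translation_inverse: "fock_translation \<alpha> (- l) (fock_translation \<alpha> l f) = f"
proof
  fix z
  have "exp (of_real \<alpha> * cnj (- l) * z - of_real (\<alpha> / 2 * (cmod (- l))\<^sup>2)) *
      exp (of_real \<alpha> * cnj l * (z - (- l)) - of_real (\<alpha> / 2 * (cmod l)\<^sup>2)) = 1"
    unfolding exp_add[symmetric] of_real_mult complex_norm_square norm_minus_cancel by (simp add: algebra_simps)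
  then show "fock_translation \<alpha> (- l) (fock_translation \<alpha> l f) z = f z"
    unfolding fock_translation_def by (simp only: mult.assoc[symmetric]) simp
qed

lemma fock_translation_inverse': "fock_translation \<alpha> l (fock_translation \<alpha> (- l) f) = f"
  using fock_translation_inverse[of "- l" f] by simp

lemma fock_inner_translation_right:
  "fock_inner \<alpha> f (fock_translation \<alpha> l g) = fock_inner \<alpha> (fock_translation \<alpha> (- l) f) g"
  using fock_inner_translation[of l "fock_translation \<alpha> (- l) f" g] by (simp add: fock_translation_inverse')

end

text \<open>The normalized upper incomplete gamma function of order k + 1. Its derivative telescopes
  to a single Poisson term, which makes it the antiderivative behind the Gaussian moments and behind
  \<open>pole\<close>.\<close>

definition gamma_tail :: "nat \<Rightarrow> real \<Rightarrow> real" where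
  "gamma_tail k x = exp (- x) * (\<Sum>j\<le>k. x ^ j / fact j)"

lemma gamma_tail_0 [simp]: "gamma_tail k 0 = 1"
  by (simp add: gamma_tail_def sum.atMost_shift)

lemma has_derivative_gamma_tail:
  "(gamma_tail k has_real_derivative - exp (- x) * x ^ k / fact k) (at x)"
proof (induction k)
  case 0
  then show ?case unfolding gamma_tail_def by (auto intro!: derivative_eq_intros)
next
  case (Suc k)
  have "gamma_tail (Suc k) = (\<lambda>x. gamma_tail k x + exp (- x) * (x ^ Suc k / fact (Suc k)))"
    by (simp add: gamma_tail_def distrib_left fun_eq_iff)
  moreover have "((\<lambda>x. gamma_tail k x + exp (- x) * (x ^ Suc k / fact (Suc k))) has_real_derivative
      - exp (- x) * x ^ k / fact k + (exp (- x) * (of_nat (Suc k) * x ^ k / fact (Suc k)) + - exp (- x) * (x ^ Suc k / fact (Suc k)))) (at x)"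
    by (rule derivative_eq_intros Suc refl | simp)+
  ultimately show ?case by (simp add: fact_Suc divide_simps del: of_nat_Suc)
qed

lemma gamma_tail_tendsto_0: "(gamma_tail k \<longlongrightarrow> 0) at_top"
proof -
  have "((\<lambda>x::real. \<Sum>j\<le>k. (x ^ j / exp x) / fact j) \<longlongrightarrow> (\<Sum>j\<le>k. 0 / fact j)) at_top"
    by (rule tendsto_sum, rule tendsto_divide[OF tendsto_power_div_exp_0 tendsto_const]) auto
  moreover have "gamma_tail k = (\<lambda>x. \<Sum>j\<le>k. (x ^ j / exp x) / fact j)"
    by (auto simp: gamma_tail_def sum_distrib_left exp_minus field_simps)
  ultimately show ?thesis by simp
qed

section \<open>Gaussian moments and the monomial basis\<close>

context
  fixes \<alpha> :: real
  assumes \<alpha>: "\<alpha> > 0"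
begin

lemma gaussian_moments:
  shows "integrable lborel (\<lambda>z::complex. ((cmod z)\<^sup>2) ^ k * exp (- \<alpha> * (cmod z)\<^sup>2))"
    and "(LINT z::complex|lborel. ((cmod z)\<^sup>2) ^ k * exp (- \<alpha> * (cmod z)\<^sup>2)) = pi * fact k / \<alpha> ^ Suc k"
proof -
  have cont: "continuous_on UNIV (\<lambda>s::real. s ^ k * exp (- \<alpha> * s))" by (intro continuous_intros)
  have "(\<integral>\<^sup>+s. ennreal (s ^ k * exp (- \<alpha> * s)) * indicator {0..} s \<partial>lborel) =
      ennreal (0 - (- (fact k / \<alpha> ^ Suc k) * gamma_tail k (\<alpha> * 0)))"
  proof (rule nn_integral_FTC_atLeast)
    fix s :: real
    have "((\<lambda>s. gamma_tail k (\<alpha> * s)) has_real_derivative (- exp (- (\<alpha> * s)) * (\<alpha> * s) ^ k / fact k) * \<alpha>) (at s)"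
      by (rule DERIV_chain2[OF has_derivative_gamma_tail]) (auto intro!: derivative_eq_intros)
    then have "((\<lambda>s. - (fact k / \<alpha> ^ Suc k) * gamma_tail k (\<alpha> * s)) has_real_derivative
        - (fact k / \<alpha> ^ Suc k) * ((- exp (- (\<alpha> * s)) * (\<alpha> * s) ^ k / fact k) * \<alpha>)) (at s)"
      by (rule DERIV_cmult)
    then show "((\<lambda>s. - (fact k / \<alpha> ^ Suc k) * gamma_tail k (\<alpha> * s)) has_real_derivative s ^ k * exp (- \<alpha> * s)) (at s)"
      using \<alpha> by (simp add: power_mult_distrib mult_ac)
    show "((\<lambda>s. - (fact k / \<alpha> ^ Suc k) * gamma_tail k (\<alpha> * s)) \<longlongrightarrow> 0) at_top"
      by (rule tendsto_mult_right_zero, rule filterlim_compose[OF gamma_tail_tendsto_0])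
         (intro filterlim_tendsto_pos_mult_at_top[OF tendsto_const \<alpha>] filterlim_ident)
  qed (auto simp: borel_measurable_continuous_onI[OF cont])
  then have nn: "(\<integral>\<^sup>+z. ennreal (((cmod z)\<^sup>2) ^ k * exp (- \<alpha> * (cmod z)\<^sup>2)) \<partial>lborel) = ennreal (pi * fact k / \<alpha> ^ Suc k)"
    using nn_integral_radial[of "\<lambda>s. ennreal (s ^ k * exp (- \<alpha> * s))"] borel_measurable_continuous_onI[OF cont] \<alpha>
    by (simp add: ennreal_mult[symmetric])
  have meas: "(\<lambda>z::complex. ((cmod z)\<^sup>2) ^ k * exp (- \<alpha> * (cmod z)\<^sup>2)) \<in> borel_measurable lborel"
    by (auto intro!: borel_measurable_continuous_onI continuous_intros)
  show "integrable lborel (\<lambda>z::complex. ((cmod z)\<^sup>2) ^ k * exp (- \<alpha> * (cmod z)\<^sup>2))"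
    by (rule integrableI_nonneg[OF meas]) (use nn in auto)
  show "(LINT z::complex|lborel. ((cmod z)\<^sup>2) ^ k * exp (- \<alpha> * (cmod z)\<^sup>2)) = pi * fact k / \<alpha> ^ Suc k"
    using \<alpha> by (subst integral_eq_nn_integral[OF meas]) (use nn in auto)
qed

lemma fock_basis_space: "fock_basis \<alpha> k \<in> fock_space \<alpha>"
proof -
  have "integrable lborel (\<lambda>z. (\<alpha> ^ k / fact k) * (((cmod z)\<^sup>2) ^ k * exp (- \<alpha> * (cmod z)\<^sup>2)))"
    by (intro integrable_mult_right gaussian_moments)
  moreover have "(cmod (fock_basis \<alpha> k z))\<^sup>2 * exp (- \<alpha> * (cmod z)\<^sup>2) =
      (\<alpha> ^ k / fact k) * (((cmod z)\<^sup>2) ^ k * exp (- \<alpha> * (cmod z)\<^sup>2))" for z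
    using \<alpha> by (simp add: fock_basis_def norm_mult norm_power power_mult_distrib power_mult[symmetric] mult.commute)
  moreover have "fock_basis \<alpha> k holomorphic_on UNIV"
    unfolding fock_basis_def[abs_def] by (intro holomorphic_intros)
  ultimately show ?thesis by (simp add: fock_space_def)
qed

lemma fock_inner_basis:
  assumes f: "f \<in> fock_space \<alpha>"
  shows "fock_inner \<alpha> f (fock_basis \<alpha> k) = of_real (sqrt (fact k / \<alpha> ^ k)) * ((deriv ^^ k) f 0 / fact k)"
proof -
  define r where "r = sqrt (\<alpha> ^ k / fact k)"
  have r: "r > 0" using \<alpha> by (simp add: r_def)
  have eq: "f z * cnj (fock_basis \<alpha> k z) * of_real (exp (- \<alpha> * (cmod z)\<^sup>2)) =
      of_real r * (f z * cnj z ^ k * of_real (exp (- \<alpha> * (cmod z)\<^sup>2)))" for z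
    by (simp add: fock_basis_def r_def)
  have "integrable lborel (\<lambda>z. of_real r * (f z * cnj z ^ k * of_real (exp (- \<alpha> * (cmod z)\<^sup>2))))"
    using integrable_fock_inner[OF f fock_basis_space, of k] unfolding eq .
  then have int: "integrable lborel (\<lambda>z. f z * cnj z ^ k * of_real (exp (- \<alpha> * (cmod z)\<^sup>2)))"
    using integrable_mult_right[of "of_real (1 / r)"] r by (fastforce simp: mult.assoc[symmetric])
  have "(LINT z|lborel. f z * cnj z ^ k * of_real (exp (- \<alpha> * (cmod z)\<^sup>2))) =
      (deriv ^^ k) f 0 / fact k * of_real (pi * fact k / \<alpha> ^ Suc k)"
    by (subst integral_entire_radial'[where w="\<lambda>s. exp (- \<alpha> * s)"])
       (use gaussian_moments int in \<open>auto intro!: continuous_intros fock_spaceD[OF f]\<close>)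
  then have "fock_inner \<alpha> f (fock_basis \<alpha> k) =
      of_real (\<alpha> / pi * r * (pi * fact k / \<alpha> ^ Suc k)) * ((deriv ^^ k) f 0 / fact k)"
    unfolding fock_inner_def eq integral_mult_right_zero by (simp add: mult_ac)
  also have "\<alpha> / pi * r * (pi * fact k / \<alpha> ^ Suc k) = r * (fact k / \<alpha> ^ k)"
    using \<alpha> by simp
  also have "\<dots> = sqrt (fact k / \<alpha> ^ k)"
  proof -
    have "r * sqrt (fact k / \<alpha> ^ k) = 1"
      unfolding r_def real_sqrt_mult[symmetric] using \<alpha> by simp
    moreover have "fact k / \<alpha> ^ k = sqrt (fact k / \<alpha> ^ k) * sqrt (fact k / \<alpha> ^ k)"
      using \<alpha> by simp
    ultimately show ?thesis by (metis mult.assoc mult_1)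
  qed
  finally show ?thesis .
qed

lemma fock_inner_basis_basis: "fock_inner \<alpha> (fock_basis \<alpha> j) (fock_basis \<alpha> k) = (if j = k then 1 else 0)"
proof -
  have 1: "fock_inner \<alpha> (fock_basis \<alpha> j) (fock_basis \<alpha> k) = of_real (sqrt (\<alpha> ^ j / fact j)) *
      fock_inner \<alpha> (\<lambda>z. z ^ j) (fock_basis \<alpha> k)"
    unfolding fock_basis_def[of \<alpha> j, abs_def] by (rule fock_inner_scale_left)
  have pow: "(\<lambda>z. z ^ j) \<in> fock_space \<alpha>"
    using fock_space_scale[OF fock_basis_space[of j], of "1 / of_real (sqrt (\<alpha> ^ j / fact j))"] \<alpha>
    by (simp add: fock_basis_def)
  have 2: "(deriv ^^ k) (\<lambda>z. z ^ j) 0 / fact k = (if j = k then 1 else (0::complex))"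
    using higher_deriv_power[of k 0 j "0::complex"]
    by (auto simp: pochhammer_fact[symmetric] pochhammer_0_left power_0_left)
  show ?thesis
    unfolding 1 fock_inner_basis[OF pow] 2 using \<alpha>
    by (auto simp: real_sqrt_mult[symmetric] of_real_mult[symmetric] simp del: of_real_mult)
qed

lemma fock_norm_basis: "fock_norm \<alpha> (fock_basis \<alpha> k) = 1"
proof -
  have "of_real ((fock_norm \<alpha> (fock_basis \<alpha> k))\<^sup>2) = complex_of_real 1"
    using fock_inner_basis_basis[of k k] unfolding fock_inner_self[OF \<alpha>] by simp
  then have "(fock_norm \<alpha> (fock_basis \<alpha> k))\<^sup>2 = 1" by (simp only: of_real_eq_iff)
  then show ?thesis using fock_norm_nonneg[OF \<alpha>] by (simp add: power2_eq_1_iff) (metis not_one_le_zero neg_0_le_iff_le)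
qed

lemma fock_inner_translation_basis:
  assumes f: "f \<in> fock_space \<alpha>"
  shows "fock_inner \<alpha> f (fock_translation \<alpha> l (fock_basis \<alpha> k)) =
    of_real (sqrt (fact k / \<alpha> ^ k)) * ((deriv ^^ k) (fock_translation \<alpha> (- l) f) 0 / fact k)"
  using fock_inner_basis[OF fock_translation_space[OF \<alpha> f]] fock_inner_translation_right[OF \<alpha>] by simp

text \<open>T_z e_0 is the normalized reproducing kernel at z: pairing with it evaluates f at z up
  to a Gaussian factor, and Cauchy-Schwarz finishes.\<close>

lemma fock_pointwise_bound:
  assumes f: "f \<in> fock_space \<alpha>"
  shows "cmod (f z) \<le> fock_norm \<alpha> f * exp (\<alpha> / 2 * (cmod z)\<^sup>2)"
proof -
  have "fock_inner \<alpha> f (fock_translation \<alpha> z (fock_basis \<alpha> 0)) = exp (- of_real (\<alpha> / 2 * (cmod z)\<^sup>2)) * f z"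
    using fock_inner_translation_basis[OF f, of z 0] by (simp add: fock_translation_def)
  moreover have "cmod (fock_inner \<alpha> f (fock_translation \<alpha> z (fock_basis \<alpha> 0))) \<le> fock_norm \<alpha> f * 1"
    using fock_Cauchy_Schwarz[OF \<alpha> f fock_translation_space[OF \<alpha> fock_basis_space[of 0], of z]]
    by (simp add: fock_norm_translation[OF \<alpha>] fock_norm_basis)
  ultimately have "exp (- (\<alpha> / 2 * (cmod z)\<^sup>2)) * cmod (f z) \<le> fock_norm \<alpha> f"
    by (simp add: norm_mult norm_exp_eq_Re)
  then show ?thesis by (simp add: exp_minus field_simps)
qed

end

subsection \<open>Weak compactness and the open mapping argument\<close>

text \<open>One relation for data on an arbitrary index set \<open>J\<close> with a norm budget
  \<open>K\<close>, so that finite sets of conditions and the whole divisor are handled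
  alike.\<close>

definition fock_solvable ::
  "real \<Rightarrow> (complex \<times> nat) set \<Rightarrow> (complex \<times> nat \<Rightarrow> complex) \<Rightarrow> real \<Rightarrow> bool" where
  "fock_solvable \<alpha> J v K \<longleftrightarrow> (\<exists>f\<in>fock_space \<alpha>. fock_norm \<alpha> f \<le> K \<and>
     (\<forall>(l, k)\<in>J. fock_inner \<alpha> f (fock_translation \<alpha> l (fock_basis \<alpha> k)) = v (l, k)))"

lemma fock_solvable_mono:
  assumes "fock_solvable \<alpha> J v K" "J' \<subseteq> J" "K \<le> K'" "\<And>i. i \<in> J' \<Longrightarrow> v i = w i"
  shows "fock_solvable \<alpha> J' w K'"
proof -
  obtain f where f: "f \<in> fock_space \<alpha>" "fock_norm \<alpha> f \<le> K"
      "\<And>l k. (l, k) \<in> J \<Longrightarrow> fock_inner \<alpha> f (fock_translation \<alpha> l (fock_basis \<alpha> k)) = v (l, k)"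
    using assms(1) by (auto simp: fock_solvable_def)
  show ?thesis
    unfolding fock_solvable_def
    by (rule bexI[OF _ f(1)]) (use f(2,3) assms(2-) in force)
qed

context
  fixes \<alpha> :: real
  assumes \<alpha>: "\<alpha> > 0"
begin

lemma fock_solvable_add:
  assumes "fock_solvable \<alpha> J v K" "fock_solvable \<alpha> J w L"
  shows "fock_solvable \<alpha> J (\<lambda>i. v i + w i) (K + L)"
proof -
  obtain f where f: "f \<in> fock_space \<alpha>" "fock_norm \<alpha> f \<le> K"
      "\<And>l k. (l, k) \<in> J \<Longrightarrow> fock_inner \<alpha> f (fock_translation \<alpha> l (fock_basis \<alpha> k)) = v (l, k)"
    using assms(1) by (auto simp: fock_solvable_def)
  obtain g where g: "g \<in> fock_space \<alpha>" "fock_norm \<alpha> g \<le> L"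
      "\<And>l k. (l, k) \<in> J \<Longrightarrow> fock_inner \<alpha> g (fock_translation \<alpha> l (fock_basis \<alpha> k)) = w (l, k)"
    using assms(2) by (auto simp: fock_solvable_def)
  have "fock_inner \<alpha> (\<lambda>z. f z + g z) (fock_translation \<alpha> l (fock_basis \<alpha> k)) = v (l, k) + w (l, k)"
    if "(l, k) \<in> J" for l k
    using that f(3) g(3)
    by (simp add: fock_inner_add_left[OF f(1) g(1) fock_translation_space[OF \<alpha> fock_basis_space[OF \<alpha>]]])
  then show ?thesis
    unfolding fock_solvable_def
    by (intro bexI[OF _ fock_space_add[OF f(1) g(1)]])
       (use fock_norm_triangle[OF \<alpha> f(1) g(1)] f(2) g(2) in force)
qed

lemma fock_solvable_scale:
  assumes "fock_solvable \<alpha> J v K"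
  shows "fock_solvable \<alpha> J (\<lambda>i. c * v i) (cmod c * K)"
proof -
  obtain f where f: "f \<in> fock_space \<alpha>" "fock_norm \<alpha> f \<le> K"
      "\<And>l k. (l, k) \<in> J \<Longrightarrow> fock_inner \<alpha> f (fock_translation \<alpha> l (fock_basis \<alpha> k)) = v (l, k)"
    using assms(1) by (auto simp: fock_solvable_def)
  show ?thesis
    unfolding fock_solvable_def
    by (rule bexI[OF _ fock_space_scale[OF f(1), of c]])
       (use f(2,3) in \<open>auto simp: fock_inner_scale_left fock_norm_scale[OF \<alpha>] intro: mult_left_mono\<close>)
qed

lemma fock_solvable_zero: "fock_solvable \<alpha> J (\<lambda>_. 0) 0"
proof -
  have "fock_norm \<alpha> (\<lambda>_. 0) = 0" by (simp add: fock_norm_def)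
  then show ?thesis
    unfolding fock_solvable_def by (intro bexI[OF _ fock_space_zero]) (auto simp: fock_inner_def)
qed

lemma fock_solvable_sum:
  assumes "finite A" "\<And>a. a \<in> A \<Longrightarrow> fock_solvable \<alpha> J (v a) (K a)"
  shows "fock_solvable \<alpha> J (\<lambda>i. \<Sum>a\<in>A. v a i) (\<Sum>a\<in>A. K a)"
  using assms
  by (induction rule: finite_induct) (auto intro: fock_solvable_zero fock_solvable_add)

text \<open>Pointwise bounds make the sequence a normal family, Fatou's lemma keeps the norm bound
  in the limit, and the pairings converge because they are multiples of Taylor coefficients, which
  locally uniform convergence preserves.\<close>

lemma fock_weak_compactness:
  assumes f: "\<And>n. f n \<in> fock_space \<alpha>" "\<And>n::nat. fock_norm \<alpha> (f n) \<le> K"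
  obtains g r where "g \<in> fock_space \<alpha>" "fock_norm \<alpha> g \<le> K" "strict_mono (r :: nat \<Rightarrow> nat)"
    "\<And>l k. (\<lambda>n. fock_inner \<alpha> (f (r n)) (fock_translation \<alpha> l (fock_basis \<alpha> k)))
        \<longlonglongrightarrow> fock_inner \<alpha> g (fock_translation \<alpha> l (fock_basis \<alpha> k))"
proof -
  have K: "K \<ge> 0" using f(2)[of 0] fock_norm_nonneg[OF \<alpha>, of "f 0"] by linarith
  define H where "H = {h \<in> fock_space \<alpha>. fock_norm \<alpha> h \<le> K}"
  obtain g r where g: "g holomorphic_on UNIV" and r: "strict_mono (r :: nat \<Rightarrow> nat)"
    and lim: "\<And>z. z \<in> UNIV \<Longrightarrow> (\<lambda>n. f (r n) z) \<longlonglongrightarrow> g z"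
    and ulim: "\<And>C. \<lbrakk>compact C; C \<subseteq> UNIV\<rbrakk> \<Longrightarrow> uniform_limit C (f \<circ> r) g sequentially"
  proof (rule Montel[of UNIV H f])
    show "\<exists>B. \<forall>h\<in>H. \<forall>z\<in>C. cmod (h z) \<le> B" if "compact C" for C
    proof -
      obtain b where b: "\<And>z. z \<in> C \<Longrightarrow> cmod z \<le> b"
        using \<open>compact C\<close> compact_imp_bounded bounded_iff by metis
      have "cmod (h z) \<le> K * exp (\<alpha> / 2 * b\<^sup>2)" if "h \<in> H" "z \<in> C" for h z
      proof -
        have "cmod (h z) \<le> fock_norm \<alpha> h * exp (\<alpha> / 2 * (cmod z)\<^sup>2)"
          using that by (intro fock_pointwise_bound[OF \<alpha>]) (simp add: H_def)
        also have "\<dots> \<le> K * exp (\<alpha> / 2 * b\<^sup>2)"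
          using that b[OF that(2)] \<alpha> K by (intro mult_mono) (auto simp: H_def intro!: mult_left_mono power_mono)
        finally show ?thesis .
      qed
      then show ?thesis by blast
    qed
  qed (use f in \<open>auto simp: H_def fock_spaceD\<close>)
  have cg: "continuous_on UNIV g" using g by (rule holomorphic_on_imp_continuous_on)
  have meas: "(\<lambda>z. (cmod (h z))\<^sup>2 * exp (- \<alpha> * (cmod z)\<^sup>2)) \<in> borel_measurable lborel"
    if "continuous_on UNIV h" for h :: "complex \<Rightarrow> complex"
    using that by (auto intro!: borel_measurable_continuous_onI continuous_intros)
  have "(\<integral>\<^sup>+z. ennreal ((cmod (g z))\<^sup>2 * exp (- \<alpha> * (cmod z)\<^sup>2)) \<partial>lborel) =
      (\<integral>\<^sup>+z. liminf (\<lambda>n. ennreal ((cmod (f (r n) z))\<^sup>2 * exp (- \<alpha> * (cmod z)\<^sup>2))) \<partial>lborel)"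
  proof (intro nn_integral_cong lim_imp_Liminf[symmetric])
    fix z
    show "((\<lambda>n. ennreal ((cmod (f (r n) z))\<^sup>2 * exp (- \<alpha> * (cmod z)\<^sup>2))) \<longlongrightarrow>
        ennreal ((cmod (g z))\<^sup>2 * exp (- \<alpha> * (cmod z)\<^sup>2))) sequentially"
      by (intro tendsto_intros lim) auto
  qed auto
  also have "\<dots> \<le> liminf (\<lambda>n. \<integral>\<^sup>+z. ennreal ((cmod (f (r n) z))\<^sup>2 * exp (- \<alpha> * (cmod z)\<^sup>2)) \<partial>lborel)"
    using meas fock_spaceD(2)[OF f(1)] by (intro nn_integral_liminf) auto
  also have "\<dots> \<le> liminf (\<lambda>n. ennreal (pi / \<alpha> * K\<^sup>2))"
  proof (intro Liminf_mono always_eventually allI)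
    fix n
    have "(\<integral>\<^sup>+z. ennreal ((cmod (f (r n) z))\<^sup>2 * exp (- \<alpha> * (cmod z)\<^sup>2)) \<partial>lborel) =
        ennreal (LINT z|lborel. (cmod (f (r n) z))\<^sup>2 * exp (- \<alpha> * (cmod z)\<^sup>2))"
      by (rule nn_integral_eq_integral[OF fock_spaceD(3)[OF f(1)]]) auto
    also have "(LINT z|lborel. (cmod (f (r n) z))\<^sup>2 * exp (- \<alpha> * (cmod z)\<^sup>2)) = pi / \<alpha> * (fock_norm \<alpha> (f (r n)))\<^sup>2"
      using \<alpha> by (simp add: fock_norm_power2[OF \<alpha>])
    also have "\<dots> \<le> pi / \<alpha> * K\<^sup>2"
      using \<alpha> f(2)[of "r n"] fock_norm_nonneg[OF \<alpha>] by (intro mult_left_mono power_mono) auto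
    finally show "(\<integral>\<^sup>+z. ennreal ((cmod (f (r n) z))\<^sup>2 * exp (- \<alpha> * (cmod z)\<^sup>2)) \<partial>lborel) \<le> ennreal (pi / \<alpha> * K\<^sup>2)"
      by (simp add: ennreal_leI)
  qed
  finally have nn: "(\<integral>\<^sup>+z. ennreal ((cmod (g z))\<^sup>2 * exp (- \<alpha> * (cmod z)\<^sup>2)) \<partial>lborel) \<le> ennreal (pi / \<alpha> * K\<^sup>2)"
    by (simp add: Liminf_const)
  have int: "integrable lborel (\<lambda>z. (cmod (g z))\<^sup>2 * exp (- \<alpha> * (cmod z)\<^sup>2))"
    by (rule integrableI_nonneg[OF meas[OF cg]]) (use nn in \<open>auto intro: le_less_trans\<close>)
  then have gF: "g \<in> fock_space \<alpha>" using g by (simp add: fock_space_def)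
  have "ennreal (LINT z|lborel. (cmod (g z))\<^sup>2 * exp (- \<alpha> * (cmod z)\<^sup>2)) \<le> ennreal (pi / \<alpha> * K\<^sup>2)"
    using nn nn_integral_eq_integral[OF int] by simp
  then have "(LINT z|lborel. (cmod (g z))\<^sup>2 * exp (- \<alpha> * (cmod z)\<^sup>2)) \<le> pi / \<alpha> * K\<^sup>2"
    using \<alpha> by (subst (asm) ennreal_le_iff) auto
  then have "(fock_norm \<alpha> g)\<^sup>2 \<le> K\<^sup>2"
    using \<alpha> by (simp add: fock_norm_power2[OF \<alpha>] field_simps)
  then have norm_g: "fock_norm \<alpha> g \<le> K" using K by (rule power2_le_imp_le)
  have "(\<lambda>n. fock_inner \<alpha> (f (r n)) (fock_translation \<alpha> l (fock_basis \<alpha> k)))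
        \<longlonglongrightarrow> fock_inner \<alpha> g (fock_translation \<alpha> l (fock_basis \<alpha> k))" for l k
    unfolding fock_inner_translation_basis[OF \<alpha> f(1)] fock_inner_translation_basis[OF \<alpha> gF]
  proof (intro tendsto_intros higher_deriv_complex_uniform_limit)
    define E where "E \<zeta> = exp (of_real \<alpha> * cnj (- l) * \<zeta> - of_real (\<alpha> / 2 * (cmod (- l))\<^sup>2))" for \<zeta>
    have E: "continuous_on S E" for S unfolding E_def by (intro continuous_intros)
    have "uniform_limit (cball 0 1) (\<lambda>n \<zeta>. E \<zeta> * f (r n) (\<zeta> - (- l))) (\<lambda>\<zeta>. E \<zeta> * g (\<zeta> - (- l))) sequentially"
    proof (rule uniform_lim_mult)
      show "uniform_limit (cball 0 1) (\<lambda>n. E) E sequentially" by (rule uniform_limit_const)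
      have "uniform_limit (cball l 1) (f \<circ> r) g sequentially" by (rule ulim) auto
      then show "uniform_limit (cball 0 1) (\<lambda>n \<zeta>. f (r n) (\<zeta> - (- l))) (\<lambda>\<zeta>. g (\<zeta> - (- l))) sequentially"
        unfolding uniform_limit_iff
        by (auto elim!: eventually_mono simp: dist_norm norm_minus_commute)
      show "bounded (E ` cball 0 1)"
        by (intro compact_imp_bounded compact_continuous_image E) auto
      show "bounded ((\<lambda>\<zeta>. g (\<zeta> - (- l))) ` cball 0 1)"
        by (intro compact_imp_bounded compact_continuous_image continuous_on_compose2[OF cg] continuous_intros) auto
    qed
    then show "uniform_limit (ball 0 1) (\<lambda>n. fock_translation \<alpha> (- l) (f (r n))) (fock_translation \<alpha> (- l) g) sequentially"
      unfolding fock_translation_def[abs_def] E_def by (rule uniform_limit_on_subset) auto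
    show "\<forall>\<^sub>F n in sequentially. fock_translation \<alpha> (- l) (f (r n)) holomorphic_on ball 0 1"
      by (intro always_eventually allI holomorphic_on_subset[OF fock_spaceD(1)[OF fock_translation_space[OF \<alpha> f(1)]]]) auto
  qed auto
  then show thesis using that gF norm_g r by blast
qed

text \<open>Every single condition is met by all but finitely many solutions of the growing finite
  problems, so it holds for a weak limit.\<close>

lemma fock_solvable_limit:
  assumes I: "countable I"
    and fin: "\<And>J. finite J \<Longrightarrow> J \<subseteq> I \<Longrightarrow> fock_solvable \<alpha> J v K"
  shows "fock_solvable \<alpha> I v K"
proof -
  define J where "J n = {i \<in> I. to_nat_on I i \<le> n}" for n
  have "finite (J n)" for n
  proof (rule inj_on_finite[of "to_nat_on I" _ "{..n}"])
    show "inj_on (to_nat_on I) (J n)"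
      by (rule inj_on_subset[OF inj_on_to_nat_on[OF I]]) (auto simp: J_def)
  qed (auto simp: J_def)
  then have "fock_solvable \<alpha> (J n) v K" for n by (rule fin) (auto simp: J_def)
  then have "\<exists>f. \<forall>n. f n \<in> fock_space \<alpha> \<and> fock_norm \<alpha> (f n) \<le> K \<and>
     (\<forall>(l, k)\<in>J n. fock_inner \<alpha> (f n) (fock_translation \<alpha> l (fock_basis \<alpha> k)) = v (l, k))"
    unfolding fock_solvable_def by (intro choice) blast
  then obtain f where f0: "\<forall>n. f n \<in> fock_space \<alpha> \<and> fock_norm \<alpha> (f n) \<le> K \<and>
     (\<forall>(l, k)\<in>J n. fock_inner \<alpha> (f n) (fock_translation \<alpha> l (fock_basis \<alpha> k)) = v (l, k))" ..
  note f = f0[THEN spec, THEN conjunct1] f0[THEN spec, THEN conjunct2, THEN conjunct1]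
  have fJ: "fock_inner \<alpha> (f n) (fock_translation \<alpha> l (fock_basis \<alpha> k)) = v (l, k)" if "(l, k) \<in> J n" for n l k
    using bspec[OF f0[THEN spec, THEN conjunct2, THEN conjunct2] that] by (simp only: prod.case)
  obtain g r where g: "g \<in> fock_space \<alpha>" "fock_norm \<alpha> g \<le> K" and r: "strict_mono (r :: nat \<Rightarrow> nat)"
    and lim: "\<And>l k. (\<lambda>n. fock_inner \<alpha> (f (r n)) (fock_translation \<alpha> l (fock_basis \<alpha> k)))
        \<longlonglongrightarrow> fock_inner \<alpha> g (fock_translation \<alpha> l (fock_basis \<alpha> k))"
    by (rule fock_weak_compactness[of f K, OF f]) (rule that)
  have "fock_inner \<alpha> g (fock_translation \<alpha> l (fock_basis \<alpha> k)) = v (l, k)" if "(l, k) \<in> I" for l k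
  proof (rule LIMSEQ_unique[OF lim tendsto_eventually])
    show "\<forall>\<^sub>F n in sequentially. fock_inner \<alpha> (f (r n)) (fock_translation \<alpha> l (fock_basis \<alpha> k)) = v (l, k)"
      using eventually_ge_at_top[of "to_nat_on I (l, k)"]
    proof eventually_elim
      case (elim n)
      then have "to_nat_on I (l, k) \<le> r n" using seq_suble[OF r, of n] by simp
      with that show ?case by (intro fJ) (simp add: J_def)
    qed
  qed
  with g show ?thesis by (auto simp: fock_solvable_def)
qed

text \<open>A gliding hump argument replaces the open mapping theorem. If the norms of the solutions were
  unbounded, small data blocks with disjoint supports could be summed to square summable data
  without a solution: that norm \<open>n\<close> does not suffice is, by compactness, already visible on a finite set
  of indices, which all later blocks avoid.\<close>

lemma fock_solvable_uniform:
  assumes I: "countable I"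
    and sol: "\<And>v. (\<lambda>i. (cmod (v i))\<^sup>2) summable_on I \<Longrightarrow> \<exists>K. fock_solvable \<alpha> I v K"
  shows "\<exists>K>0. \<forall>J v. finite J \<longrightarrow> J \<subseteq> I \<longrightarrow> (\<Sum>i\<in>J. (cmod (v i))\<^sup>2) \<le> 1 \<longrightarrow> fock_solvable \<alpha> J v K"
proof (rule ccontr)
  assume "\<not> ?thesis"
  then have bad0: "\<exists>J v. finite J \<and> J \<subseteq> I \<and> (\<Sum>i\<in>J. (cmod (v i))\<^sup>2) \<le> 1 \<and> \<not> fock_solvable \<alpha> J v K" if "K > 0" for K
    using that by blast
  have fin_summable: "(\<lambda>i. (cmod (v i))\<^sup>2) summable_on I"
    if "finite J" "\<And>i. i \<notin> J \<Longrightarrow> v i = 0" for J v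
  proof -
    have "(\<lambda>i. (cmod (v i))\<^sup>2) summable_on (I \<inter> J) \<longleftrightarrow> (\<lambda>i. (cmod (v i))\<^sup>2) summable_on I"
      by (rule summable_on_cong_neutral) (use that in auto)
    moreover have "(\<lambda>i. (cmod (v i))\<^sup>2) summable_on (I \<inter> J)" using that by (intro summable_on_finite) auto
    ultimately show ?thesis by simp
  qed
  \<comment> \<open>Unsolvable blocks can be made to avoid a finite set: data bounded by 1 on
    \<open>J0\<close> are solvable at cost at most \<open>S\<close>, so discarding them leaves a
    block that is still not solvable with norm \<open>K\<close>.\<close>
  have bad: "\<exists>J v. finite J \<and> J \<subseteq> I - J0 \<and> (\<forall>i. i \<notin> J \<longrightarrow> v i = 0) \<and>
      (\<Sum>i\<in>J. (cmod (v i))\<^sup>2) \<le> 1 \<and> \<not> fock_solvable \<alpha> I v K"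
    if J0: "finite J0" "J0 \<subseteq> I" for J0 and K :: real
  proof -
    define e where "e a i = (if i = a then 1 else 0 :: complex)" for a i :: "complex \<times> nat"
    have "\<exists>D. \<forall>a. fock_solvable \<alpha> I (e a) (D a)"
      by (intro choice allI sol fin_summable[of "{_}"]) (auto simp: e_def)
    then obtain D where D: "\<And>a. fock_solvable \<alpha> I (e a) (D a)" by blast
    have D0: "D a \<ge> 0" for a
    proof -
      obtain f where "fock_norm \<alpha> f \<le> D a" using D[of a] unfolding fock_solvable_def by blast
      then show ?thesis using fock_norm_nonneg[OF \<alpha>, of f] by linarith
    qed
    define S where "S = (\<Sum>a\<in>J0. D a)"
    have S0: "S \<ge> 0" using D0 by (auto simp: S_def intro: sum_nonneg)
    have "\<bar>K\<bar> + 1 + S > 0" using S0 by linarith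
    from bad0[OF this] obtain J v where J: "finite J" "J \<subseteq> I" and v: "(\<Sum>i\<in>J. (cmod (v i))\<^sup>2) \<le> 1"
      and unsol: "\<not> fock_solvable \<alpha> J v (\<bar>K\<bar> + 1 + S)" by blast
    have v1: "cmod (v a) \<le> 1" if "a \<in> J" for a
    proof -
      have "(cmod (v a))\<^sup>2 \<le> (\<Sum>i\<in>J. (cmod (v i))\<^sup>2)"
        by (rule member_le_sum) (use that J in auto)
      with v have "(cmod (v a))\<^sup>2 \<le> 1\<^sup>2" by simp
      then show ?thesis by (rule power2_le_imp_le) simp
    qed
    define u where "u i = (if i \<in> J - J0 then v i else 0)" for i
    have "\<not> fock_solvable \<alpha> I u K"
    proof
      assume "fock_solvable \<alpha> I u K"
      moreover have "fock_solvable \<alpha> I (\<lambda>i. \<Sum>a\<in>J0 \<inter> J. v a * e a i) (\<Sum>a\<in>J0 \<inter> J. cmod (v a) * D a)"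
        using J0 D by (intro fock_solvable_sum fock_solvable_scale) auto
      ultimately have "fock_solvable \<alpha> I (\<lambda>i. u i + (\<Sum>a\<in>J0 \<inter> J. v a * e a i)) (K + (\<Sum>a\<in>J0 \<inter> J. cmod (v a) * D a))"
        by (rule fock_solvable_add)
      moreover have "(\<Sum>a\<in>J0 \<inter> J. cmod (v a) * D a) \<le> S"
      proof -
        have "(\<Sum>a\<in>J0 \<inter> J. cmod (v a) * D a) \<le> (\<Sum>a\<in>J0 \<inter> J. D a)"
          by (intro sum_mono mult_left_le_one_le D0 v1) auto
        also have "\<dots> \<le> S" unfolding S_def using J0 D0 by (intro sum_mono2) auto
        finally show ?thesis .
      qed
      moreover have "u i + (\<Sum>a\<in>J0 \<inter> J. v a * e a i) = v i" if "i \<in> J" for i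
        using that J0 by (auto simp: u_def e_def if_distrib sum.delta' cong: if_cong)
      ultimately have "fock_solvable \<alpha> J v (\<bar>K\<bar> + 1 + S)"
        by (elim fock_solvable_mono) (use J in auto)
      with unsol show False by simp
    qed
    moreover have "(\<Sum>i\<in>J - J0. (cmod (u i))\<^sup>2) \<le> 1"
    proof -
      have "(\<Sum>i\<in>J - J0. (cmod (u i))\<^sup>2) \<le> (\<Sum>i\<in>J. (cmod (v i))\<^sup>2)"
        using J by (intro order_trans[OF _ sum_mono2[of J "J - J0"]] sum_mono) (auto simp: u_def)
      with v show ?thesis by simp
    qed
    ultimately show ?thesis
      using J by (intro exI[of _ "J - J0"] exI[of _ u]) (auto simp: u_def)
  qed
  \<comment> \<open>The budget is 0 for the empty data and stays below 2; a block of size at most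
    1/4^n always fits, as 1/4^n \<le> 2/4^n - 2/4^(n + 1).\<close>
  define P where "P n s = (case s of (u, J) \<Rightarrow> finite J \<and> J \<subseteq> I \<and> (\<forall>i. i \<notin> J \<longrightarrow> u i = 0) \<and>
      (\<Sum>i\<in>J. (cmod (u i))\<^sup>2) \<le> 2 - 2 / 4 ^ n)" for n :: nat and s :: "(complex \<times> nat \<Rightarrow> complex) \<times> (complex \<times> nat) set"
  define Q where "Q n s s' = (case s of (u, J) \<Rightarrow> case s' of (u', J') \<Rightarrow> J \<subseteq> J' \<and> (\<forall>i\<in>J. u' i = u i) \<and>
      \<not> fock_solvable \<alpha> J' u' (real n))" for n :: nat and s s' :: "(complex \<times> nat \<Rightarrow> complex) \<times> (complex \<times> nat) set"
  have "\<exists>s. \<forall>n. P n (s n) \<and> Q n (s n) (s (Suc n))"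
  proof (rule dependent_nat_choice)
    show "\<exists>s. P 0 s" by (rule exI[of _ "(\<lambda>_. 0, {})"]) (simp add: P_def)
  next
    fix s n
    assume "P n s"
    obtain u J where s: "s = (u, J)" by (cases s)
    have J: "finite J" "J \<subseteq> I" and u0: "\<And>i. i \<notin> J \<Longrightarrow> u i = 0"
      and uJ: "(\<Sum>i\<in>J. (cmod (u i))\<^sup>2) \<le> 2 - 2 / 4 ^ n"
      using \<open>P n s\<close> by (auto simp: P_def s)
    obtain S where S: "fock_solvable \<alpha> I u S" using sol[OF fin_summable[of J u, OF J(1) u0]] by blast
    \<comment> \<open>The bound is chosen so that the block, scaled by 2^(-n) and added to
      \<open>u\<close>, is not solvable with norm n: solving for \<open>u\<close> costs only
      \<open>S\<close>.\<close>
    obtain J1 b where J1: "finite J1" "J1 \<subseteq> I - J" and b0: "\<And>i. i \<notin> J1 \<Longrightarrow> b i = 0"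
      and bJ: "(\<Sum>i\<in>J1. (cmod (b i))\<^sup>2) \<le> 1" and bsol: "\<not> fock_solvable \<alpha> I b (2 ^ n * (real n + S))"
      using bad[OF J, of "2 ^ n * (real n + S)"] by blast
    define u' where "u' i = u i + b i / 2 ^ n" for i
    have "\<not> fock_solvable \<alpha> I u' (real n)"
    proof
      assume "fock_solvable \<alpha> I u' (real n)"
      from fock_solvable_scale[OF fock_solvable_add[OF this fock_solvable_scale[OF S, of "-1"]], of "2 ^ n"]
      have "fock_solvable \<alpha> I b (2 ^ n * (real n + S))"
        by (simp add: u'_def norm_power)
      with bsol show False by simp
    qed
    with fock_solvable_limit[OF I] obtain F where F: "finite F" "F \<subseteq> I" "\<not> fock_solvable \<alpha> F u' (real n)"
      by blast
    \<comment> \<open>Including \<open>F\<close> protects the failure: no later block changes the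
      data on \<open>J'\<close>.\<close>
    define J' where "J' = J \<union> J1 \<union> F"
    have fin: "finite J'" "J' \<subseteq> I" using J J1 F by (auto simp: J'_def)
    have uJ': "u' i = u i" if "i \<in> J" for i using that J1 b0[of i] by (auto simp: u'_def)
    have uJ1: "u' i = b i / 2 ^ n" if "i \<in> J1" for i using that J1 u0[of i] by (auto simp: u'_def)
    have "(\<Sum>i\<in>J'. (cmod (u' i))\<^sup>2) = (\<Sum>i\<in>J \<union> J1. (cmod (u' i))\<^sup>2)"
      by (rule sum.mono_neutral_right) (use fin u0 b0 in \<open>auto simp: J'_def u'_def\<close>)
    also have "\<dots> = (\<Sum>i\<in>J. (cmod (u' i))\<^sup>2) + (\<Sum>i\<in>J1. (cmod (u' i))\<^sup>2)"
      using J J1 by (intro sum.union_disjoint) auto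
    also have "(\<Sum>i\<in>J. (cmod (u' i))\<^sup>2) = (\<Sum>i\<in>J. (cmod (u i))\<^sup>2)" using uJ' by simp
    also have "(\<Sum>i\<in>J1. (cmod (u' i))\<^sup>2) = (\<Sum>i\<in>J1. (cmod (b i))\<^sup>2) / 4 ^ n"
      unfolding sum_divide_distrib
    proof (rule sum.cong)
      have "(2 ^ n)\<^sup>2 = (4 :: real) ^ n" by (simp add: power2_eq_square flip: power_mult_distrib)
      then show "(cmod (u' i))\<^sup>2 = (cmod (b i))\<^sup>2 / 4 ^ n" if "i \<in> J1" for i
        using uJ1[OF that] by (simp add: norm_divide norm_power power_divide)
    qed simp
    also have "\<dots> \<le> 1 / 4 ^ n" using bJ by (intro divide_right_mono) auto
    finally have "(\<Sum>i\<in>J'. (cmod (u' i))\<^sup>2) \<le> 2 - 2 / 4 ^ Suc n" using uJ by (simp add: field_simps)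
    moreover have "u' i = 0" if "i \<notin> J'" for i using that u0[of i] b0[of i] by (auto simp: J'_def u'_def)
    ultimately have "P (Suc n) (u', J')" using fin by (auto simp: P_def)
    moreover have "Q n s (u', J')"
      using F(3) fock_solvable_mono[of \<alpha> J' u' "real n" F "real n" u'] uJ' by (auto simp: Q_def s J'_def)
    ultimately show "\<exists>s'. P (Suc n) s' \<and> Q n s s'" by blast
  qed
  then obtain s where s: "\<And>n. P n (s n)" "\<And>n. Q n (s n) (s (Suc n))" by blast
  define u where "u n = fst (s n)" for n
  define J where "J n = snd (s n)" for n
  have P: "finite (J n)" "J n \<subseteq> I" "(\<Sum>i\<in>J n. (cmod (u n i))\<^sup>2) \<le> 2 - 2 / 4 ^ n" for n
    using s(1)[of n] by (auto simp: P_def u_def J_def split_beta)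
  have Q: "J n \<subseteq> J (Suc n)" "\<And>i. i \<in> J n \<Longrightarrow> u (Suc n) i = u n i" "\<not> fock_solvable \<alpha> (J (Suc n)) (u (Suc n)) (real n)" for n
    using s(2)[of n] by (auto simp: Q_def u_def J_def split_beta)
  have Jmono: "J n \<subseteq> J m" if "n \<le> m" for n m using Q(1) that by (rule lift_Suc_mono_le)
  have um: "u m i = u n i" if "n \<le> m" "i \<in> J n" for n m i
    using that(1)
  proof (induction rule: dec_induct)
    case (step m)
    then show ?case using Q(2)[of i m] Jmono[of n m] that(2) by auto
  qed simp
  define w where "w i = (if \<exists>n. i \<in> J n then u (LEAST n. i \<in> J n) i else 0)" for i
  have w: "w i = u n i" if "i \<in> J n" for n i
  proof -
    have "(LEAST n. i \<in> J n) \<le> n" "i \<in> J (LEAST n. i \<in> J n)"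
      using that by (auto intro: Least_le LeastI)
    from um[OF this] show ?thesis using that by (auto simp: w_def)
  qed
  have "(\<lambda>i. (cmod (w i))\<^sup>2) summable_on I"
  proof (rule nonneg_bdd_above_summable_on)
    show "bdd_above (sum (\<lambda>i. (cmod (w i))\<^sup>2) ` {F. F \<subseteq> I \<and> finite F})"
    proof (rule bdd_aboveI2)
      fix F assume "F \<in> {F. F \<subseteq> I \<and> finite F}"
      then have F: "finite F" by simp
      then have "\<exists>N. F \<inter> (\<Union>n. J n) \<subseteq> J N"
      proof (induction rule: finite_induct)
        case (insert a F)
        then obtain N where N: "F \<inter> (\<Union>n. J n) \<subseteq> J N" by blast
        show ?case
        proof (cases "a \<in> (\<Union>n. J n)")
          case True
          then obtain n where "a \<in> J n" by blast
          then show ?thesis using N Jmono[of n "max n N"] Jmono[of N "max n N"]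
            by (intro exI[of _ "max n N"]) auto
        next
          case False
          then show ?thesis using N by (intro exI[of _ N]) auto
        qed
      qed simp
      then obtain N where N: "F \<inter> (\<Union>n. J n) \<subseteq> J N" by blast
      have "(\<Sum>i\<in>F. (cmod (w i))\<^sup>2) = (\<Sum>i\<in>F \<inter> (\<Union>n. J n). (cmod (w i))\<^sup>2)"
        using F by (intro sum.mono_neutral_right) (auto simp: w_def)
      also have "\<dots> \<le> (\<Sum>i\<in>J N. (cmod (w i))\<^sup>2)" using N P(1) by (intro sum_mono2) auto
      also have "\<dots> = (\<Sum>i\<in>J N. (cmod (u N i))\<^sup>2)" by (simp add: w)
      also have "\<dots> \<le> 2 - 2 / 4 ^ N" by (rule P)
      also have "\<dots> \<le> 2" by simp
      finally show "(\<Sum>i\<in>F. (cmod (w i))\<^sup>2) \<le> 2" .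
    qed
  qed auto
  with sol obtain K where K: "fock_solvable \<alpha> I w K" by blast
  obtain n :: nat where "K \<le> real n" using real_arch_simple by blast
  with K have "fock_solvable \<alpha> (J (Suc n)) (u (Suc n)) (real n)"
    by (rule fock_solvable_mono[OF _ P(2)]) (simp add: w)
  with Q(3)[of n] show False by simp
qed

end

subsection \<open>Interpolation forces the shrunken discs to be disjoint\<close>

text \<open>A Chernoff bound. For k \<ge> m the ratio of x^k to m^k is at most (x/m)^m, so the tail
  is at most exp (m - x) (x/m)^m; then sqrt (x/m) \<le> exp (sqrt (x/m) - 1) completes the square in
  the exponent.\<close>

lemma poisson_tail:
  fixes x :: real
  assumes "0 \<le> x" "x \<le> real m"
  shows "1 - (\<Sum>k<m. exp (- x) * x ^ k / fact k) \<le> exp (- (sqrt (real m) - sqrt x)\<^sup>2)"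
proof (cases "m = 0")
  case True
  then show ?thesis using assms by simp
next
  case False
  define t where "t = x / real m"
  have t: "0 \<le> t" "t \<le> 1" using assms False by (auto simp: t_def)
  have sums: "(\<lambda>k. y ^ k / fact k) sums exp y" for y :: real
    using exp_converges[of y] by (simp add: divide_inverse mult.commute)
  have s1: "(\<lambda>k. x ^ (k + m) / fact (k + m)) sums (exp x - (\<Sum>k<m. x ^ k / fact k))"
    by (rule sums_split_initial_segment[OF sums])
  have s2: "(\<lambda>k. t ^ m * (real m ^ (k + m) / fact (k + m))) sums (t ^ m * (exp (real m) - (\<Sum>k<m. real m ^ k / fact k)))"
    by (intro sums_mult sums_split_initial_segment sums)
  have "exp x - (\<Sum>k<m. x ^ k / fact k) \<le> t ^ m * (exp (real m) - (\<Sum>k<m. real m ^ k / fact k))"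
  proof (rule sums_le[OF _ s1 s2])
    fix k
    have "x ^ (k + m) = t ^ (k + m) * real m ^ (k + m)"
      using False by (simp add: t_def power_divide)
    also have "\<dots> \<le> t ^ m * real m ^ (k + m)"
      using t by (intro mult_right_mono power_decreasing) auto
    finally show "x ^ (k + m) / fact (k + m) \<le> t ^ m * (real m ^ (k + m) / fact (k + m))"
      by (simp add: divide_right_mono)
  qed
  also have "\<dots> \<le> t ^ m * exp (real m)"
    using t by (intro mult_left_mono) (auto intro!: sum_nonneg)
  finally have 1: "exp x - (\<Sum>k<m. x ^ k / fact k) \<le> t ^ m * exp (real m)" .
  have "1 - (\<Sum>k<m. exp (- x) * x ^ k / fact k) = exp (- x) * (exp x - (\<Sum>k<m. x ^ k / fact k))"
    by (simp add: right_diff_distrib sum_distrib_left exp_minus)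
  also have "\<dots> \<le> exp (- x) * (t ^ m * exp (real m))"
    using 1 by (intro mult_left_mono) auto
  also have "t ^ m = (sqrt x / sqrt (real m)) ^ (2 * m)"
    using assms by (simp add: t_def power_mult power_divide)
  also have "\<dots> \<le> exp (sqrt x / sqrt (real m) - 1) ^ (2 * m)"
    using exp_ge_add_one_self[of "sqrt x / sqrt (real m) - 1"] assms by (intro power_mono) auto
  also have "\<dots> = exp (2 * real m * (sqrt x / sqrt (real m) - 1))"
    by (simp add: exp_of_nat_mult[symmetric])
  also have "2 * real m * (sqrt x / sqrt (real m) - 1) = 2 * (sqrt x * sqrt (real m)) - 2 * real m"
  proof -
    have "real m / sqrt (real m) = sqrt (real m)" by (rule real_div_sqrt) simp
    moreover have "2 * real m * (sqrt x / sqrt (real m) - 1) = 2 * (sqrt x * (real m / sqrt (real m))) - 2 * real m"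
      by (simp add: right_diff_distrib)
    ultimately show ?thesis by (simp only:)
  qed
  also have "exp (- x) * (exp (2 * (sqrt x * sqrt (real m)) - 2 * real m) * exp (real m)) =
      exp (- (sqrt (real m) - sqrt x)\<^sup>2)"
    using assms by (simp add: exp_add[symmetric] power2_diff algebra_simps)
  finally show ?thesis by (simp add: mult_ac)
qed

lemma higher_deriv_cexp:
  "(deriv ^^ k) (\<lambda>z. C * exp (c * z)) = (\<lambda>z. C * c ^ k * exp (c * z :: complex))"
proof (induction k)
  case (Suc k)
  have "deriv (\<lambda>z. C * c ^ k * exp (c * z)) z = C * c ^ Suc k * exp (c * z)" for z
    by (rule DERIV_imp_deriv) (auto intro!: derivative_eq_intros)
  then show ?case by (simp add: Suc fun_eq_iff)
qed simp

section \<open>Coherent states and the collision of two discs\<close>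

context
  fixes \<alpha> :: real
  assumes \<alpha>: "\<alpha> > 0"
begin

abbreviation "fock_atom l k \<equiv> fock_translation \<alpha> l (fock_basis \<alpha> k)"

lemma fock_atom_space: "fock_atom l k \<in> fock_space \<alpha>"
  by (intro fock_translation_space fock_basis_space \<alpha>)

text \<open>In coordinates centred at \<open>l\<close> the coherent state at \<open>w\<close> is a
  multiple of an exponential, so the squared coefficients are the Poisson weights of mean \<alpha>
  |w - l|^2.\<close>

lemma coherent_state_coeff:
  "(cmod (fock_inner \<alpha> (fock_atom w 0) (fock_atom l k)))\<^sup>2 =
    exp (- (\<alpha> * (cmod (w - l))\<^sup>2)) * (\<alpha> * (cmod (w - l))\<^sup>2) ^ k / fact k"
proof -
  define x where "x = \<alpha> * (cmod (w - l))\<^sup>2"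
  define C where "C = exp (of_real \<alpha> * cnj w * l - of_real (\<alpha> / 2 * (cmod l)\<^sup>2) - of_real (\<alpha> / 2 * (cmod w)\<^sup>2))"
  define c where "c = of_real \<alpha> * cnj (w - l)"
  have "fock_translation \<alpha> (- l) (fock_atom w 0) = (\<lambda>z. C * exp (c * z))"
    unfolding fock_translation_def fock_basis_def C_def c_def exp_add[symmetric]
    by (rule ext) (simp add: exp_add[symmetric] algebra_simps)
  then have eq: "fock_inner \<alpha> (fock_atom w 0) (fock_atom l k) =
      of_real (sqrt (fact k / \<alpha> ^ k)) * (C * c ^ k / fact k)"
    using fock_inner_translation_basis[OF \<alpha> fock_atom_space[of w 0], of l k] by (simp add: higher_deriv_cexp)
  have C: "(cmod C)\<^sup>2 = exp (- x)"
  proof -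
    have "(cmod (w - l))\<^sup>2 = (cmod w)\<^sup>2 + (cmod l)\<^sup>2 - 2 * Re (cnj w * l)"
      unfolding cmod_power2 by (simp add: power2_eq_square algebra_simps)
    then have "2 * (\<alpha> * Re (cnj w * l) - \<alpha> / 2 * (cmod l)\<^sup>2 - \<alpha> / 2 * (cmod w)\<^sup>2) = - x"
      unfolding x_def by (simp only:) (simp add: algebra_simps)
    moreover have "cmod C = exp (\<alpha> * Re (cnj w * l) - \<alpha> / 2 * (cmod l)\<^sup>2 - \<alpha> / 2 * (cmod w)\<^sup>2)"
    proof -
      have "Re (of_real \<alpha> * (cnj w * l)) = \<alpha> * Re (cnj w * l)" by simp
      then show ?thesis
        by (simp only: C_def norm_exp_eq_Re minus_complex.sel Re_complex_of_real mult.assoc)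
    qed
    ultimately show ?thesis by (simp add: exp_double[symmetric])
  qed
  have "(cmod c)\<^sup>2 = \<alpha> * x" by (simp add: c_def x_def norm_mult power_mult_distrib power2_eq_square flip: complex_cnj_diff)
  then have c: "(cmod c ^ k)\<^sup>2 = (\<alpha> * x) ^ k" by (simp add: power_mult[symmetric] mult.commute[of k]) (simp add: power_mult)
  have "(cmod (fock_inner \<alpha> (fock_atom w 0) (fock_atom l k)))\<^sup>2 =
      fact k / \<alpha> ^ k * (exp (- x) * (\<alpha> * x) ^ k / (fact k)\<^sup>2)"
    unfolding eq using \<alpha> C c by (simp add: norm_mult norm_divide norm_power power_mult_distrib power_divide)
  also have "\<dots> = exp (- x) * x ^ k / fact k"
    using \<alpha> by (simp add: power_mult_distrib power2_eq_square)
  finally show ?thesis by (simp add: x_def)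
qed

lemma fock_atom_orthonormal: "fock_inner \<alpha> (fock_atom l j) (fock_atom l k) = (if j = k then 1 else 0)"
  by (simp add: fock_inner_translation[OF \<alpha>] fock_inner_basis_basis[OF \<alpha>])

text \<open>Pythagoras for the orthogonal projection onto the span of the first \<open>m\<close>
  atoms at \<open>l\<close>.\<close>

lemma fock_projection_residual:
  assumes g: "g \<in> fock_space \<alpha>"
  shows "(fock_norm \<alpha> (\<lambda>z. (\<Sum>k<m. fock_inner \<alpha> g (fock_atom l k) * fock_atom l k z) - g z))\<^sup>2 =
    (fock_norm \<alpha> g)\<^sup>2 - (\<Sum>k<m. (cmod (fock_inner \<alpha> g (fock_atom l k)))\<^sup>2)"
proof -
  define a where "a k = fock_inner \<alpha> g (fock_atom l k)" for k
  define p where "p z = (\<Sum>k<m. a k * fock_atom l k z)" for z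
  have pF: "p \<in> fock_space \<alpha>"
    unfolding p_def by (intro fock_space_sum fock_space_scale fock_atom_space)
  have gF: "(\<lambda>z. (-1) * g z) \<in> fock_space \<alpha>" using g by (rule fock_space_scale)
  have gp: "fock_inner \<alpha> g p = of_real (\<Sum>k<m. (cmod (a k))\<^sup>2)"
  proof -
    have "fock_inner \<alpha> g p = (\<Sum>k<m. fock_inner \<alpha> g (\<lambda>z. a k * fock_atom l k z))"
      unfolding p_def by (rule fock_inner_sum_right[OF fock_space_scale[OF fock_atom_space] g])
    also have "\<dots> = (\<Sum>k<m. of_real ((cmod (a k))\<^sup>2))"
      unfolding complex_norm_square by (intro sum.cong refl) (simp only: fock_inner_scale_right, simp add: a_def mult.commute)
    finally show ?thesis by simp
  qed
  have pg: "fock_inner \<alpha> p g = of_real (\<Sum>k<m. (cmod (a k))\<^sup>2)"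
    using fock_inner_cnj[of \<alpha> g p] gp by simp
  have pp: "fock_inner \<alpha> p p = of_real (\<Sum>k<m. (cmod (a k))\<^sup>2)"
  proof -
    have "fock_inner \<alpha> (fock_atom l j) p = cnj (a j)" if "j < m" for j
    proof -
      have "fock_inner \<alpha> (fock_atom l j) p = (\<Sum>k<m. fock_inner \<alpha> (fock_atom l j) (\<lambda>z. a k * fock_atom l k z))"
        unfolding p_def by (rule fock_inner_sum_right[OF fock_space_scale[OF fock_atom_space] fock_atom_space])
      also have "\<dots> = (\<Sum>k<m. cnj (a k) * (if j = k then 1 else 0))"
        by (simp only: fock_inner_scale_right fock_atom_orthonormal)
      also have "\<dots> = cnj (a j)" using that by (simp add: if_distrib sum.delta cong: if_cong)
      finally show ?thesis .
    qed
    note atom_p = this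
    have "fock_inner \<alpha> p p = (\<Sum>k<m. fock_inner \<alpha> (\<lambda>z. a k * fock_atom l k z) p)"
      unfolding p_def[abs_def]
      by (rule fock_inner_sum_left[OF fock_space_scale[OF fock_atom_space] pF[unfolded p_def[abs_def]]])
    also have "\<dots> = (\<Sum>k<m. of_real ((cmod (a k))\<^sup>2))"
      unfolding complex_norm_square by (intro sum.cong refl) (simp only: fock_inner_scale_left, simp add: atom_p)
    finally show ?thesis by simp
  qed
  have "of_real ((fock_norm \<alpha> (\<lambda>z. p z - g z))\<^sup>2) = fock_inner \<alpha> (\<lambda>z. p z + (-1) * g z) (\<lambda>z. p z + (-1) * g z)"
    by (simp add: fock_inner_self[OF \<alpha>])
  also have "\<dots> = fock_inner \<alpha> p p - fock_inner \<alpha> p g - fock_inner \<alpha> g p + fock_inner \<alpha> g g"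
    unfolding fock_inner_add_left[OF pF gF fock_space_add[OF pF gF]] fock_inner_scale_left
      fock_inner_add_right[OF pF gF pF] fock_inner_add_right[OF pF gF g] fock_inner_scale_right by simp
  also have "\<dots> = of_real ((fock_norm \<alpha> g)\<^sup>2 - (\<Sum>k<m. (cmod (a k))\<^sup>2))"
    unfolding pp pg gp unfolding fock_inner_self[OF \<alpha>] by simp
  finally show ?thesis unfolding p_def a_def by (simp only: of_real_eq_iff)
qed

text \<open>The hypothesis says that sqrt m exceeds the square root of the Poisson mean by at least
  sqrt \<alpha> c, which is the gap that \<open>poisson_tail\<close> turns into decay.\<close>

lemma coherent_state_residual:
  assumes "cmod (w - l) < sqrt (real m / \<alpha>) - c" "c \<ge> 0"
  shows "fock_norm \<alpha> (\<lambda>z. (\<Sum>k<m. fock_inner \<alpha> (fock_atom w 0) (fock_atom l k) * fock_atom l k z) - fock_atom w 0 z)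
      \<le> exp (- (\<alpha> * c\<^sup>2) / 2)" (is "?R \<le> _")
    and "(\<Sum>k<m. (cmod (fock_inner \<alpha> (fock_atom w 0) (fock_atom l k)))\<^sup>2) \<ge> 1 - exp (- (\<alpha> * c\<^sup>2))" (is "?S \<ge> _")
    and "(\<Sum>k<m. (cmod (fock_inner \<alpha> (fock_atom w 0) (fock_atom l k)))\<^sup>2) \<le> 1"
proof -
  define x where "x = \<alpha> * (cmod (w - l))\<^sup>2"
  have sx: "sqrt x = sqrt \<alpha> * cmod (w - l)" using \<alpha> by (simp add: x_def real_sqrt_mult)
  have "sqrt \<alpha> * (cmod (w - l) + c) \<le> sqrt \<alpha> * sqrt (real m / \<alpha>)"
    using assms \<alpha> by (intro mult_left_mono) auto
  also have "\<dots> = sqrt (real m)" using \<alpha> by (simp add: real_sqrt_mult[symmetric])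
  finally have le: "sqrt \<alpha> * c \<le> sqrt (real m) - sqrt x" by (simp add: sx algebra_simps)
  have x: "0 \<le> x" "x \<le> real m"
  proof -
    show "0 \<le> x" using \<alpha> by (simp add: x_def)
    have "0 \<le> sqrt \<alpha> * c" using \<alpha> assms(2) by simp
    with le have "sqrt x \<le> sqrt (real m)" by linarith
    then show "x \<le> real m" by simp
  qed
  have S: "?S = (\<Sum>k<m. exp (- x) * x ^ k / fact k)"
    by (intro sum.cong refl) (simp add: coherent_state_coeff x_def)
  have "(sqrt \<alpha> * c)\<^sup>2 \<le> (sqrt (real m) - sqrt x)\<^sup>2"
    using le \<alpha> assms(2) by (intro power_mono) auto
  then have "\<alpha> * c\<^sup>2 \<le> (sqrt (real m) - sqrt x)\<^sup>2"
    using \<alpha> by (simp add: power_mult_distrib)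
  then have 1: "1 - ?S \<le> exp (- (\<alpha> * c\<^sup>2))"
    unfolding S using poisson_tail[OF x] by (meson exp_le_cancel_iff neg_le_iff_le order_trans)
  then show "?S \<ge> 1 - exp (- (\<alpha> * c\<^sup>2))" by linarith
  have R: "?R\<^sup>2 = 1 - ?S"
    using fock_projection_residual[OF fock_atom_space[of w 0], where m=m and l=l]
    by (simp add: fock_norm_translation[OF \<alpha>] fock_norm_basis[OF \<alpha>])
  then show "?S \<le> 1" using zero_le_power2[of ?R] by linarith
  have "?R\<^sup>2 \<le> (exp (- (\<alpha> * c\<^sup>2) / 2))\<^sup>2"
    using 1 R by (simp add: exp_double[symmetric])
  then show "?R \<le> exp (- (\<alpha> * c\<^sup>2) / 2)" by (rule power2_le_imp_le) simp
qed

lemma l2_data_finite_support: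
  assumes J: "finite J" "J \<subseteq> divisor_index \<Lambda> m"
    and v: "\<And>l k. (l, k) \<in> divisor_index \<Lambda> m \<Longrightarrow> (l, k) \<notin> J \<Longrightarrow> v l k = 0"
  shows "l2_data \<Lambda> m v" "data_norm \<Lambda> m v = sqrt (\<Sum>(l, k)\<in>J. (cmod (v l k))\<^sup>2)"
proof -
  have "(\<lambda>(l, k). (cmod (v l k))\<^sup>2) summable_on J \<longleftrightarrow> (\<lambda>(l, k). (cmod (v l k))\<^sup>2) summable_on divisor_index \<Lambda> m"
    by (rule summable_on_cong_neutral) (use J v in auto)
  then show "l2_data \<Lambda> m v" using J by (simp add: l2_data_def)
  have "infsum (\<lambda>(l, k). (cmod (v l k))\<^sup>2) J = infsum (\<lambda>(l, k). (cmod (v l k))\<^sup>2) (divisor_index \<Lambda> m)"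
    by (rule infsum_cong_neutral) (use J v in auto)
  then show "data_norm \<Lambda> m v = sqrt (\<Sum>(l, k)\<in>J. (cmod (v l k))\<^sup>2)"
    using J by (simp add: data_norm_def)
qed

lemma interpolating_balls_disjoint:
  assumes K: "K > 0"
    and sol: "\<And>v. l2_data \<Lambda> m v \<Longrightarrow>
       \<exists>f\<in>fock_space \<alpha>. interpolates \<alpha> \<Lambda> m f v \<and> fock_norm \<alpha> f \<le> K * data_norm \<Lambda> m v"
    and c: "c \<ge> 0" "exp (- (\<alpha> * c\<^sup>2) / 2) \<le> 1 / (2 * (K + 1))"
    and l: "l1 \<in> \<Lambda>" "l2 \<in> \<Lambda>" "l1 \<noteq> l2"
  shows "ball l1 (sqrt (real (m l1) / \<alpha>) - c) \<inter> ball l2 (sqrt (real (m l2) / \<alpha>) - c) = {}"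
proof (rule ccontr)
  assume "\<not> ?thesis"
  then obtain w where w: "cmod (w - l1) < sqrt (real (m l1) / \<alpha>) - c" "cmod (w - l2) < sqrt (real (m l2) / \<alpha>) - c"
    by (auto simp: dist_norm norm_minus_commute)
  define \<epsilon> where "\<epsilon> = exp (- (\<alpha> * c\<^sup>2) / 2)"
  have \<epsilon>2: "exp (- (\<alpha> * c\<^sup>2)) = \<epsilon>\<^sup>2" by (simp add: \<epsilon>_def exp_double[symmetric])
  have \<epsilon>: "\<epsilon> > 0" "\<epsilon> \<le> 1 / (2 * (K + 1))" using c by (auto simp: \<epsilon>_def)
  define a where "a l k = fock_inner \<alpha> (fock_atom w 0) (fock_atom l k)" for l k
  define S where "S l = (\<Sum>k<m l. (cmod (a l k))\<^sup>2)" for l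
  define p where "p l z = (\<Sum>k<m l. a l k * fock_atom l k z)" for l z
  have S: "1 - \<epsilon>\<^sup>2 \<le> S l" "S l \<le> 1" and p: "fock_norm \<alpha> (\<lambda>z. p l z - fock_atom w 0 z) \<le> \<epsilon>"
    if "l \<in> {l1, l2}" for l
  proof -
    have wl: "cmod (w - l) < sqrt (real (m l) / \<alpha>) - c" using w that by auto
    show "1 - \<epsilon>\<^sup>2 \<le> S l" "S l \<le> 1" "fock_norm \<alpha> (\<lambda>z. p l z - fock_atom w 0 z) \<le> \<epsilon>"
      using coherent_state_residual[OF wl c(1)] unfolding S_def p_def a_def \<epsilon>2 \<epsilon>_def[symmetric] by auto
  qed
  \<comment> \<open>Opposite signs at the two points: the pairings of \<open>f\<close> with
    \<open>p l1\<close> and \<open>p l2\<close> then differ by about 2, although these two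
    projections nearly coincide.\<close>
  define v where "v l k = (if l = l1 then a l1 k else if l = l2 then - a l2 k else 0)" for l k
  define J where "J = (SIGMA l:{l1, l2}. {..<m l})"
  have J: "finite J" "J \<subseteq> divisor_index \<Lambda> m" using l by (auto simp: J_def divisor_index_def)
  have vJ: "v l k = 0" if "(l, k) \<in> divisor_index \<Lambda> m" "(l, k) \<notin> J" for l k
    using that by (auto simp: v_def J_def divisor_index_def)
  have "(\<Sum>(l, k)\<in>J. (cmod (v l k))\<^sup>2) = (\<Sum>l\<in>{l1, l2}. \<Sum>k<m l. (cmod (v l k))\<^sup>2)"
    unfolding J_def by (rule sum.Sigma[symmetric]) auto
  also have "\<dots> = S l1 + S l2" using l(3) by (simp add: S_def v_def)
  finally have dn: "data_norm \<Lambda> m v = sqrt (S l1 + S l2)"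
    using l2_data_finite_support(2)[where v=v, OF J vJ] by simp
  obtain f where f: "f \<in> fock_space \<alpha>" "interpolates \<alpha> \<Lambda> m f v" "fock_norm \<alpha> f \<le> K * data_norm \<Lambda> m v"
    using sol[OF l2_data_finite_support(1)[where v=v, OF J vJ]] by blast
  have "sqrt (S l1 + S l2) \<le> sqrt 2" using S(2)[of l1] S(2)[of l2] by (intro real_sqrt_le_mono) auto
  then have fn: "fock_norm \<alpha> f \<le> K * sqrt 2"
    using f(3) K unfolding dn by (meson mult_left_mono order_trans less_imp_le)
  have pF: "p l \<in> fock_space \<alpha>" for l
    unfolding p_def by (intro fock_space_sum fock_space_scale fock_atom_space)
  have fp: "fock_inner \<alpha> f (p l) = (\<Sum>k<m l. cnj (a l k) * v l k)" if "l \<in> \<Lambda>" for l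
  proof -
    have "fock_inner \<alpha> f (p l) = (\<Sum>k<m l. fock_inner \<alpha> f (\<lambda>z. a l k * fock_atom l k z))"
      unfolding p_def by (rule fock_inner_sum_right[OF fock_space_scale[OF fock_atom_space] f(1)])
    also have "\<dots> = (\<Sum>k<m l. cnj (a l k) * v l k)"
      using f(2) that by (intro sum.cong refl) (simp add: fock_inner_scale_right interpolates_def)
    finally show ?thesis .
  qed
  have f1: "fock_inner \<alpha> f (p l1) = of_real (S l1)"
    unfolding fp[OF l(1)] S_def of_real_sum complex_norm_square
    by (intro sum.cong refl) (simp add: v_def mult.commute)
  have f2: "fock_inner \<alpha> f (p l2) = - of_real (S l2)"
    unfolding fp[OF l(2)] S_def of_real_sum complex_norm_square sum_negf[symmetric]
    using l(3) by (intro sum.cong refl) (simp add: v_def mult.commute)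
  define d1 where "d1 z = p l1 z - fock_atom w 0 z" for z
  define d2 where "d2 z = p l2 z - fock_atom w 0 z" for z
  have dF: "d1 \<in> fock_space \<alpha>" "d2 \<in> fock_space \<alpha>"
    using fock_space_add[OF pF fock_space_scale[OF fock_atom_space[of w 0], of "-1"]]
    by (auto simp: d1_def[abs_def] d2_def[abs_def])
  have d2F: "(\<lambda>z. (-1) * d2 z) \<in> fock_space \<alpha>" by (intro fock_space_scale dF)
  have p2F: "(\<lambda>z. (-1) * p l2 z) \<in> fock_space \<alpha>" by (intro fock_space_scale pF)
  have eq: "(\<lambda>z. p l1 z + (-1) * p l2 z) = (\<lambda>z. d1 z + (-1) * d2 z)"
    by (auto simp: d1_def d2_def)
  have "of_real (S l1 + S l2) = fock_inner \<alpha> f (\<lambda>z. p l1 z + (-1) * p l2 z)"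
    unfolding fock_inner_add_right[OF pF p2F f(1)] fock_inner_scale_right f1 f2 by simp
  then have "cmod (of_real (S l1 + S l2)) = cmod (fock_inner \<alpha> f (\<lambda>z. d1 z + (-1) * d2 z))"
    by (simp only: eq)
  moreover have "0 \<le> S l1 + S l2" by (auto simp: S_def intro!: add_nonneg_nonneg sum_nonneg)
  ultimately have "S l1 + S l2 = cmod (fock_inner \<alpha> f (\<lambda>z. d1 z + (-1) * d2 z))"
    by (simp only: norm_of_real abs_of_nonneg)
  also have "\<dots> \<le> fock_norm \<alpha> f * fock_norm \<alpha> (\<lambda>z. d1 z + (-1) * d2 z)"
    by (rule fock_Cauchy_Schwarz[OF \<alpha> f(1) fock_space_add[OF dF(1) d2F]])
  also have "\<dots> \<le> (K * sqrt 2) * (2 * \<epsilon>)"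
  proof (rule mult_mono[OF fn])
    have "fock_norm \<alpha> (\<lambda>z. d1 z + (-1) * d2 z) \<le> fock_norm \<alpha> d1 + fock_norm \<alpha> (\<lambda>z. (-1) * d2 z)"
      by (rule fock_norm_triangle[OF \<alpha> dF(1) d2F])
    also have "fock_norm \<alpha> (\<lambda>z. (-1) * d2 z) = fock_norm \<alpha> d2" by (simp only: fock_norm_scale[OF \<alpha>]) simp
    also have "fock_norm \<alpha> d1 + fock_norm \<alpha> d2 \<le> 2 * \<epsilon>"
      using p[of l1] p[of l2] by (simp add: d1_def[abs_def] d2_def[abs_def])
    finally show "fock_norm \<alpha> (\<lambda>z. d1 z + (-1) * d2 z) \<le> 2 * \<epsilon>" .
  qed (use K fock_norm_nonneg[OF \<alpha>] in auto)
  finally have main: "S l1 + S l2 \<le> sqrt 2 * (2 * K * \<epsilon>)" by (simp add: mult_ac)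
  have "2 * K * \<epsilon> \<le> 2 * K * (1 / (2 * (K + 1)))" using \<epsilon> K by (intro mult_left_mono) auto
  also have "\<dots> < 1" using K by simp
  finally have "sqrt 2 * (2 * K * \<epsilon>) < sqrt 2 * 1" by (intro mult_strict_left_mono) auto
  with main have "S l1 + S l2 < sqrt 2" by linarith
  \<comment> \<open>This contradicts S l1 + S l2 \<ge> 2 (1 - \<epsilon>^2) \<ge> 3/2, since
    \<epsilon> \<le> 1/2.\<close>
  moreover have "sqrt 2 < 3 / 2" by (rule real_less_lsqrt) (auto simp: power2_eq_square)
  moreover have "\<epsilon>\<^sup>2 \<le> (1 / 2)\<^sup>2"
  proof (rule power_mono)
    have "1 / (2 * (K + 1)) \<le> 1 / 2" using K by (simp add: field_simps)
    with \<epsilon> show "\<epsilon> \<le> 1 / 2" by linarith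
  qed (use \<epsilon> in auto)
  ultimately show False using S(1)[of l1] S(1)[of l2] by (simp add: power2_eq_square)
qed

section \<open>Uniform bounds and the interpolation constant\<close>

lemma interpolating_iff_solvable:
  "interpolates \<alpha> \<Lambda> m f v \<longleftrightarrow>
    (\<forall>(l, k)\<in>divisor_index \<Lambda> m. fock_inner \<alpha> f (fock_atom l k) = (case (l, k) of (l, k) \<Rightarrow> v l k))"
  by (auto simp: interpolates_def divisor_index_def)

lemma countable_divisor_index: "divisor \<Lambda> m \<Longrightarrow> countable (divisor_index \<Lambda> m)"
  by (auto simp: divisor_def divisor_index_def)

text \<open>Homogeneity removes the normalization of the data, and
  \<open>fock_solvable_limit\<close> the finiteness of the index set.\<close>

lemma bounded_solvability_extends:
  assumes \<Lambda>: "divisor \<Lambda> m" and K: "K > 0"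
    and fin: "\<And>J v. finite J \<Longrightarrow> J \<subseteq> divisor_index \<Lambda> m \<Longrightarrow> (\<Sum>i\<in>J. (cmod (v i))\<^sup>2) \<le> 1 \<Longrightarrow> fock_solvable \<alpha> J v K"
    and v: "l2_data \<Lambda> m v"
  shows "\<exists>f\<in>fock_space \<alpha>. interpolates \<alpha> \<Lambda> m f v \<and> fock_norm \<alpha> f \<le> K * data_norm \<Lambda> m v"
proof -
  define N where "N = data_norm \<Lambda> m v"
  define w where "w = (\<lambda>(l, k). v l k)"
  let ?I = "divisor_index \<Lambda> m"
  have w2: "(\<lambda>i. (cmod (w i))\<^sup>2) = (\<lambda>(l, k). (cmod (v l k))\<^sup>2)" by (auto simp: w_def)
  have sm: "(\<lambda>i. (cmod (w i))\<^sup>2) summable_on ?I" using v by (simp add: l2_data_def w2)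
  have le: "(\<Sum>i\<in>J. (cmod (w i))\<^sup>2) \<le> N\<^sup>2" if "finite J" "J \<subseteq> ?I" for J
  proof -
    have "(\<Sum>i\<in>J. (cmod (w i))\<^sup>2) \<le> infsum (\<lambda>i. (cmod (w i))\<^sup>2) ?I"
      by (rule finite_sum_le_infsum[OF sm that]) auto
    also have "\<dots> = N\<^sup>2" unfolding N_def data_norm_def w2[symmetric]
      by (subst real_sqrt_pow2) (auto intro!: infsum_nonneg)
    finally show ?thesis .
  qed
  have N0: "N \<ge> 0" by (auto simp: N_def data_norm_def intro!: infsum_nonneg)
  have "fock_solvable \<alpha> ?I w (K * N)"
  proof (cases "N = 0")
    case True
    have "w i = 0" if "i \<in> ?I" for i using le[of "{i}"] that True by simp
    then show ?thesis
      using fock_solvable_mono[OF fock_solvable_zero[OF \<alpha>, of ?I] order_refl, of "K * N" w] True by simp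
  next
    case False
    then have N: "N > 0" using N0 by simp
    have "fock_solvable \<alpha> ?I (\<lambda>i. w i / of_real N) K"
    proof (rule fock_solvable_limit[OF \<alpha> countable_divisor_index[OF \<Lambda>]], rule fin)
      fix J assume J: "finite J" "J \<subseteq> ?I"
      have "(\<Sum>i\<in>J. (cmod (w i / of_real N))\<^sup>2) = (\<Sum>i\<in>J. (cmod (w i))\<^sup>2) / N\<^sup>2"
        by (simp add: norm_divide power_divide sum_divide_distrib)
      also have "\<dots> \<le> 1" using le[OF J] N by simp
      finally show "(\<Sum>i\<in>J. (cmod (w i / of_real N))\<^sup>2) \<le> 1" .
    qed
    from fock_solvable_scale[OF \<alpha> this, of "of_real N"] show ?thesis
      using N by (simp add: mult.commute)
  qed
  then show ?thesis
    unfolding fock_solvable_def interpolating_iff_solvable w_def N_def by (auto simp: split_beta)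
qed

text \<open>The infimum need not be known to be attained: some admissible K lies below M + 1, and
  |M| + 2 majorizes K + 1.\<close>

lemma interpolating_disjoint:
  assumes \<Lambda>: "divisor \<Lambda> m" and int: "interpolating \<alpha> \<Lambda> m"
    and c: "c \<ge> 0" "exp (- (\<alpha> * c\<^sup>2) / 2) \<le> 1 / (2 * (\<bar>interpolation_constant \<alpha> \<Lambda> m\<bar> + 2))"
  shows "disjoint_family_on (\<lambda>l. ball l (sqrt (real (m l) / \<alpha>) - c)) \<Lambda>"
proof -
  define S where "S = {K. K > 0 \<and> (\<forall>v. l2_data \<Lambda> m v \<longrightarrow>
       (\<exists>f\<in>fock_space \<alpha>. interpolates \<alpha> \<Lambda> m f v \<and> fock_norm \<alpha> f \<le> K * data_norm \<Lambda> m v))}"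
  have "\<exists>K. fock_solvable \<alpha> (divisor_index \<Lambda> m) v K"
    if "(\<lambda>i. (cmod (v i))\<^sup>2) summable_on divisor_index \<Lambda> m" for v
  proof -
    have "l2_data \<Lambda> m (\<lambda>l k. v (l, k))"
      unfolding l2_data_def using that by (simp add: case_prod_unfold)
    then obtain f where "f \<in> fock_space \<alpha>" "interpolates \<alpha> \<Lambda> m f (\<lambda>l k. v (l, k))"
      using int by (auto simp: interpolating_def)
    then show ?thesis unfolding fock_solvable_def interpolating_iff_solvable by auto
  qed
  from fock_solvable_uniform[OF \<alpha> countable_divisor_index[OF \<Lambda>] this]
  obtain K0 where K0: "K0 > 0" "\<And>J v. finite J \<Longrightarrow> J \<subseteq> divisor_index \<Lambda> m \<Longrightarrow>
      (\<Sum>i\<in>J. (cmod (v i))\<^sup>2) \<le> 1 \<Longrightarrow> fock_solvable \<alpha> J v K0" by blast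
  \<comment> \<open>The set of admissible constants is nonempty; only then does its infimum carry
    information.\<close>
  have "K0 \<in> S" using K0(1) bounded_solvability_extends[OF \<Lambda> K0] by (auto simp: S_def)
  moreover have M: "interpolation_constant \<alpha> \<Lambda> m = Inf S" by (simp add: interpolation_constant_def S_def)
  ultimately obtain K where K: "K \<in> S" "K < interpolation_constant \<alpha> \<Lambda> m + 1"
    using cInf_lessD[of S "interpolation_constant \<alpha> \<Lambda> m + 1"] by auto
  have "exp (- (\<alpha> * c\<^sup>2) / 2) \<le> 1 / (2 * (K + 1))"
  proof (rule order_trans[OF c(2)])
    show "1 / (2 * (\<bar>interpolation_constant \<alpha> \<Lambda> m\<bar> + 2)) \<le> 1 / (2 * (K + 1))"
      using K by (intro divide_left_mono) (auto simp: S_def)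
  qed
  with K(1) c(1) show ?thesis
    unfolding disjoint_family_on_def S_def
    by (intro ballI impI interpolating_balls_disjoint[of K]) auto
qed

end

subsection \<open>The basic weighted estimate\<close>

text \<open>A C^2 function with its derivatives: \<open>p\<close> and \<open>q\<close> in z and
  conjugate z, then \<open>a\<close> (twice z), \<open>r\<close> (mixed) and \<open>b\<close> (twice
  conjugate z). The same \<open>r\<close> under \<open>p\<close> and under \<open>q\<close> encodes
  the equality of the mixed derivatives.\<close>

definition wirtinger2 ::
  "(complex \<Rightarrow> complex) \<Rightarrow> (complex \<Rightarrow> complex) \<Rightarrow> (complex \<Rightarrow> complex) \<Rightarrow>
   (complex \<Rightarrow> complex) \<Rightarrow> (complex \<Rightarrow> complex) \<Rightarrow> (complex \<Rightarrow> complex) \<Rightarrow> bool" where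
  "wirtinger2 f p q a r b \<longleftrightarrow>
     (\<forall>z. wirtinger f (p z) (q z) z \<and> wirtinger p (a z) (r z) z \<and> wirtinger q (r z) (b z) z) \<and>
     continuous_on UNIV a \<and> continuous_on UNIV r \<and> continuous_on UNIV b"

lemma wirtinger2D:
  assumes "wirtinger2 f p q a r b"
  shows "wirtinger f (p z) (q z) z" "wirtinger p (a z) (r z) z" "wirtinger q (r z) (b z) z"
    "continuous_on UNIV f" "continuous_on UNIV p" "continuous_on UNIV q"
    "continuous_on UNIV a" "continuous_on UNIV r" "continuous_on UNIV b"
  using assms unfolding wirtinger2_def
  by (auto intro: continuous_on_wirtinger)

lemma wirtinger2_add:
  assumes "wirtinger2 f p q a r b" "wirtinger2 f' p' q' a' r' b'"
  shows "wirtinger2 (\<lambda>z. f z + f' z) (\<lambda>z. p z + p' z) (\<lambda>z. q z + q' z)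
     (\<lambda>z. a z + a' z) (\<lambda>z. r z + r' z) (\<lambda>z. b z + b' z)"
  unfolding wirtinger2_def
  by (intro conjI allI wirtinger_add continuous_on_add wirtinger2D[OF assms(1)] wirtinger2D[OF assms(2)])

lemma wirtinger2_mult:
  assumes f: "wirtinger2 f p q a r b" and g: "wirtinger2 f' p' q' a' r' b'"
  shows "wirtinger2 (\<lambda>z. f z * f' z) (\<lambda>z. p z * f' z + f z * p' z) (\<lambda>z. q z * f' z + f z * q' z)
     (\<lambda>z. (a z * f' z + p z * p' z) + (p z * p' z + f z * a' z))
     (\<lambda>z. (r z * f' z + p z * q' z) + (q z * p' z + f z * r' z))
     (\<lambda>z. (b z * f' z + q z * q' z) + (q z * q' z + f z * b' z))"
proof -
  have "wirtinger (\<lambda>z. q z * f' z + f z * q' z) ((r z * f' z + q z * p' z) + (p z * q' z + f z * r' z))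
      ((b z * f' z + q z * q' z) + (q z * q' z + f z * b' z)) z" for z
    by (intro wirtinger_add wirtinger_mult wirtinger2D[OF f] wirtinger2D[OF g])
  moreover have "(r z * f' z + q z * p' z) + (p z * q' z + f z * r' z) =
      (r z * f' z + p z * q' z) + (q z * p' z + f z * r' z)" for z by simp
  ultimately have w: "wirtinger (\<lambda>z. q z * f' z + f z * q' z) ((r z * f' z + p z * q' z) + (q z * p' z + f z * r' z))
      ((b z * f' z + q z * q' z) + (q z * q' z + f z * b' z)) z" for z by (simp only:)
  show ?thesis
    unfolding wirtinger2_def
    by (intro conjI allI w)
      (intro wirtinger_add wirtinger_mult continuous_on_add continuous_on_mult
        wirtinger2D[OF f] wirtinger2D[OF g])+
qed

lemma wirtinger2_holomorphic:
  assumes f: "f holomorphic_on UNIV"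
  shows "wirtinger2 f (deriv f) (\<lambda>_. 0) (deriv (deriv f)) (\<lambda>_. 0) (\<lambda>_. 0)"
proof -
  have f': "deriv f holomorphic_on UNIV" by (rule holomorphic_deriv[OF f open_UNIV])
  have "continuous_on UNIV (deriv (deriv f))"
    by (intro holomorphic_on_imp_continuous_on holomorphic_deriv[OF f' open_UNIV])
  then show ?thesis
    unfolding wirtinger2_def
    by (auto intro: wirtinger_holomorphic_deriv f f' wirtinger_const)
qed

lemma wirtinger2_sum:
  assumes "\<And>i. i \<in> I \<Longrightarrow> wirtinger2 (f i) (p i) (q i) (a i) (r i) (b i)"
  shows "wirtinger2 (\<lambda>z. \<Sum>i\<in>I. f i z) (\<lambda>z. \<Sum>i\<in>I. p i z) (\<lambda>z. \<Sum>i\<in>I. q i z)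
     (\<lambda>z. \<Sum>i\<in>I. a i z) (\<lambda>z. \<Sum>i\<in>I. r i z) (\<lambda>z. \<Sum>i\<in>I. b i z)"
  using assms
proof (induction I rule: infinite_finite_induct)
  case (insert i I)
  then show ?case using wirtinger2_add by simp
qed (auto simp: wirtinger2_def intro: wirtinger_const)

text \<open>In the variable s = |z - l|^2 a quarter of the Laplacian is g' + s g'', the derivative
  of s g'. Masses of radial weights are therefore read off from s g'.\<close>

lemma wirtinger2_radial:
  assumes g: "\<And>s. s \<ge> 0 \<Longrightarrow> (g has_real_derivative g' s) (at s)"
    and g': "\<And>s. s \<ge> 0 \<Longrightarrow> (g' has_real_derivative g'' s) (at s)"
    and cont: "continuous_on {0..} g''"
  shows "wirtinger2 (\<lambda>z. of_real (g ((cmod (z - l))\<^sup>2)))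
    (\<lambda>z. of_real (g' ((cmod (z - l))\<^sup>2)) * cnj (z - l))
    (\<lambda>z. of_real (g' ((cmod (z - l))\<^sup>2)) * (z - l))
    (\<lambda>z. of_real (g'' ((cmod (z - l))\<^sup>2)) * (cnj (z - l))\<^sup>2)
    (\<lambda>z. of_real (g' ((cmod (z - l))\<^sup>2) + (cmod (z - l))\<^sup>2 * g'' ((cmod (z - l))\<^sup>2)))
    (\<lambda>z. of_real (g'' ((cmod (z - l))\<^sup>2)) * (z - l)\<^sup>2)"
proof -
  have shift: "wirtinger (\<lambda>z. z - l) 1 0 z" for z
    by (rule wirtinger_holomorphic) (auto intro!: derivative_eq_intros)
  have cshift: "wirtinger (\<lambda>z. cnj (z - l)) 0 1 z" for z
    using wirtinger_cnj[OF shift] by simp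
  have c'': "continuous_on UNIV (\<lambda>z. g'' ((cmod (z - l))\<^sup>2))"
    by (rule continuous_on_compose2[OF cont]) (auto intro!: continuous_intros)
  have "continuous_on {0..} g'"
    using g' by (meson DERIV_isCont atLeast_iff continuous_at_imp_continuous_on)
  then have c': "continuous_on UNIV (\<lambda>z. g' ((cmod (z - l))\<^sup>2))"
    by (rule continuous_on_compose2) (auto intro!: continuous_intros)
  have 1: "wirtinger (\<lambda>z. of_real (g ((cmod (z - l))\<^sup>2))) (of_real (g' ((cmod (z - l))\<^sup>2)) * cnj (z - l))
      (of_real (g' ((cmod (z - l))\<^sup>2)) * (z - l)) z" for z
    by (intro wirtinger_radial g) simp
  have 2: "wirtinger (\<lambda>z. of_real (g' ((cmod (z - l))\<^sup>2))) (of_real (g'' ((cmod (z - l))\<^sup>2)) * cnj (z - l))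
      (of_real (g'' ((cmod (z - l))\<^sup>2)) * (z - l)) z" for z
    by (intro wirtinger_radial g') simp
  have 3: "wirtinger (\<lambda>z. of_real (g' ((cmod (z - l))\<^sup>2)) * cnj (z - l)) (of_real (g'' ((cmod (z - l))\<^sup>2)) * (cnj (z - l))\<^sup>2)
      (of_real (g' ((cmod (z - l))\<^sup>2) + (cmod (z - l))\<^sup>2 * g'' ((cmod (z - l))\<^sup>2))) z" for z
    using wirtinger_mult[OF 2[of z] cshift[of z]]
    unfolding of_real_add of_real_mult complex_norm_square[of "z - l"] by (simp add: power2_eq_square algebra_simps)
  have 4: "wirtinger (\<lambda>z. of_real (g' ((cmod (z - l))\<^sup>2)) * (z - l))
      (of_real (g' ((cmod (z - l))\<^sup>2) + (cmod (z - l))\<^sup>2 * g'' ((cmod (z - l))\<^sup>2)))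
      (of_real (g'' ((cmod (z - l))\<^sup>2)) * (z - l)\<^sup>2) z" for z
    using wirtinger_mult[OF 2[of z] shift[of z]]
    unfolding of_real_add of_real_mult complex_norm_square[of "z - l"] by (simp add: power2_eq_square algebra_simps)
  show ?thesis unfolding wirtinger2_def
    by (intro conjI allI 1 3 4 continuous_intros c' c'')
qed

text \<open>With \<open>D = \<partial>\<^bsub>z\<^esub> + \<Psi>\<^bsub>z\<^esub>\<close> one has the pointwise identity
  \<open>\<bar>B\<^bsub>z'\<^esub>\<bar>\<^sup>2 e\<^sup>\<Psi> = \<Psi>\<^bsub>zz'\<^esub> \<bar>B\<bar>\<^sup>2 e\<^sup>\<Psi> + \<bar>D B\<bar>\<^sup>2 e\<^sup>\<Psi> +\<close> divergence terms, where \<open>z'\<close> is the conjugate variable.\<close>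

lemma dbar_estimate_compact_support:
  assumes B: "wirtinger2 B p q a r b"
    and \<Psi>: "wirtinger2 (\<lambda>z. of_real (\<Psi> z)) (\<lambda>z. cnj (q' z)) q' a' (\<lambda>z. of_real (L z)) b'"
    and supp: "\<And>z. cmod z > R \<Longrightarrow> B z = 0"
  shows "(LINT z|lborel. L z * (cmod (B z))\<^sup>2 * exp (\<Psi> z)) \<le> (LINT z|lborel. (cmod (q z))\<^sup>2 * exp (\<Psi> z))"
proof -
  note B = wirtinger2D[OF B] and \<Psi> = wirtinger2D[OF \<Psi>]
  define E where "E z = exp (complex_of_real (\<Psi> z))" for z
  have E: "wirtinger E (E z * cnj (q' z)) (E z * q' z) z" for z
    unfolding E_def by (rule wirtinger_exp[OF \<Psi>(1)])
  have cE: "continuous_on UNIV E" unfolding E_def by (intro continuous_intros \<Psi>)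
  have E_real: "E z = of_real (exp (\<Psi> z))" for z by (simp add: E_def exp_of_real)
  have c\<Psi>: "continuous_on UNIV (\<lambda>z. exp (\<Psi> z))"
    using continuous_on_Re[OF cE] by (simp add: E_real)
  have cL: "continuous_on UNIV L" using continuous_on_Re[OF \<Psi>(8)] by simp
  \<comment> \<open>The two divergence terms: \<open>X\<close> is conj B times B_z', and
    \<open>Y\<close> is conj B times D B, both weighted. In X_z - Y_z' the mixed derivative
    \<open>r\<close> cancels, and |q|^2 - L |B|^2 - |D B|^2 remains, times exp \<Psi>.\<close>
  define X where "X z = cnj (B z) * q z * E z" for z
  define Y where "Y z = (p z + cnj (q' z) * B z) * cnj (B z) * E z" for z
  define Xp where "Xp z = (cnj (q z) * q z + cnj (B z) * r z) * E z + cnj (B z) * q z * (E z * cnj (q' z))" for z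
  define Xq where "Xq z = (cnj (p z) * q z + cnj (B z) * b z) * E z + cnj (B z) * q z * (E z * q' z)" for z
  define Yp where "Yp z = ((a z + (a' z * B z + cnj (q' z) * p z)) * cnj (B z) + (p z + cnj (q' z) * B z) * cnj (q z)) * E z +
      (p z + cnj (q' z) * B z) * cnj (B z) * (E z * cnj (q' z))" for z
  define Yq where "Yq z = ((r z + (of_real (L z) * B z + cnj (q' z) * q z)) * cnj (B z) + (p z + cnj (q' z) * B z) * cnj (p z)) * E z +
      (p z + cnj (q' z) * B z) * cnj (B z) * (E z * q' z)" for z
  have X: "wirtinger X (Xp z) (Xq z) z" for z
    unfolding X_def Xp_def Xq_def by (intro wirtinger_mult wirtinger_cnj B E)
  have Y: "wirtinger Y (Yp z) (Yq z) z" for z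
    unfolding Y_def Yp_def Yq_def by (intro wirtinger_mult wirtinger_add wirtinger_cnj B E \<Psi>)
  have cX: "continuous_on UNIV Xp" "continuous_on UNIV Xq"
    unfolding Xp_def Xq_def
    by (intro continuous_on_add continuous_on_mult continuous_on_cnj B(4-9) \<Psi>(6) cE)+
  have ca': "continuous_on UNIV a'" by (rule \<Psi>)
  have cq': "continuous_on UNIV q'" by (rule \<Psi>)
  have cY: "continuous_on UNIV Yp" "continuous_on UNIV Yq"
    unfolding Yp_def Yq_def
    by (intro continuous_on_add continuous_on_mult continuous_on_cnj continuous_on_of_real B(4-9) ca' cq' cE cL)+
  have supp': "X z = 0" "Y z = 0" if "cmod z > R" for z using supp[OF that] by (auto simp: X_def Y_def)
  note IX = integral_wirtinger_eq_0[OF X cX supp'(1)] and IY = integral_wirtinger_eq_0[OF Y cY supp'(2)]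
  have B0: "B z = 0" "p z = 0" "q z = 0" if "cmod z > R" for z
  proof -
    show "B z = 0" by (rule supp[OF that])
    have "wirtinger B 0 0 z"
      by (rule wirtinger_transform[OF wirtinger_const[of 0], of "{z. cmod z > R}"])
         (use that supp in \<open>auto intro!: open_Collect_less continuous_intros\<close>)
    with B(1)[of z] have "(\<lambda>h. p z * h + q z * cnj h) = (\<lambda>h. 0 * h + 0 * cnj h)"
      unfolding wirtinger_def by (rule has_derivative_unique)
    then have *: "p z * h + q z * cnj h = 0" for h by (metis add.left_neutral mult_zero_left)
    show "p z = 0" "q z = 0" using *[of 1] *[of \<i>] by (simp_all add: complex_eq_iff)
  qed
  define S where "S z = (cmod (p z + cnj (q' z) * B z))\<^sup>2 * exp (\<Psi> z)" for z
  have int1: "integrable lborel (\<lambda>z. (cmod (q z))\<^sup>2 * exp (\<Psi> z))"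
    using B0 by (intro integrable_compact_support[where R=R] continuous_intros B c\<Psi>) auto
  have int2: "integrable lborel (\<lambda>z. L z * (cmod (B z))\<^sup>2 * exp (\<Psi> z))"
    using B0 by (intro integrable_compact_support[where R=R] continuous_intros B c\<Psi> cL) auto
  have int3: "integrable lborel S"
    unfolding S_def
    using B0 by (intro integrable_compact_support[where R=R] continuous_intros B c\<Psi> cq') auto
  have "Xp z - Yq z = of_real ((cmod (q z))\<^sup>2 * exp (\<Psi> z) - L z * (cmod (B z))\<^sup>2 * exp (\<Psi> z) - S z)" for z
    unfolding of_real_diff of_real_mult S_def complex_norm_square E_real[symmetric] Xp_def Yq_def
    by (simp add: algebra_simps)
  then have "(LINT z|lborel. Xp z - Yq z) =
      of_real (LINT z|lborel. (cmod (q z))\<^sup>2 * exp (\<Psi> z) - L z * (cmod (B z))\<^sup>2 * exp (\<Psi> z) - S z)"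
    by (simp only: integral_complex_of_real)
  also have "(LINT z|lborel. Xp z - Yq z) = 0"
    using IX IY by (subst Bochner_Integration.integral_diff) auto
  finally have "complex_of_real (LINT z|lborel. (cmod (q z))\<^sup>2 * exp (\<Psi> z) - L z * (cmod (B z))\<^sup>2 * exp (\<Psi> z) - S z) = 0"
    by (rule sym)
  then have "(LINT z|lborel. (cmod (q z))\<^sup>2 * exp (\<Psi> z) - L z * (cmod (B z))\<^sup>2 * exp (\<Psi> z) - S z) = 0"
    by (simp only: of_real_eq_0_iff)
  moreover have "(LINT z|lborel. S z) \<ge> 0" by (intro Bochner_Integration.integral_nonneg) (simp add: S_def)
  ultimately show ?thesis
    using int1 int2 int3 by (simp add: Bochner_Integration.integral_diff)
qed

text \<open>Truncated powers are the building blocks of all cut-offs and weights below: they vanish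
  on a half-line, and each derivative costs one power.\<close>

lemma has_derivative_max_power:
  "((\<lambda>s::real. (max 0 s) ^ Suc (Suc n)) has_real_derivative real (Suc (Suc n)) * (max 0 s) ^ Suc n) (at s)"
proof (cases "s = 0")
  case True
  have "((\<lambda>h::real. (max 0 h) ^ Suc (Suc n) / h) \<longlongrightarrow> 0) (at 0)"
  proof (rule Lim_null_comparison)
    show "\<forall>\<^sub>F h in at 0. norm ((max 0 h) ^ Suc (Suc n) / h) \<le> \<bar>h\<bar> ^ Suc n"
    proof (intro always_eventually allI)
      fix h :: real
      show "norm ((max 0 h) ^ Suc (Suc n) / h) \<le> \<bar>h\<bar> ^ Suc n"
        by (cases "h > 0") (auto simp: max_def simp del: power_Suc, simp add: abs_mult)
    qed
    have "((\<lambda>h::real. \<bar>h\<bar> ^ Suc n) \<longlongrightarrow> \<bar>0\<bar> ^ Suc n) (at 0)" by (intro tendsto_intros)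
    then show "((\<lambda>h::real. \<bar>h\<bar> ^ Suc n) \<longlongrightarrow> 0) (at 0)" by simp
  qed
  then show ?thesis using True by (simp add: DERIV_def)
next
  case False
  consider "s > 0" | "s < 0" using False by linarith
  then show ?thesis
  proof cases
    case 1
    have "((\<lambda>s::real. s ^ Suc (Suc n)) has_real_derivative real (Suc (Suc n)) * s ^ Suc n) (at s)"
      by (rule derivative_eq_intros refl | simp)+
    then have "((\<lambda>s::real. (max 0 s) ^ Suc (Suc n)) has_real_derivative real (Suc (Suc n)) * s ^ Suc n) (at s)"
      by (rule has_field_derivative_transform_within_open[of _ _ _ "{0<..}"]) (use 1 in auto)
    then show ?thesis using 1 by simp
  next
    case 2
    have "((\<lambda>s::real. (max 0 s) ^ Suc (Suc n)) has_real_derivative 0) (at s)"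
      by (rule has_field_derivative_transform_within_open[OF DERIV_const[of 0], of "{..<0}"]) (use 2 in auto)
    then show ?thesis using 2 by simp
  qed
qed

lemma has_derivative_max_power_affine:
  "((\<lambda>s::real. (max 0 (a + c * s)) ^ Suc (Suc n)) has_real_derivative
     c * (real (Suc (Suc n)) * (max 0 (a + c * s)) ^ Suc n)) (at s)"
proof -
  have "((\<lambda>s. a + c * s) has_real_derivative c) (at s)" by (auto intro!: derivative_eq_intros)
  from DERIV_chain2[where f="\<lambda>s::real. (max 0 s) ^ Suc (Suc n)", OF has_derivative_max_power this]
  show ?thesis by (simp only: mult.commute)
qed

text \<open>From compact support to weighted L^2: multiply by cut-offs whose gradients tend to 0
  uniformly. The factor 2 is the price of (x + y)^2 \<le> 2 x^2 + 2 y^2, and the error term with its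
  constant 18 = 2 times 3^2 disappears in the limit, which Fatou's lemma makes legitimate.\<close>

lemma dbar_estimate:
  assumes B: "wirtinger2 B p q a r b"
    and \<Psi>: "wirtinger2 (\<lambda>z. of_real (\<Psi> z)) (\<lambda>z. cnj (q' z)) q' a' (\<lambda>z. of_real (L z)) b'"
    and L: "\<And>z. L z \<ge> 0"
    and intB: "integrable lborel (\<lambda>z. (cmod (B z))\<^sup>2 * exp (\<Psi> z))"
    and intq: "integrable lborel (\<lambda>z. (cmod (q z))\<^sup>2 * exp (\<Psi> z))"
  shows "integrable lborel (\<lambda>z. L z * (cmod (B z))\<^sup>2 * exp (\<Psi> z))"
    and "(LINT z|lborel. L z * (cmod (B z))\<^sup>2 * exp (\<Psi> z)) \<le> 2 * (LINT z|lborel. (cmod (q z))\<^sup>2 * exp (\<Psi> z))"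
proof -
  \<comment> \<open>The truncated cube of 1 - s/(n + 1)^2: a third power is what makes second
    derivatives continuous.\<close>
  define \<tau> where "\<tau> n s = (max 0 (1 + (- 1 / real (Suc n) ^ 2) * s)) ^ Suc (Suc (Suc 0))" for n and s :: real
  define \<tau>' where "\<tau>' n s = (- 1 / real (Suc n) ^ 2) * (real (Suc (Suc (Suc 0))) * (max 0 (1 + (- 1 / real (Suc n) ^ 2) * s)) ^ Suc (Suc 0))" for n and s :: real
  define \<tau>'' where "\<tau>'' n s = (- 1 / real (Suc n) ^ 2) * (real (Suc (Suc (Suc 0))) * ((- 1 / real (Suc n) ^ 2) * (real (Suc (Suc 0)) * (max 0 (1 + (- 1 / real (Suc n) ^ 2) * s)) ^ Suc 0)))" for n and s :: real
  have \<tau>1: "(\<tau> n has_real_derivative \<tau>' n s) (at s)" for n s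
    unfolding \<tau>_def \<tau>'_def by (rule has_derivative_max_power_affine)
  have \<tau>2: "(\<tau>' n has_real_derivative \<tau>'' n s) (at s)" for n s
    unfolding \<tau>'_def \<tau>''_def by (intro DERIV_cmult has_derivative_max_power_affine)
  have \<tau>3: "continuous_on {0..} (\<tau>'' n)" for n unfolding \<tau>''_def by (intro continuous_intros)
  define \<theta> where "\<theta> n z = complex_of_real (\<tau> n ((cmod (z - 0))\<^sup>2))" for n z
  have \<theta>: "wirtinger2 (\<theta> n) (\<lambda>z. of_real (\<tau>' n ((cmod (z - 0))\<^sup>2)) * cnj (z - 0))
    (\<lambda>z. of_real (\<tau>' n ((cmod (z - 0))\<^sup>2)) * (z - 0))
    (\<lambda>z. of_real (\<tau>'' n ((cmod (z - 0))\<^sup>2)) * (cnj (z - 0))\<^sup>2)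
    (\<lambda>z. of_real (\<tau>' n ((cmod (z - 0))\<^sup>2) + (cmod (z - 0))\<^sup>2 * \<tau>'' n ((cmod (z - 0))\<^sup>2)))
    (\<lambda>z. of_real (\<tau>'' n ((cmod (z - 0))\<^sup>2)) * (z - 0)\<^sup>2)" for n
    unfolding \<theta>_def by (intro wirtinger2_radial \<tau>1 \<tau>2 \<tau>3)
  have \<tau>01: "0 \<le> \<tau> n s" "\<tau> n s \<le> 1" if "s \<ge> 0" for n s
    using that by (auto simp: \<tau>_def intro!: power_le_one simp del: power_Suc)
  have \<theta>_le: "cmod (\<theta> n z) \<le> 1" for n z using \<tau>01[of "(cmod z)\<^sup>2" n] by (simp add: \<theta>_def)
  define q\<theta> where "q\<theta> n z = of_real (\<tau>' n ((cmod z)\<^sup>2)) * z" for n z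
  have \<theta>'_le: "cmod (q\<theta> n z) \<le> 3 / real (Suc n)" for n z
  proof -
    define N where "N = real (Suc n)"
    have N: "N > 0" by (simp add: N_def)
    define x where "x = max 0 (1 + (- 1 / N ^ 2) * (cmod z)\<^sup>2)"
    have x: "0 \<le> x" "x \<le> 1" by (auto simp: x_def)
    have eq: "cmod (q\<theta> n z) = 3 / N ^ 2 * x\<^sup>2 * cmod z"
    proof -
      have "\<tau>' n ((cmod z)\<^sup>2) = - (3 / N ^ 2 * x\<^sup>2)"
        unfolding \<tau>'_def N_def[symmetric] x_def[symmetric] by (simp add: power2_eq_square)
      then show ?thesis by (simp add: q\<theta>_def norm_mult del: of_real_mult of_real_divide of_real_power)
    qed
    show ?thesis
    proof (cases "cmod z \<le> N")
      case True
      have "x\<^sup>2 * cmod z \<le> 1 * N" using x True by (intro mult_mono power_le_one) auto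
      then have "3 / N ^ 2 * (x\<^sup>2 * cmod z) \<le> 3 / N ^ 2 * N" using N by (intro mult_left_mono) auto
      also have "\<dots> = 3 / N" using N by (simp add: power2_eq_square)
      finally show ?thesis by (simp add: eq N_def)
    next
      case False
      then have "N\<^sup>2 \<le> (cmod z)\<^sup>2" using N by (intro power_mono) auto
      then have "x = 0" using N by (simp add: x_def field_simps)
      then show ?thesis by (simp add: eq)
    qed
  qed
  have \<theta>0: "\<theta> n z = 0" if "cmod z > real (Suc n)" for n z
  proof -
    have "(real (Suc n))\<^sup>2 \<le> (cmod z)\<^sup>2" using that by (intro power_mono) auto
    then have "1 + (- 1 / real (Suc n) ^ 2) * (cmod z)\<^sup>2 \<le> 0" by (simp add: field_simps del: of_nat_Suc)
    then show ?thesis by (simp add: \<theta>_def \<tau>_def max_def del: of_nat_Suc)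
  qed
  note BD = wirtinger2D[OF B] and \<Psi>D = wirtinger2D[OF \<Psi>]
  have c\<Psi>: "continuous_on UNIV (\<lambda>z. exp (\<Psi> z))"
    using continuous_on_Re[OF \<Psi>D(4)] by (intro continuous_intros) simp
  have cL: "continuous_on UNIV L" using continuous_on_Re[OF \<Psi>D(8)] by simp
  define G where "G = (LINT z|lborel. (cmod (q z))\<^sup>2 * exp (\<Psi> z))"
  define J where "J = (LINT z|lborel. (cmod (B z))\<^sup>2 * exp (\<Psi> z))"
  have est: "(LINT z|lborel. L z * (cmod (B z * \<theta> n z))\<^sup>2 * exp (\<Psi> z)) \<le> 2 * G + 18 / (real (Suc n))\<^sup>2 * J" for n
  proof -
    have "(LINT z|lborel. L z * (cmod (B z * \<theta> n z))\<^sup>2 * exp (\<Psi> z)) \<le>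
        (LINT z|lborel. (cmod (q z * \<theta> n z + B z * q\<theta> n z))\<^sup>2 * exp (\<Psi> z))"
      using dbar_estimate_compact_support[OF wirtinger2_mult[OF B \<theta>[of n]] \<Psi>, of "real (Suc n)"] \<theta>0[of n]
      by (simp add: q\<theta>_def)
    also have "\<dots> \<le> (LINT z|lborel. 2 * ((cmod (q z))\<^sup>2 * exp (\<Psi> z)) + 18 / (real (Suc n))\<^sup>2 * ((cmod (B z))\<^sup>2 * exp (\<Psi> z)))"
    proof (rule integral_mono')
      show "integrable lborel (\<lambda>z. 2 * ((cmod (q z))\<^sup>2 * exp (\<Psi> z)) + 18 / (real (Suc n))\<^sup>2 * ((cmod (B z))\<^sup>2 * exp (\<Psi> z)))"
        using intq intB by (intro Bochner_Integration.integrable_add integrable_mult_right)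
      fix z
      have "(cmod (q z * \<theta> n z + B z * q\<theta> n z))\<^sup>2 \<le> (cmod (q z) * 1 + cmod (B z) * (3 / real (Suc n)))\<^sup>2"
      proof (rule power_mono)
        have "cmod (q z * \<theta> n z + B z * q\<theta> n z) \<le> cmod (q z) * cmod (\<theta> n z) + cmod (B z) * cmod (q\<theta> n z)"
          using norm_triangle_ineq[of "q z * \<theta> n z" "B z * q\<theta> n z"] by (simp add: norm_mult)
        also have "\<dots> \<le> cmod (q z) * 1 + cmod (B z) * (3 / real (Suc n))"
          using \<theta>_le \<theta>'_le by (intro add_mono mult_left_mono) auto
        finally show "cmod (q z * \<theta> n z + B z * q\<theta> n z) \<le> cmod (q z) * 1 + cmod (B z) * (3 / real (Suc n))" .
      qed simp
      also have "\<dots> \<le> 2 * (cmod (q z))\<^sup>2 + 2 * (cmod (B z) * (3 / real (Suc n)))\<^sup>2"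
        using sum_squares_bound[of "cmod (q z)" "cmod (B z) * (3 / real (Suc n))"] by (simp add: power2_sum del: of_nat_Suc)
      also have "\<dots> = 2 * (cmod (q z))\<^sup>2 + 18 / (real (Suc n))\<^sup>2 * (cmod (B z))\<^sup>2"
        by (simp add: power_mult_distrib power_divide del: of_nat_Suc)
      finally have "(cmod (q z * \<theta> n z + B z * q\<theta> n z))\<^sup>2 * exp (\<Psi> z) \<le>
          (2 * (cmod (q z))\<^sup>2 + 18 / (real (Suc n))\<^sup>2 * (cmod (B z))\<^sup>2) * exp (\<Psi> z)"
        by (rule mult_right_mono) simp
      then show "(cmod (q z * \<theta> n z + B z * q\<theta> n z))\<^sup>2 * exp (\<Psi> z) \<le>
          2 * ((cmod (q z))\<^sup>2 * exp (\<Psi> z)) + 18 / (real (Suc n))\<^sup>2 * ((cmod (B z))\<^sup>2 * exp (\<Psi> z))"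
        by (simp only: distrib_right mult.assoc)
    qed simp
    also have "\<dots> = 2 * G + 18 / (real (Suc n))\<^sup>2 * J"
      unfolding G_def J_def using intq intB
      by (subst Bochner_Integration.integral_add) (auto simp del: of_nat_Suc)
    finally show ?thesis .
  qed
  let ?F = "\<lambda>n z. L z * (cmod (B z * \<theta> n z))\<^sup>2 * exp (\<Psi> z)"
  let ?lim = "\<lambda>z. L z * (cmod (B z))\<^sup>2 * exp (\<Psi> z)"
  have c\<theta>: "continuous_on UNIV (\<theta> n)" for n using wirtinger2D(4)[OF \<theta>] .
  have \<theta>_lim: "(\<lambda>n. \<theta> n z) \<longlonglongrightarrow> 1" for z
  proof -
    have "(\<lambda>n. complex_of_real ((max 0 (1 + (- 1 * (inverse (real (Suc n))) ^ 2) * (cmod z)\<^sup>2)) ^ Suc (Suc (Suc 0)))) \<longlonglongrightarrow>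
        complex_of_real ((max 0 (1 + (- 1 * 0 ^ 2) * (cmod z)\<^sup>2)) ^ Suc (Suc (Suc 0)))"
      by (intro tendsto_intros LIMSEQ_inverse_real_of_nat)
    then show ?thesis by (simp add: \<theta>_def \<tau>_def divide_inverse power_inverse del: of_nat_Suc power_Suc)
  qed
  have intF: "integrable lborel (?F n)" for n
    using \<theta>0 by (intro integrable_compact_support[where R="real (Suc n)"] continuous_intros c\<theta> cL c\<Psi> BD) auto
  have meas0: "?lim \<in> borel_measurable lborel"
    by (auto intro!: borel_measurable_continuous_onI continuous_intros cL c\<Psi> BD)
  have "(\<integral>\<^sup>+z. ennreal (?lim z) \<partial>lborel) = (\<integral>\<^sup>+z. liminf (\<lambda>n. ennreal (?F n z)) \<partial>lborel)"
  proof (intro nn_integral_cong lim_imp_Liminf[symmetric])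
    fix z
    have "(\<lambda>n. ?F n z) \<longlonglongrightarrow> L z * (cmod (B z * 1))\<^sup>2 * exp (\<Psi> z)"
      by (intro tendsto_intros \<theta>_lim)
    then show "((\<lambda>n. ennreal (?F n z)) \<longlongrightarrow> ennreal (?lim z)) sequentially"
      by (intro tendsto_ennrealI) simp
  qed auto
  also have "\<dots> \<le> liminf (\<lambda>n. \<integral>\<^sup>+z. ennreal (?F n z) \<partial>lborel)"
    using intF by (intro nn_integral_liminf) auto
  also have "\<dots> \<le> liminf (\<lambda>n. ennreal (2 * G + 18 / (real (Suc n))\<^sup>2 * J))"
  proof (intro Liminf_mono always_eventually allI)
    fix n
    have "(\<integral>\<^sup>+z. ennreal (?F n z) \<partial>lborel) = ennreal (LINT z|lborel. ?F n z)"
      using L by (intro nn_integral_eq_integral intF) auto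
    also have "\<dots> \<le> ennreal (2 * G + 18 / (real (Suc n))\<^sup>2 * J)" using est by (intro ennreal_leI)
    finally show "(\<integral>\<^sup>+z. ennreal (?F n z) \<partial>lborel) \<le> ennreal (2 * G + 18 / (real (Suc n))\<^sup>2 * J)" .
  qed
  also have "\<dots> = ennreal (2 * G)"
  proof (rule lim_imp_Liminf)
    have "(\<lambda>n. 2 * G + 18 * (inverse (real (Suc n)))\<^sup>2 * J) \<longlonglongrightarrow> 2 * G + 18 * 0\<^sup>2 * J"
      by (intro tendsto_intros LIMSEQ_inverse_real_of_nat)
    then have "(\<lambda>n. 2 * G + 18 / (real (Suc n))\<^sup>2 * J) \<longlonglongrightarrow> 2 * G"
      by (simp add: divide_inverse power_inverse del: of_nat_Suc)
    then show "((\<lambda>n. ennreal (2 * G + 18 / (real (Suc n))\<^sup>2 * J)) \<longlongrightarrow> ennreal (2 * G)) sequentially"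
      by (rule tendsto_ennrealI)
  qed simp
  finally have nn: "(\<integral>\<^sup>+z. ennreal (?lim z) \<partial>lborel) \<le> ennreal (2 * G)" .
  show int0: "integrable lborel ?lim"
    by (rule integrableI_nonneg[OF meas0]) (use nn L in \<open>auto intro: le_less_trans\<close>)
  have "ennreal (LINT z|lborel. ?lim z) \<le> ennreal (2 * G)"
    using nn nn_integral_eq_integral[OF int0] L by simp
  moreover have "G \<ge> 0" unfolding G_def by (intro Bochner_Integration.integral_nonneg) simp
  ultimately show "(LINT z|lborel. ?lim z) \<le> 2 * (LINT z|lborel. (cmod (q z))\<^sup>2 * exp (\<Psi> z))"
    by (subst (asm) ennreal_le_iff) (auto simp: G_def)
qed

subsection \<open>Radial weights and cut-offs\<close>

text \<open>The weight \<open>e\<^sup>\<eta>\<close> sweeps the point mass \<open>m\<close> out to the disc \<open>s < b\<close> in such a way that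
  the total mass density \<open>\<alpha> + e + s e'\<close> stays nonnegative and is bounded below on an outer annulus;
  \<open>m + s e s\<close> is the mass that is left at radius \<open>\<surd>s\<close>.\<close>

lemma radial_weight:
  fixes \<alpha> a b :: real
  assumes \<alpha>: "\<alpha> > 0" and a: "0 < a" and ab: "a < b" and m: "m \<ge> 1" and ma: "real m = \<alpha> * a"
  obtains \<eta> e e' :: "real \<Rightarrow> real" where
    "\<And>s. s \<ge> 0 \<Longrightarrow> (\<eta> has_real_derivative e s) (at s)"
    "\<And>s. s \<ge> 0 \<Longrightarrow> (e has_real_derivative e' s) (at s)"
    "continuous_on {0..} e'"
    "\<And>s. s \<ge> 0 \<Longrightarrow> s ^ m * exp (\<eta> s) \<le> 1"
    "\<And>s. s \<ge> b \<Longrightarrow> s ^ m * exp (\<eta> s) = 1"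
    "\<And>s. s \<ge> a \<Longrightarrow> s ^ m * exp (\<eta> s) \<ge> exp (- (\<alpha> * (b - a)\<^sup>2 / (2 * a)))"
    "\<And>s. s \<ge> 0 \<Longrightarrow> 0 \<le> \<alpha> + (e s + s * e' s)"
    "\<And>s. s \<ge> b \<Longrightarrow> e s + s * e' s = 0"
    "\<And>s. (a + b) / 2 \<le> s \<Longrightarrow> s \<le> b \<Longrightarrow> \<alpha> / 2 \<le> \<alpha> + (e s + s * e' s)"
proof -
  \<comment> \<open>The density e + s e' is -\<sigma> for s < a and rises linearly to 0 at s = b.
    Total mass m forces \<sigma> (a + b)/2 = m, and m = \<alpha> a then gives \<sigma> \<le>
    \<alpha>. The slope 2 \<open>k\<close> is fixed by reaching 0 exactly at b.\<close>
  define \<sigma> where "\<sigma> = 2 * real m / (a + b)"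
  define k where "k = \<sigma> / (2 * (b - a))"
  have \<sigma>0: "\<sigma> > 0" using m a ab by (simp add: \<sigma>_def)
  have \<sigma>\<alpha>: "\<sigma> \<le> \<alpha>" using a ab \<alpha> by (simp add: \<sigma>_def ma field_simps)
  have k0: "k > 0" using \<sigma>0 ab by (simp add: k_def)
  have k\<sigma>: "2 * k * (b - a) = \<sigma>" using ab by (simp add: k_def field_simps)
  have m\<sigma>: "real m = \<sigma> * (a + b) / 2" using a ab by (simp add: \<sigma>_def)
  define t where "t s = k * ((max 0 (- a + 1 * s)) ^ Suc (Suc 0) - (max 0 (- b + 1 * s)) ^ Suc (Suc 0))" for s
  define t' where "t' s = k * (1 * (real (Suc (Suc 0)) * (max 0 (- a + 1 * s)) ^ Suc 0) - 1 * (real (Suc (Suc 0)) * (max 0 (- b + 1 * s)) ^ Suc 0))" for s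
  have t: "(t has_real_derivative t' s) (at s)" for s
    unfolding t_def t'_def by (intro DERIV_cmult DERIV_diff has_derivative_max_power_affine)
  have t'_eq: "t' s = 2 * k * (max 0 (s - a) - max 0 (s - b))" for s by (simp add: t'_def algebra_simps)
  have t_eq: "t s = k * ((max 0 (s - a))\<^sup>2 - (max 0 (s - b))\<^sup>2)" for s by (simp add: t_def power2_eq_square)
  have ct: "continuous_on S t" "continuous_on S t'" for S
    unfolding t_def t'_def by (intro continuous_intros)+
  have t0: "t s = 0" "t' s = 0" if "s \<le> a" for s using that ab by (auto simp: t_eq t'_eq max_def)
  \<comment> \<open>Solves (s e)' = t' - \<sigma>. The division at s = 0 does no harm because
    \<open>t\<close> vanishes up to a > 0.\<close>
  define e where "e s = t s / s - \<sigma>" for s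
  define e' where "e' s = t' s / s - t s / s\<^sup>2" for s
  have e: "(e has_real_derivative e' s) (at s)" for s
  proof (cases "s < a")
    case True
    have "(e has_real_derivative 0) (at s)"
      by (rule has_field_derivative_transform_within_open[OF DERIV_const[of "- \<sigma>"], of "{..<a}"])
         (use True in \<open>auto simp: e_def t0\<close>)
    then show ?thesis using True by (simp add: e'_def t0)
  next
    case False
    then have "s > 0" using a by linarith
    then show ?thesis unfolding e_def e'_def
      by (auto intro!: derivative_eq_intros t simp: field_simps power2_eq_square)
  qed
  have ce: "continuous_on UNIV e"
    using e by (meson DERIV_isCont continuous_at_imp_continuous_on)
  have ce': "continuous_on UNIV e'"
  proof -
    have "continuous_on ({..<a} \<union> {0<..}) e'"
    proof (rule continuous_on_open_Un)
      have "continuous_on {..<a} (\<lambda>_. 0 :: real)" by (rule continuous_on_const)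
      then show "continuous_on {..<a} e'"
        by (rule continuous_on_eq) (auto simp: e'_def t0)
      show "continuous_on {0<..} e'" unfolding e'_def by (intro continuous_intros ct) auto
    qed auto
    moreover have "{..<a} \<union> {0<..} = UNIV" using a by auto
    ultimately show ?thesis by simp
  qed
  have mass: "e s + s * e' s = t' s - \<sigma>" for s
    using a by (cases "s = 0") (auto simp: e_def e'_def t0 field_simps power2_eq_square)
  define g where "g s = real m + s * e s" for s
  have g_eq: "g s = real m - \<sigma> * s + t s" for s
    using a by (cases "s = 0") (auto simp: g_def e_def t0 field_simps)
  have g_b: "g s = 0" if "s \<ge> b" for s
  proof -
    have "t s = k * ((s - a)\<^sup>2 - (s - b)\<^sup>2)" using that ab by (simp add: t_eq)
    also have "\<dots> = (2 * k * (b - a)) * (s - (a + b) / 2)" by (simp add: power2_eq_square algebra_simps add_divide_distrib diff_divide_distrib)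
    finally show ?thesis unfolding k\<sigma> g_eq m\<sigma> by (simp add: algebra_simps)
  qed
  have g_ab: "g s = k * (b - s)\<^sup>2" if "a \<le> s" "s \<le> b" for s
  proof -
    have "t s = k * (s - a)\<^sup>2" using that by (simp add: t_eq)
    then show ?thesis unfolding g_eq m\<sigma> k\<sigma>[symmetric] by (simp add: power2_eq_square field_simps)
  qed
  have g_nonneg: "g s \<ge> 0" for s
  proof -
    consider "s \<le> a" | "a \<le> s" "s \<le> b" | "b \<le> s" by linarith
    then show ?thesis
    proof cases
      case 1
      have "\<sigma> * s \<le> \<sigma> * ((a + b) / 2)" using \<sigma>0 1 ab by (intro mult_left_mono) auto
      then show ?thesis using 1 by (simp add: g_eq t0 m\<sigma>)
    qed (use g_ab g_b k0 in auto)
  qed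
  obtain F where F: "\<And>s. s \<ge> 0 \<Longrightarrow> (F has_real_derivative e s) (at s)"
    using antiderivative_nonneg[OF ce] by blast
  \<comment> \<open>Normalized so that s^m exp (\<eta> s) equals 1 at s = b, hence from b
    on.\<close>
  define \<eta> where "\<eta> s = F s - F b - real m * ln b" for s
  have \<eta>: "(\<eta> has_real_derivative e s) (at s)" if "s \<ge> 0" for s
    unfolding \<eta>_def using F[OF that] by (auto intro!: derivative_eq_intros)
  \<comment> \<open>The logarithm of s^m exp (\<eta> s). Its derivative is the remaining mass over
    s, nonnegative and 0 beyond b: the upper bound is monotonicity, the lower one an estimate of the
    remaining mass on [a, b].\<close>
  define h where "h s = \<eta> s + real m * ln s" for s
  have h: "(h has_real_derivative g s / s) (at s)" if "s > 0" for s
    unfolding h_def g_def using \<eta>[of s] that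
    by (auto intro!: derivative_eq_intros simp: field_simps)
  have h_b: "h b = 0" by (simp add: h_def \<eta>_def)
  have exp_h: "s ^ m * exp (\<eta> s) = exp (h s)" if "s > 0" for s
    using that by (simp add: h_def exp_add ln_realpow[symmetric] mult.commute)
  have mvt: "\<exists>x>s. x < u \<and> h u - h s = (u - s) * (g x / x)" if "0 < s" "s < u" for s u
    by (rule MVT2[OF that(2)]) (use h that(1) in auto)
  have h0: "h s = 0" if ge: "s \<ge> b" for s
  proof (cases "s = b")
    case False
    then have "b < s" using that by simp
    then obtain x where "b < x" "h s - h b = (s - b) * (g x / x)"
      using mvt[of b s] a ab by auto
    then show ?thesis using g_b[of x] h_b by simp
  qed (simp add: h_b)
  have h_le: "h s \<le> 0" if pos: "s > 0" for s
  proof (cases "s \<ge> b")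
    case False
    then have "s < b" by simp
    then obtain x where x: "s < x" "h b - h s = (b - s) * (g x / x)"
      using mvt[of s b] pos by auto
    moreover have "(b - s) * (g x / x) \<ge> 0"
      using x(1) that g_nonneg \<open>s < b\<close> by (intro mult_nonneg_nonneg divide_nonneg_nonneg) auto
    ultimately show ?thesis using h_b by simp
  qed (use h0 in auto)
  have h_ge: "h s \<ge> - (\<alpha> * (b - a)\<^sup>2 / (2 * a))" if ge: "s \<ge> a" for s
  proof (cases "s \<ge> b")
    case True
    then show ?thesis using h0 \<alpha> a by simp
  next
    case False
    then have "s < b" by simp
    then obtain x where x: "s < x" "x < b" "h b - h s = (b - s) * (g x / x)"
      using mvt[of s b] ge a by auto
    have "g x \<le> k * (b - a)\<^sup>2"
      using x that k0 by (simp add: g_ab power_mono)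
    also have "k * (b - a)\<^sup>2 = \<sigma> * (b - a) / 2" unfolding k\<sigma>[symmetric] by (simp add: power2_eq_square)
    also have "\<dots> \<le> \<alpha> * (b - a) / 2" using \<sigma>\<alpha> ab by (intro divide_right_mono mult_right_mono) auto
    finally have "g x / x \<le> (\<alpha> * (b - a) / 2) / a"
      using x that a \<alpha> ab g_nonneg by (intro frac_le) auto
    then have "(b - s) * (g x / x) \<le> (b - a) * ((\<alpha> * (b - a) / 2) / a)"
      using x that a ab g_nonneg[of x] by (intro mult_mono) auto
    then show ?thesis using x(3) h_b by (simp add: power2_eq_square mult_ac)
  qed
  show thesis
  proof (rule that[of \<eta> e e'])
    show "continuous_on {0..} e'" using ce' by (rule continuous_on_subset) auto
    show "s ^ m * exp (\<eta> s) \<le> 1" if "s \<ge> 0" for s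
      using that m h_le[of s] exp_h[of s] by (cases "s = 0") (auto simp: power_0_left)
    show "s ^ m * exp (\<eta> s) = 1" if "s \<ge> b" for s
      using that a ab h0[of s] exp_h[of s] by simp
    show "s ^ m * exp (\<eta> s) \<ge> exp (- (\<alpha> * (b - a)\<^sup>2 / (2 * a)))" if "s \<ge> a" for s
      using that a h_ge[of s] exp_h[of s] by simp
    show "0 \<le> \<alpha> + (e s + s * e' s)" if "s \<ge> 0" for s
    proof -
      have "t' s \<ge> 0" using k0 ab by (auto simp: t'_eq max_def)
      then show ?thesis using \<sigma>\<alpha> by (simp add: mass)
    qed
    show "e s + s * e' s = 0" if "s \<ge> b" for s
      using that ab k\<sigma> by (simp add: mass t'_eq)
    show "\<alpha> / 2 \<le> \<alpha> + (e s + s * e' s)" if "(a + b) / 2 \<le> s" "s \<le> b" for s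
    proof -
      \<comment> \<open>At the midpoint \<open>t'\<close> has reached \<sigma>/2, so from there on
        at most \<alpha>/2 of the density is taken away.\<close>
      have "2 * k * ((b - a) / 2) \<le> 2 * k * (s - a)" using that k0 by (intro mult_left_mono) (auto simp: field_simps)
      moreover have "t' s = 2 * k * (s - a)" using that ab by (simp add: t'_eq)
      ultimately show ?thesis using k\<sigma> \<sigma>\<alpha> by (simp add: mass)
    qed
  qed (use e \<eta> in auto)
qed

text \<open>\<phi>' is minus a tent with base [c, d] and height 1/\<delta>, hence of area 1; so
  \<phi> is a second difference of truncated squares, and it decreases from 1 to 0.\<close>

lemma radial_cutoff:
  fixes c d :: real
  assumes cd: "c < d"
  obtains \<phi> \<phi>' :: "real \<Rightarrow> real" where
    "\<And>s. (\<phi> has_real_derivative \<phi>' s) (at s)" "continuous_on UNIV \<phi>'"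
    "\<And>s. s \<le> c \<Longrightarrow> \<phi> s = 1" "\<And>s. s \<ge> d \<Longrightarrow> \<phi> s = 0"
    "\<And>s. s \<le> c \<Longrightarrow> \<phi>' s = 0" "\<And>s. s \<ge> d \<Longrightarrow> \<phi>' s = 0"
    "\<And>s. \<bar>\<phi> s\<bar> \<le> 1" "\<And>s. \<bar>\<phi>' s\<bar> \<le> 2 / (d - c)"
proof -
  define \<delta> where "\<delta> = (d - c) / 2"
  have \<delta>: "\<delta> > 0" "d = c + 2 * \<delta>" using cd by (auto simp: \<delta>_def field_simps)
  define P where "P x s = (max 0 (x + (-1) * s)) ^ Suc (Suc 0)" for x s :: real
  define P' where "P' x s = (-1) * (real (Suc (Suc 0)) * (max 0 (x + (-1) * s)) ^ Suc 0)" for x s :: real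
  have P: "(P x has_real_derivative P' x s) (at s)" for x s
    unfolding P_def P'_def by (rule has_derivative_max_power_affine)
  define \<phi> where "\<phi> s = 1 / (2 * \<delta>\<^sup>2) * (P d s - 2 * P (c + \<delta>) s + P c s)" for s
  define \<phi>' where "\<phi>' s = 1 / (2 * \<delta>\<^sup>2) * (P' d s - 2 * P' (c + \<delta>) s + P' c s)" for s
  have P_eq: "P x s = (max 0 (x - s))\<^sup>2" and P'_eq: "P' x s = - 2 * max 0 (x - s)" for x s
    by (simp_all add: P_def P'_def power2_eq_square)
  have deriv: "(\<phi> has_real_derivative \<phi>' s) (at s)" for s
    unfolding \<phi>_def \<phi>'_def by (intro DERIV_cmult DERIV_add DERIV_diff P)
  have one: "\<phi> s = 1" if "s \<le> c" for s
  proof -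
    have "P d s - 2 * P (c + \<delta>) s + P c s = 2 * \<delta>\<^sup>2"
      using that \<delta> by (simp add: P_eq power2_eq_square algebra_simps)
    then show ?thesis using \<delta> by (simp add: \<phi>_def)
  qed
  have zero: "\<phi> s = 0" if "s \<ge> d" for s using that \<delta> by (simp add: \<phi>_def P_eq)
  have one': "\<phi>' s = 0" if "s \<le> c" for s
    using that \<delta> by (simp add: \<phi>'_def P'_eq)
  have zero': "\<phi>' s = 0" if "s \<ge> d" for s using that \<delta> by (simp add: \<phi>'_def P'_eq)
  have tent: "0 \<le> max 0 (d - s) - 2 * max 0 (c + \<delta> - s) + max 0 (c - s)"
    "max 0 (d - s) - 2 * max 0 (c + \<delta> - s) + max 0 (c - s) \<le> \<delta>" for s
    using \<delta> by (auto simp: max_def)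
  have \<phi>'_tent: "\<phi>' s = - (1 / \<delta>\<^sup>2 * (max 0 (d - s) - 2 * max 0 (c + \<delta> - s) + max 0 (c - s)))" for s
    using \<delta>(1) by (simp add: \<phi>'_def P'_eq field_simps)
  have neg: "\<phi>' s \<le> 0" for s
    unfolding \<phi>'_tent using tent(1)[of s] by simp
  have anti: "\<phi> y \<le> \<phi> x" if "x \<le> y" for x y
    using that by (rule DERIV_nonpos_imp_nonincreasing) (use deriv neg in blast)
  show thesis
  proof (rule that[of \<phi> \<phi>'])
    show "continuous_on UNIV \<phi>'" unfolding \<phi>'_def P'_def by (intro continuous_intros)
    show "\<bar>\<phi> s\<bar> \<le> 1" for s
      using anti[of s "max s d"] anti[of "min s c" s] one[of "min s c"] zero[of "max s d"] by simp
    show "\<bar>\<phi>' s\<bar> \<le> 2 / (d - c)" for s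
    proof -
      have "\<bar>\<phi>' s\<bar> = 1 / \<delta>\<^sup>2 * (max 0 (d - s) - 2 * max 0 (c + \<delta> - s) + max 0 (c - s))"
        unfolding \<phi>'_tent using tent(1)[of s] by simp
      also have "\<dots> \<le> 1 / \<delta>\<^sup>2 * \<delta>" using tent(2)[of s] by (intro mult_left_mono) auto
      also have "\<dots> = 2 / (d - c)" using \<delta> by (simp add: power2_eq_square)
      finally show ?thesis .
    qed
  qed (use deriv one zero one' zero' in auto)
qed

subsection \<open>The lower Riesz bound for finite divisors\<close>

text \<open>Needed against the growth exp x of |\<open>expo\<close>|^2 exp (\<alpha> |z|^2), where x
  = \<alpha> |z - l|^2. Writing x^j as 4^j (x/4)^j costs 4^k but bounds the sum by exp (x/4), and
  exp x exp (-2 x) exp (x/2) still decays.\<close>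

lemma gamma_tail_bound:
  assumes "x \<ge> 0"
  shows "exp x * (gamma_tail k x)\<^sup>2 \<le> 16 ^ k * exp (- x / 2)"
proof -
  have "(\<Sum>j\<le>k. x ^ j / fact j) \<le> 4 ^ k * (\<Sum>j\<le>k. (x / 4) ^ j / fact j)"
    unfolding sum_distrib_left
  proof (rule sum_mono)
    fix j assume "j \<in> {..k}"
    then have "(4::real) ^ j * (x / 4) ^ j \<le> 4 ^ k * (x / 4) ^ j"
      using assms by (intro mult_right_mono power_increasing) auto
    also have "(4::real) ^ j * (x / 4) ^ j = (4 * (x / 4)) ^ j" by (rule power_mult_distrib[symmetric])
    finally have "x ^ j \<le> 4 ^ k * (x / 4) ^ j" by simp
    from divide_right_mono[OF this, of "fact j"] show "x ^ j / fact j \<le> 4 ^ k * ((x / 4) ^ j / fact j)"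
      by simp
  qed
  also have "(\<Sum>j\<le>k. (x / 4) ^ j / fact j) \<le> exp (x / 4)"
  proof -
    have "(\<lambda>j. y ^ j / fact j) sums exp y" for y :: real
      using exp_converges[of y] by (simp add: divide_inverse mult.commute)
    from this[of "x / 4"] show ?thesis
      using assms sum_le_suminf[of "\<lambda>j. (x / 4) ^ j / fact j" "{..k}"] by (auto simp: sums_iff)
  qed
  finally have "(\<Sum>j\<le>k. x ^ j / fact j) \<le> 4 ^ k * exp (x / 4)" by simp
  then have "(gamma_tail k x)\<^sup>2 \<le> (exp (- x) * (4 ^ k * exp (x / 4)))\<^sup>2"
    using assms unfolding gamma_tail_def
    by (intro power_mono mult_left_mono mult_nonneg_nonneg sum_nonneg) auto
  then have "exp x * (gamma_tail k x)\<^sup>2 \<le> exp x * (exp (- x) * (4 ^ k * exp (x / 4)))\<^sup>2"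
    by (intro mult_left_mono) auto
  also have "\<dots> = (4 ^ k)\<^sup>2 * (exp x * (exp (- x) * exp (- x)) * (exp (x / 4) * exp (x / 4)))"
    by (simp add: power2_eq_square mult_ac)
  also have "exp x * (exp (- x) * exp (- x)) * (exp (x / 4) * exp (x / 4)) = exp (- x / 2)"
    by (simp add: exp_add[symmetric])
  also have "((4::real) ^ k)\<^sup>2 = 16 ^ k" by (simp add: power2_eq_square flip: power_mult_distrib)
  finally show ?thesis .
qed

text \<open>A finite divisor with a radial weight at each point, as supplied by
  \<open>radial_weight\<close> for a = m/\<alpha> and b = (sqrt (m/\<alpha>) + C)^2.
  \<open>H\<close> bounds the loss of all weights at once, and the final constant involves only
  \<alpha>, C and H.\<close>

locale weighted_divisor =
  fixes \<alpha> C H :: real and \<Lambda> :: "complex set" and m :: "complex \<Rightarrow> nat"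
    and \<eta> e e' :: "complex \<Rightarrow> real \<Rightarrow> real"
  assumes \<alpha>: "\<alpha> > 0" and C: "C > 0" and finite_\<Lambda>: "finite \<Lambda>" and m: "\<And>l. l \<in> \<Lambda> \<Longrightarrow> m l \<ge> 1"
    and disj: "disjoint_family_on (\<lambda>l. ball l (sqrt (real (m l) / \<alpha>) + C)) \<Lambda>"
    and \<eta>: "\<And>l s. l \<in> \<Lambda> \<Longrightarrow> s \<ge> 0 \<Longrightarrow> (\<eta> l has_real_derivative e l s) (at s)"
    and e: "\<And>l s. l \<in> \<Lambda> \<Longrightarrow> s \<ge> 0 \<Longrightarrow> (e l has_real_derivative e' l s) (at s)"
    and cont_e': "\<And>l. l \<in> \<Lambda> \<Longrightarrow> continuous_on {0..} (e' l)"
    and weight_le: "\<And>l s. l \<in> \<Lambda> \<Longrightarrow> s \<ge> 0 \<Longrightarrow> s ^ m l * exp (\<eta> l s) \<le> 1"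
    and weight_eq: "\<And>l s. l \<in> \<Lambda> \<Longrightarrow> s \<ge> (sqrt (real (m l) / \<alpha>) + C)\<^sup>2 \<Longrightarrow> s ^ m l * exp (\<eta> l s) = 1"
    and weight_ge: "\<And>l s. l \<in> \<Lambda> \<Longrightarrow> s \<ge> real (m l) / \<alpha> \<Longrightarrow> s ^ m l * exp (\<eta> l s) \<ge> exp (- H)"
    and density_nonneg: "\<And>l s. l \<in> \<Lambda> \<Longrightarrow> s \<ge> 0 \<Longrightarrow> 0 \<le> \<alpha> + (e l s + s * e' l s)"
    and density_zero: "\<And>l s. l \<in> \<Lambda> \<Longrightarrow> s \<ge> (sqrt (real (m l) / \<alpha>) + C)\<^sup>2 \<Longrightarrow> e l s + s * e' l s = 0"
    and density_ge: "\<And>l s. l \<in> \<Lambda> \<Longrightarrow> (real (m l) / \<alpha> + (sqrt (real (m l) / \<alpha>) + C)\<^sup>2) / 2 \<le> s \<Longrightarrow>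
        s \<le> (sqrt (real (m l) / \<alpha>) + C)\<^sup>2 \<Longrightarrow> \<alpha> / 2 \<le> \<alpha> + (e l s + s * e' l s)"
begin

definition radius2 :: "complex \<Rightarrow> real" where
  "radius2 l = (sqrt (real (m l) / \<alpha>) + C)\<^sup>2"

lemma radius2_pos: "radius2 l > 0"
proof -
  have "sqrt (real (m l) / \<alpha>) \<ge> 0" using \<alpha> by simp
  then show ?thesis unfolding radius2_def using C by (intro zero_less_power) linarith
qed

lemma less_radius2_iff: "(cmod (z - l))\<^sup>2 < radius2 l \<longleftrightarrow> z \<in> ball l (sqrt (real (m l) / \<alpha>) + C)"
proof -
  have "0 \<le> sqrt (real (m l) / \<alpha>) + C" using \<alpha> C by simp
  then show ?thesis
    by (auto simp: radius2_def dist_norm norm_minus_commute intro: power_strict_mono power2_less_imp_less)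
qed

lemma radius2_unique:
  assumes "l \<in> \<Lambda>" "l' \<in> \<Lambda>" "l \<noteq> l'" "(cmod (z - l))\<^sup>2 < radius2 l"
  shows "radius2 l' \<le> (cmod (z - l'))\<^sup>2"
proof (rule ccontr)
  assume "\<not> ?thesis"
  then have "z \<in> ball l' (sqrt (real (m l') / \<alpha>) + C)" by (simp only: not_le less_radius2_iff)
  moreover have "z \<in> ball l (sqrt (real (m l) / \<alpha>) + C)" using assms(4) by (simp add: less_radius2_iff)
  ultimately show False using disj assms(1-3) unfolding disjoint_family_on_def by blast
qed

section \<open>Explicit primitives, in conjugate z, of conjugated atoms\<close>

abbreviation gauss :: "complex \<Rightarrow> real" where
  "gauss z \<equiv> exp (- \<alpha> * (cmod z)\<^sup>2)"

abbreviation index :: "(complex \<times> nat) set" where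
  "index \<equiv> divisor_index \<Lambda> m"

lemma finite_index: "finite index"
  unfolding divisor_index_def using finite_\<Lambda> by auto

text \<open>The reciprocal of the exponential factor of T_l.\<close>

definition expo :: "complex \<Rightarrow> complex \<Rightarrow> complex" where
  "expo l z = exp (of_real (\<alpha> / 2 * (cmod l)\<^sup>2) - of_real \<alpha> * cnj l * z)"

text \<open>The constant for which the conjugate-z derivative of \<open>pole\<close> comes out
  without an extra factor.\<close>

definition normal :: "nat \<Rightarrow> real" where
  "normal k = sqrt (fact k / \<alpha> ^ k) / \<alpha>"

lemma normal_eq: "normal k * (\<alpha> * \<alpha> ^ k / fact k) = sqrt (\<alpha> ^ k / fact k)"
proof -
  have "sqrt (fact k / \<alpha> ^ k) * sqrt (\<alpha> ^ k / fact k) = 1"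
    unfolding real_sqrt_mult[symmetric] using \<alpha> by simp
  moreover have "\<alpha> ^ k / fact k = sqrt (\<alpha> ^ k / fact k) * sqrt (\<alpha> ^ k / fact k)"
    using \<alpha> by simp
  ultimately have "sqrt (fact k / \<alpha> ^ k) * (\<alpha> ^ k / fact k) = sqrt (\<alpha> ^ k / fact k)"
    by (metis mult.assoc mult_1)
  then show ?thesis using \<alpha> by (simp add: normal_def)
qed

lemma expo_translation: "fock_translation \<alpha> l f z * expo l z = f (z - l)"
proof -
  have "exp (of_real \<alpha> * cnj l * z - of_real (\<alpha> / 2 * (cmod l)\<^sup>2)) * expo l z = 1"
    unfolding expo_def exp_add[symmetric] by simp
  then show ?thesis unfolding fock_translation_def by (metis mult.commute mult.assoc mult_1)
qed

lemma cmod_expo_gauss: "(cmod (expo l z))\<^sup>2 * exp (\<alpha> * (cmod z)\<^sup>2) = exp (\<alpha> * (cmod (z - l))\<^sup>2)"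
proof -
  have "cmod (expo l z) = exp (\<alpha> / 2 * (cmod l)\<^sup>2 - \<alpha> * Re (cnj l * z))"
  proof -
    have "Re (of_real \<alpha> * (cnj l * z)) = \<alpha> * Re (cnj l * z)" by simp
    then show ?thesis by (simp only: expo_def norm_exp_eq_Re minus_complex.sel Re_complex_of_real mult.assoc)
  qed
  then have "(cmod (expo l z))\<^sup>2 * exp (\<alpha> * (cmod z)\<^sup>2) =
      exp (2 * (\<alpha> / 2 * (cmod l)\<^sup>2 - \<alpha> * Re (cnj l * z)) + \<alpha> * (cmod z)\<^sup>2)"
    by (simp only: exp_double[symmetric] exp_add)
  also have "2 * (\<alpha> / 2 * (cmod l)\<^sup>2 - \<alpha> * Re (cnj l * z)) + \<alpha> * (cmod z)\<^sup>2 = \<alpha> * (cmod (z - l))\<^sup>2"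
  proof -
    have "(cmod (z - l))\<^sup>2 = (cmod z)\<^sup>2 + (cmod l)\<^sup>2 - 2 * Re (cnj l * z)"
      unfolding cmod_power2 by (simp add: power2_eq_square algebra_simps)
    then show ?thesis by (simp only:) (simp add: algebra_simps)
  qed
  finally show ?thesis .
qed

text \<open>Completing the square turns the conjugate atom times the Gaussian into the entire
  function \<open>expo\<close>, a power of conj (z - l) and the Gaussian at \<open>l\<close>. The
  non-holomorphic part is then radial up to a power, so a primitive in conjugate z can be written
  down.\<close>

lemma cnj_atom_gauss:
  "cnj (fock_atom \<alpha> l k z) * of_real (gauss z) =
    of_real (sqrt (\<alpha> ^ k / fact k)) * expo l z * cnj (z - l) ^ k * of_real (exp (- \<alpha> * (cmod (z - l))\<^sup>2))"
proof -
  have "cnj (of_real \<alpha> * cnj l * z - of_real (\<alpha> / 2 * (cmod l)\<^sup>2)) + of_real (- \<alpha> * (cmod z)\<^sup>2) =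
      (of_real (\<alpha> / 2 * (cmod l)\<^sup>2) - of_real \<alpha> * cnj l * z) + complex_of_real (- \<alpha> * (cmod (z - l))\<^sup>2)"
    unfolding of_real_mult complex_norm_square by (simp add: algebra_simps)
  then have eq: "cnj (exp (of_real \<alpha> * cnj l * z - of_real (\<alpha> / 2 * (cmod l)\<^sup>2))) * of_real (gauss z) =
      expo l z * of_real (exp (- \<alpha> * (cmod (z - l))\<^sup>2))"
    unfolding expo_def by (simp only: exp_cnj exp_add[symmetric] exp_of_real[symmetric])
  have "cnj (fock_atom \<alpha> l k z) * of_real (gauss z) = of_real (sqrt (\<alpha> ^ k / fact k)) * cnj (z - l) ^ k *
      (cnj (exp (of_real \<alpha> * cnj l * z - of_real (\<alpha> / 2 * (cmod l)\<^sup>2))) * of_real (gauss z))"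
    unfolding fock_translation_def fock_basis_def complex_cnj_mult complex_cnj_power complex_cnj_complex_of_real
    by (simp only: mult_ac)
  then show ?thesis unfolding eq by (simp only: mult_ac)
qed

definition tail' :: "nat \<Rightarrow> real \<Rightarrow> real" where
  "tail' k s = - (\<alpha> * exp (- (\<alpha> * s)) * (\<alpha> * s) ^ k / fact k)"

text \<open>For k = 0 the exponent k - 1 truncates to 0, which is harmless because of the factor
  \<open>real k\<close>.\<close>

definition tail'' :: "nat \<Rightarrow> real \<Rightarrow> real" where
  "tail'' k s = - (\<alpha> * (- \<alpha> * exp (- (\<alpha> * s)) * (\<alpha> * s) ^ k + exp (- (\<alpha> * s)) * (real k * (\<alpha> * s) ^ (k - 1) * \<alpha>)) / fact k)"

lemma tail_derivs:
  "((\<lambda>s. gamma_tail k (\<alpha> * s)) has_real_derivative tail' k s) (at s)"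
  "(tail' k has_real_derivative tail'' k s) (at s)"
  "continuous_on S (tail'' k)" "continuous_on S (tail' k)"
proof -
  have "((\<lambda>s. gamma_tail k (\<alpha> * s)) has_real_derivative (- exp (- (\<alpha> * s)) * (\<alpha> * s) ^ k / fact k) * \<alpha>) (at s)"
    by (rule DERIV_chain2[OF has_derivative_gamma_tail]) (auto intro!: derivative_eq_intros)
  then show "((\<lambda>s. gamma_tail k (\<alpha> * s)) has_real_derivative tail' k s) (at s)"
    by (simp add: tail'_def mult_ac)
  show "(tail' k has_real_derivative tail'' k s) (at s)"
  proof -
    have pow: "((\<lambda>s. (\<alpha> * s) ^ k) has_real_derivative real k * (\<alpha> * s) ^ (k - 1) * \<alpha>) (at s)"
      by (auto intro!: derivative_eq_intros)
    have ex: "((\<lambda>s. exp (- (\<alpha> * s))) has_real_derivative - \<alpha> * exp (- (\<alpha> * s))) (at s)"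
      by (auto intro!: derivative_eq_intros)
    have "((\<lambda>s. - (\<alpha> * (exp (- (\<alpha> * s)) * (\<alpha> * s) ^ k) / fact k)) has_real_derivative
        - (\<alpha> * (- \<alpha> * exp (- (\<alpha> * s)) * (\<alpha> * s) ^ k + real k * (\<alpha> * s) ^ (k - 1) * \<alpha> * exp (- (\<alpha> * s))) / fact k)) (at s)"
      by (intro DERIV_minus DERIV_cdivide DERIV_cmult DERIV_mult pow ex)
    then show ?thesis unfolding tail'_def tail''_def by (simp only: mult_ac)
  qed
  show "continuous_on S (tail'' k)" "continuous_on S (tail' k)"
    unfolding tail''_def tail'_def by (intro continuous_intros; simp)+
qed

text \<open>Clears the poles: \<open>pole l k\<close> with k < m l has order k + 1 \<le> m l at
  l.\<close>

definition Qpoly :: "complex \<Rightarrow> complex" where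
  "Qpoly z = (\<Prod>l\<in>\<Lambda>. (z - l) ^ m l)"

text \<open>\<open>pole l k\<close> decays like a Gaussian and satisfies
  \<open>\<partial>\<^bsub>z'\<^esub> (pole l k) = cnj (fock_atom l k) gauss\<close> off \<open>l\<close> (\<open>z'\<close> being the conjugate variable),
  and \<open>reg l k\<close> is \<open>Qpoly\<close> times \<open>pole l k\<close> with the singularity removed.\<close>

definition pole :: "complex \<Rightarrow> nat \<Rightarrow> complex \<Rightarrow> complex" where
  "pole l k z = - of_real (normal k) * expo l z / (z - l) ^ Suc k * of_real (gamma_tail k (\<alpha> * (cmod (z - l))\<^sup>2))"

definition num :: "complex \<Rightarrow> nat \<Rightarrow> complex \<Rightarrow> complex" where
  "num l k z = - of_real (normal k) * expo l z * (z - l) ^ (m l - Suc k) * (\<Prod>l'\<in>\<Lambda> - {l}. (z - l') ^ m l')"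

definition reg :: "complex \<Rightarrow> nat \<Rightarrow> complex \<Rightarrow> complex" where
  "reg l k z = num l k z * of_real (gamma_tail k (\<alpha> * (cmod (z - l))\<^sup>2))"

lemma Qpoly_split: "l \<in> \<Lambda> \<Longrightarrow> Qpoly z = (z - l) ^ m l * (\<Prod>l'\<in>\<Lambda> - {l}. (z - l') ^ m l')"
  unfolding Qpoly_def using finite_\<Lambda> by (rule prod.remove)

lemma reg_eq_pole:
  assumes "l \<in> \<Lambda>" "k < m l" "z \<noteq> l"
  shows "reg l k z = Qpoly z * pole l k z"
proof -
  have "(z - l) ^ m l = (z - l) ^ (m l - Suc k) * (z - l) ^ Suc k"
    using assms(2) by (simp flip: power_add del: power_Suc)
  then show ?thesis
    using assms(3) by (simp add: reg_def num_def pole_def Qpoly_split[OF assms(1)] del: power_Suc)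
qed

text \<open>Differentiating the radial tail produces |z - l|^(2 k) (z - l), which is (z - l)^(k + 1)
  times conj (z - l)^k. This is why the pole has order exactly k + 1.\<close>

lemma dbar_pole_aux:
  "- of_real (normal k) * expo l z * (of_real (tail' k ((cmod (z - l))\<^sup>2)) * (z - l)) =
    (z - l) ^ Suc k * (cnj (fock_atom \<alpha> l k z) * of_real (gauss z))"
proof -
  have s: "complex_of_real (((cmod (z - l))\<^sup>2) ^ k) = (z - l) ^ k * cnj (z - l) ^ k"
    by (rule power_mult_power_cnj[symmetric])
  have "- of_real (normal k) * expo l z * (of_real (tail' k ((cmod (z - l))\<^sup>2)) * (z - l)) =
     of_real (normal k * (\<alpha> * \<alpha> ^ k / fact k)) * expo l z * of_real (((cmod (z - l))\<^sup>2) ^ k) *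
       of_real (exp (- \<alpha> * (cmod (z - l))\<^sup>2)) * (z - l)"
    by (simp add: tail'_def power_mult_distrib mult_ac)
  then show ?thesis
    unfolding cnj_atom_gauss normal_eq s by (simp only: power_Suc mult_ac)
qed

lemma num_holomorphic: "num l k holomorphic_on UNIV"
  unfolding num_def expo_def by (intro holomorphic_intros)

text \<open>After multiplication by \<open>Qpoly\<close> the singularity is gone, so the equation
  holds on the whole plane with C^2 regularity. Only the conjugate-z derivative has to be
  explicit.\<close>

lemma wirtinger2_reg:
  assumes "l \<in> \<Lambda>" "k < m l"
  shows "\<exists>p a r b. wirtinger2 (reg l k) p (\<lambda>z. Qpoly z * (cnj (fock_atom \<alpha> l k z) * of_real (gauss z))) a r b"
proof -
  have pw: "(z - l) ^ m l = (z - l) ^ (m l - Suc k) * (z - l) ^ Suc k" for z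
    using assms(2) by (simp flip: power_add del: power_Suc)
  have q: "0 * of_real (gamma_tail k (\<alpha> * (cmod (z - l))\<^sup>2)) + num l k z * (of_real (tail' k ((cmod (z - l))\<^sup>2)) * (z - l)) =
      Qpoly z * (cnj (fock_atom \<alpha> l k z) * of_real (gauss z))" for z
  proof -
    have "num l k z * (of_real (tail' k ((cmod (z - l))\<^sup>2)) * (z - l)) =
       (z - l) ^ (m l - Suc k) * (\<Prod>l'\<in>\<Lambda> - {l}. (z - l') ^ m l') *
       (- of_real (normal k) * expo l z * (of_real (tail' k ((cmod (z - l))\<^sup>2)) * (z - l)))"
      unfolding num_def by (simp only: mult_ac)
    then show ?thesis
      unfolding dbar_pole_aux Qpoly_split[OF assms(1)] pw by (simp only: mult_ac) simp
  qed
  have "\<exists>p a r b. wirtinger2 (reg l k) p (\<lambda>z. 0 * of_real (gamma_tail k (\<alpha> * (cmod (z - l))\<^sup>2)) +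
      num l k z * (of_real (tail' k ((cmod (z - l))\<^sup>2)) * (z - l))) a r b"
    unfolding reg_def[abs_def]
    by (rule exI)+ (rule wirtinger2_mult[OF wirtinger2_holomorphic[OF num_holomorphic]
          wirtinger2_radial[OF tail_derivs(1,2,3)]])
  then show ?thesis unfolding q .
qed

text \<open>\<open>potential\<close> plus log |\<open>Qpoly\<close>|^2 is the weight with
  logarithmic poles. The poles are carried by \<open>Qpoly\<close> and attached to the function, so
  that the remaining weight is C^2 and \<open>dbar_estimate\<close> applies.\<close>

definition potential :: "complex \<Rightarrow> real" where
  "potential z = \<alpha> * (cmod z)\<^sup>2 + (\<Sum>l\<in>\<Lambda>. \<eta> l ((cmod (z - l))\<^sup>2))"

definition density :: "complex \<Rightarrow> real" where
  "density z = \<alpha> + (\<Sum>l\<in>\<Lambda>. e l ((cmod (z - l))\<^sup>2) + (cmod (z - l))\<^sup>2 * e' l ((cmod (z - l))\<^sup>2))"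

lemma wirtinger2_potential:
  "\<exists>q a b. wirtinger2 (\<lambda>z. of_real (potential z)) (\<lambda>z. cnj (q z)) q a (\<lambda>z. of_real (density z)) b"
proof -
  have 1: "wirtinger2 (\<lambda>z. of_real (\<alpha> * (cmod (z - 0))\<^sup>2)) (\<lambda>z. of_real \<alpha> * cnj (z - 0)) (\<lambda>z. of_real \<alpha> * (z - 0))
     (\<lambda>z. of_real 0 * (cnj (z - 0))\<^sup>2) (\<lambda>z. of_real (\<alpha> + (cmod (z - 0))\<^sup>2 * 0)) (\<lambda>z. of_real 0 * (z - 0)\<^sup>2)"
    by (rule wirtinger2_radial) (auto intro!: derivative_eq_intros)
  have 2: "wirtinger2 (\<lambda>z. \<Sum>l\<in>\<Lambda>. of_real (\<eta> l ((cmod (z - l))\<^sup>2)))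
    (\<lambda>z. \<Sum>l\<in>\<Lambda>. of_real (e l ((cmod (z - l))\<^sup>2)) * cnj (z - l))
    (\<lambda>z. \<Sum>l\<in>\<Lambda>. of_real (e l ((cmod (z - l))\<^sup>2)) * (z - l))
    (\<lambda>z. \<Sum>l\<in>\<Lambda>. of_real (e' l ((cmod (z - l))\<^sup>2)) * (cnj (z - l))\<^sup>2)
    (\<lambda>z. \<Sum>l\<in>\<Lambda>. of_real (e l ((cmod (z - l))\<^sup>2) + (cmod (z - l))\<^sup>2 * e' l ((cmod (z - l))\<^sup>2)))
    (\<lambda>z. \<Sum>l\<in>\<Lambda>. of_real (e' l ((cmod (z - l))\<^sup>2)) * (z - l)\<^sup>2)"
    by (intro wirtinger2_sum wirtinger2_radial \<eta> e cont_e') auto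
  from wirtinger2_add[OF 1 2] show ?thesis
    unfolding potential_def density_def
    by (intro exI[of _ "\<lambda>z. of_real \<alpha> * (z - 0) + (\<Sum>l\<in>\<Lambda>. of_real (e l ((cmod (z - l))\<^sup>2)) * (z - l))"] exI)
       (simp)
qed

lemma Qpoly_potential:
  "(cmod (Qpoly z))\<^sup>2 * exp (potential z) =
    exp (\<alpha> * (cmod z)\<^sup>2) * (\<Prod>l\<in>\<Lambda>. ((cmod (z - l))\<^sup>2) ^ m l * exp (\<eta> l ((cmod (z - l))\<^sup>2)))"
proof -
  have "(cmod (Qpoly z))\<^sup>2 = (\<Prod>l\<in>\<Lambda>. ((cmod (z - l))\<^sup>2) ^ m l)"
    by (simp add: Qpoly_def prod_norm[symmetric] norm_power prod_power_distrib power_mult[symmetric] mult.commute)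
  then show ?thesis
    by (simp add: potential_def exp_add exp_sum[OF finite_\<Lambda>] prod.distrib mult_ac)
qed

lemma Qpoly_potential_le: "(cmod (Qpoly z))\<^sup>2 * exp (potential z) \<le> exp (\<alpha> * (cmod z)\<^sup>2)"
proof -
  have "(\<Prod>l\<in>\<Lambda>. ((cmod (z - l))\<^sup>2) ^ m l * exp (\<eta> l ((cmod (z - l))\<^sup>2))) \<le> 1"
    using weight_le by (intro prod_le_1) auto
  then show ?thesis unfolding Qpoly_potential by (simp add: mult_left_le)
qed

text \<open>The discs are disjoint, and a weight contributes no density outside its own disc, so
  only one term survives.\<close>

lemma density_local:
  assumes "l \<in> \<Lambda>" "(cmod (z - l))\<^sup>2 < radius2 l"
  shows "density z = \<alpha> + (e l ((cmod (z - l))\<^sup>2) + (cmod (z - l))\<^sup>2 * e' l ((cmod (z - l))\<^sup>2))"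
proof -
  have "e l' ((cmod (z - l'))\<^sup>2) + (cmod (z - l'))\<^sup>2 * e' l' ((cmod (z - l'))\<^sup>2) = 0" if "l' \<in> \<Lambda> - {l}" for l'
    using that radius2_unique[of l l' z] assms by (intro density_zero) (auto simp: radius2_def)
  then show ?thesis unfolding density_def by (simp add: sum.remove[OF finite_\<Lambda> assms(1)])
qed

lemma density_nonneg': "density z \<ge> 0"
proof (cases "\<exists>l\<in>\<Lambda>. (cmod (z - l))\<^sup>2 < radius2 l")
  case True
  then obtain l where "l \<in> \<Lambda>" "(cmod (z - l))\<^sup>2 < radius2 l" by blast
  then show ?thesis using density_local[of l z] density_nonneg[of l "(cmod (z - l))\<^sup>2"] by simp
next
  case False
  then have "e l ((cmod (z - l))\<^sup>2) + (cmod (z - l))\<^sup>2 * e' l ((cmod (z - l))\<^sup>2) = 0" if "l \<in> \<Lambda>" for l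
    using that by (intro density_zero) (auto simp: radius2_def not_less)
  then show ?thesis using \<alpha> by (simp add: density_def)
qed

text \<open>Needed only qualitatively, so \<open>M\<close> may depend on the point and on
  \<open>k\<close>. On the disc, compactness bounds s^(m - k - 1) exp \<eta>; beyond it this equals
  s^(-k - 1). The Gaussian decay comes from \<open>gamma_tail_bound\<close>.\<close>

lemma reg_bound:
  assumes l: "l \<in> \<Lambda>" and k: "k < m l"
  obtains M where "\<And>z. (cmod (reg l k z))\<^sup>2 * exp (potential z) \<le> M * exp (- (\<alpha> / 2) * (cmod (z - l))\<^sup>2)"
proof -
  define F where "F s = s ^ (m l - Suc k) * exp (\<eta> l s)" for s
  have c\<eta>: "continuous_on {0..radius2 l} (\<eta> l)"
    by (rule continuous_at_imp_continuous_on) (use DERIV_isCont[OF \<eta>[OF l]] in auto)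
  have "compact (F ` {0..radius2 l})"
    unfolding F_def by (intro compact_continuous_image continuous_intros c\<eta>) auto
  then obtain M0 where "\<forall>y\<in>F ` {0..radius2 l}. norm y \<le> M0"
    using compact_imp_bounded bounded_iff by blast
  then have M0: "\<bar>F s\<bar> \<le> M0" if "s \<in> {0..radius2 l}" for s using that by auto
  define M1 where "M1 = max M0 (1 / radius2 l ^ Suc k)"
  have F: "F s \<le> M1" if "s \<ge> 0" for s
  proof (cases "s \<le> radius2 l")
    case True
    then show ?thesis using M0[of s] that by (auto simp: M1_def)
  next
    case False
    then have s: "s > radius2 l" "s > 0" using radius2_pos[of l] by auto
    have "F s * s ^ Suc k = s ^ m l * exp (\<eta> l s)"
      unfolding F_def using k by (simp flip: power_add del: power_Suc add: mult_ac)
    also have "\<dots> = 1" using s by (intro weight_eq l) (simp add: radius2_def)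
    finally have "F s = 1 / s ^ Suc k" using s by (simp add: field_simps)
    also have "\<dots> \<le> 1 / radius2 l ^ Suc k"
      using s radius2_pos[of l] by (intro divide_left_mono power_mono) auto
    finally show ?thesis by (simp add: M1_def)
  qed
  have F0: "F s \<ge> 0" if "s \<ge> 0" for s using that by (simp add: F_def)
  have "(cmod (reg l k z))\<^sup>2 * exp (potential z) \<le> ((normal k)\<^sup>2 * M1 * 16 ^ k) * exp (- (\<alpha> / 2) * (cmod (z - l))\<^sup>2)" for z
  proof -
    define s where "s = (cmod (z - l))\<^sup>2"
    define P where "P = (\<Prod>l'\<in>\<Lambda> - {l}. ((cmod (z - l'))\<^sup>2) ^ m l' * exp (\<eta> l' ((cmod (z - l'))\<^sup>2)))"
    have P: "0 \<le> P" "P \<le> 1" unfolding P_def using weight_le by (auto intro!: prod_le_1 prod_nonneg)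
    have pot: "exp (potential z) = exp (\<alpha> * (cmod z)\<^sup>2) * exp (\<eta> l s) * (\<Prod>l'\<in>\<Lambda> - {l}. exp (\<eta> l' ((cmod (z - l'))\<^sup>2)))"
      using finite_\<Lambda> by (simp add: potential_def exp_add sum.remove[OF finite_\<Lambda> l] exp_sum s_def)
    have "(cmod (\<Prod>l'\<in>\<Lambda> - {l}. (z - l') ^ m l'))\<^sup>2 = (\<Prod>l'\<in>\<Lambda> - {l}. ((cmod (z - l'))\<^sup>2) ^ m l')"
      by (simp add: prod_norm[symmetric] norm_power prod_power_distrib power_mult[symmetric] mult.commute)
    moreover have "(cmod ((z - l) ^ (m l - Suc k)))\<^sup>2 = s ^ (m l - Suc k)"
      by (simp add: s_def norm_power power_mult[symmetric] mult.commute)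
    ultimately have "(cmod (reg l k z))\<^sup>2 = (normal k)\<^sup>2 * (cmod (expo l z))\<^sup>2 * s ^ (m l - Suc k) *
        (\<Prod>l'\<in>\<Lambda> - {l}. ((cmod (z - l'))\<^sup>2) ^ m l') * (gamma_tail k (\<alpha> * s))\<^sup>2"
      unfolding reg_def num_def norm_mult power_mult_distrib s_def by simp
    then have "(cmod (reg l k z))\<^sup>2 * exp (potential z) =
        (normal k)\<^sup>2 * F s * P * (((cmod (expo l z))\<^sup>2 * exp (\<alpha> * (cmod z)\<^sup>2)) * (gamma_tail k (\<alpha> * s))\<^sup>2)"
      unfolding pot P_def F_def prod.distrib by (simp only: mult_ac)
    also have "\<dots> = (normal k)\<^sup>2 * F s * P * (exp (\<alpha> * s) * (gamma_tail k (\<alpha> * s))\<^sup>2)"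
      by (simp only: cmod_expo_gauss s_def)
    also have "\<dots> \<le> (normal k)\<^sup>2 * M1 * 1 * (16 ^ k * exp (- (\<alpha> * s) / 2))"
    proof -
      have "M1 \<ge> 0" using F[of 0] F0[of 0] by linarith
      moreover have "s \<ge> 0" by (simp add: s_def)
      ultimately show ?thesis using \<alpha> F0[of s] P F[of s]
        by (intro mult_mono gamma_tail_bound mult_nonneg_nonneg) auto
    qed
    finally show ?thesis by (simp add: s_def mult_ac)
  qed
  then show thesis by (rule that)
qed

definition synth :: "(complex \<Rightarrow> nat \<Rightarrow> complex) \<Rightarrow> complex \<Rightarrow> complex" where
  "synth c z = (\<Sum>(l, k)\<in>index. c l k * fock_atom \<alpha> l k z)"

text \<open>\<open>Qpoly\<close> times W, with the singularities removed. The coefficients are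
  conjugated because W is a primitive of the conjugate of \<open>synth c\<close> times the
  Gaussian.\<close>

definition bsum :: "(complex \<Rightarrow> nat \<Rightarrow> complex) \<Rightarrow> complex \<Rightarrow> complex" where
  "bsum c z = (\<Sum>(l, k)\<in>index. cnj (c l k) * reg l k z)"

lemma synth_space: "synth c \<in> fock_space \<alpha>"
  unfolding synth_def case_prod_beta
  by (intro fock_space_sum fock_space_scale fock_atom_space[OF \<alpha>])

lemma wirtinger2_bsum:
  "\<exists>p a r b. wirtinger2 (bsum c) p (\<lambda>z. Qpoly z * (cnj (synth c z) * of_real (gauss z))) a r b"
proof -
  have "\<forall>i\<in>index. \<exists>p a r b. wirtinger2 (\<lambda>z. cnj (c (fst i) (snd i)) * reg (fst i) (snd i) z) p
      (\<lambda>z. cnj (c (fst i) (snd i)) * (Qpoly z * (cnj (fock_atom \<alpha> (fst i) (snd i) z) * of_real (gauss z)))) a r b"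
  proof
    fix i assume "i \<in> index"
    then have "fst i \<in> \<Lambda>" "snd i < m (fst i)" by (auto simp: divisor_index_def)
    from wirtinger2_reg[OF this] obtain p a r b where
      w: "wirtinger2 (reg (fst i) (snd i)) p (\<lambda>z. Qpoly z * (cnj (fock_atom \<alpha> (fst i) (snd i) z) * of_real (gauss z))) a r b"
      by blast
    have "wirtinger2 (\<lambda>_. cnj (c (fst i) (snd i))) (\<lambda>_. 0) (\<lambda>_. 0) (\<lambda>_. 0) (\<lambda>_. 0) (\<lambda>_. 0)"
      by (auto simp: wirtinger2_def intro: wirtinger_const)
    from wirtinger2_mult[OF this w]
    show "\<exists>p a r b. wirtinger2 (\<lambda>z. cnj (c (fst i) (snd i)) * reg (fst i) (snd i) z) p
      (\<lambda>z. cnj (c (fst i) (snd i)) * (Qpoly z * (cnj (fock_atom \<alpha> (fst i) (snd i) z) * of_real (gauss z)))) a r b"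
      by (simp only: mult_zero_left add_0) blast
  qed
  from bchoice[OF this] obtain p where "\<forall>i\<in>index. \<exists>a r b. wirtinger2 (\<lambda>z. cnj (c (fst i) (snd i)) * reg (fst i) (snd i) z) (p i)
      (\<lambda>z. cnj (c (fst i) (snd i)) * (Qpoly z * (cnj (fock_atom \<alpha> (fst i) (snd i) z) * of_real (gauss z)))) a r b" ..
  from bchoice[OF this] obtain a where "\<forall>i\<in>index. \<exists>r b. wirtinger2 (\<lambda>z. cnj (c (fst i) (snd i)) * reg (fst i) (snd i) z) (p i)
      (\<lambda>z. cnj (c (fst i) (snd i)) * (Qpoly z * (cnj (fock_atom \<alpha> (fst i) (snd i) z) * of_real (gauss z)))) (a i) r b" ..
  from bchoice[OF this] obtain r where "\<forall>i\<in>index. \<exists>b. wirtinger2 (\<lambda>z. cnj (c (fst i) (snd i)) * reg (fst i) (snd i) z) (p i)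
      (\<lambda>z. cnj (c (fst i) (snd i)) * (Qpoly z * (cnj (fock_atom \<alpha> (fst i) (snd i) z) * of_real (gauss z)))) (a i) (r i) b" ..
  from bchoice[OF this] obtain b where "\<forall>i\<in>index. wirtinger2 (\<lambda>z. cnj (c (fst i) (snd i)) * reg (fst i) (snd i) z) (p i)
      (\<lambda>z. cnj (c (fst i) (snd i)) * (Qpoly z * (cnj (fock_atom \<alpha> (fst i) (snd i) z) * of_real (gauss z)))) (a i) (r i) (b i)" ..
  note w = bspec[OF this]
  have "(\<Sum>i\<in>index. cnj (c (fst i) (snd i)) * (Qpoly z * (cnj (fock_atom \<alpha> (fst i) (snd i) z) * of_real (gauss z)))) =
      Qpoly z * (cnj (synth c z) * of_real (gauss z))" for z
    unfolding synth_def case_prod_beta cnj_sum sum_distrib_left sum_distrib_right complex_cnj_mult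
    by (intro sum.cong refl) (simp only: mult_ac)
  moreover have "wirtinger2 (\<lambda>z. \<Sum>i\<in>index. cnj (c (fst i) (snd i)) * reg (fst i) (snd i) z) (\<lambda>z. \<Sum>i\<in>index. p i z)
      (\<lambda>z. \<Sum>i\<in>index. cnj (c (fst i) (snd i)) * (Qpoly z * (cnj (fock_atom \<alpha> (fst i) (snd i) z) * of_real (gauss z))))
      (\<lambda>z. \<Sum>i\<in>index. a i z) (\<lambda>z. \<Sum>i\<in>index. r i z) (\<lambda>z. \<Sum>i\<in>index. b i z)"
    by (rule wirtinger2_sum) (rule w)
  ultimately show ?thesis
    unfolding bsum_def[abs_def] case_prod_beta by (simp only:) blast
qed

text \<open>Finitely many terms, each with a Gaussian bound; this supplies the a priori
  integrability that \<open>dbar_estimate\<close> demands.\<close>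

lemma integrable_bsum: "integrable lborel (\<lambda>z. (cmod (bsum c z))\<^sup>2 * exp (potential z))"
proof -
  obtain p a r b where w: "wirtinger2 (bsum c) p (\<lambda>z. Qpoly z * (cnj (synth c z) * of_real (gauss z))) a r b"
    using wirtinger2_bsum by blast
  have cb: "continuous_on UNIV (bsum c)" using wirtinger2D(4)[OF w] .
  obtain q' a' b' where \<Psi>: "wirtinger2 (\<lambda>z. of_real (potential z)) (\<lambda>z. cnj (q' z)) q' a' (\<lambda>z. of_real (density z)) b'"
    using wirtinger2_potential by blast
  have cp: "continuous_on UNIV potential" using continuous_on_Re[OF wirtinger2D(4)[OF \<Psi>]] by simp
  have "\<forall>i\<in>index. \<exists>M. \<forall>z. (cmod (reg (fst i) (snd i) z))\<^sup>2 * exp (potential z) \<le> M * exp (- (\<alpha> / 2) * (cmod (z - fst i))\<^sup>2)"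
  proof
    fix i assume "i \<in> index"
    then have "fst i \<in> \<Lambda>" "snd i < m (fst i)" by (auto simp: divisor_index_def)
    from reg_bound[OF this] show "\<exists>M. \<forall>z. (cmod (reg (fst i) (snd i) z))\<^sup>2 * exp (potential z) \<le> M * exp (- (\<alpha> / 2) * (cmod (z - fst i))\<^sup>2)"
      by metis
  qed
  from bchoice[OF this] obtain M where "\<forall>i\<in>index. \<forall>z. (cmod (reg (fst i) (snd i) z))\<^sup>2 * exp (potential z) \<le> M i * exp (- (\<alpha> / 2) * (cmod (z - fst i))\<^sup>2)" ..
  note M = spec[OF bspec[OF this]]
  define N where "N = real (card index)"
  define D where "D z = (\<Sum>i\<in>index. N * (cmod (c (fst i) (snd i)))\<^sup>2 * M i * exp (- (\<alpha> / 2) * (cmod (z - fst i))\<^sup>2))" for z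
  show ?thesis
  proof (rule Bochner_Integration.integrable_bound)
    have "integrable lborel (\<lambda>z. exp (- (\<alpha> / 2) * (cmod (z - l))\<^sup>2))" for l :: complex
      using gaussian_moments(1)[of "\<alpha> / 2" 0] \<alpha>
        integrable_translate[of "\<lambda>z::complex. exp (- (\<alpha> / 2) * (cmod z)\<^sup>2)" "- l"] by simp
    then show "integrable lborel D"
      unfolding D_def by (intro Bochner_Integration.integrable_sum integrable_mult_right)
    show "AE z in lborel. norm ((cmod (bsum c z))\<^sup>2 * exp (potential z)) \<le> norm (D z)"
    proof (rule AE_I2)
      fix z
      have "cmod (bsum c z) \<le> (\<Sum>i\<in>index. cmod (c (fst i) (snd i)) * cmod (reg (fst i) (snd i) z))"
        unfolding bsum_def case_prod_beta by (rule order_trans[OF norm_sum]) (simp add: norm_mult)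
      then have "(cmod (bsum c z))\<^sup>2 \<le> (\<Sum>i\<in>index. cmod (c (fst i) (snd i)) * cmod (reg (fst i) (snd i) z))\<^sup>2"
        by (intro power_mono) auto
      also have "\<dots> \<le> (\<Sum>i\<in>index. (cmod (c (fst i) (snd i)) * cmod (reg (fst i) (snd i) z))\<^sup>2) * N"
        unfolding N_def by (rule sum_squared_le_sum_of_squares)
      finally have "(cmod (bsum c z))\<^sup>2 * exp (potential z) \<le>
          (\<Sum>i\<in>index. (cmod (c (fst i) (snd i)) * cmod (reg (fst i) (snd i) z))\<^sup>2) * N * exp (potential z)"
        by (intro mult_right_mono) auto
      also have "\<dots> = (\<Sum>i\<in>index. N * (cmod (c (fst i) (snd i)))\<^sup>2 * ((cmod (reg (fst i) (snd i) z))\<^sup>2 * exp (potential z)))"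
        by (simp add: sum_distrib_left sum_distrib_right power_mult_distrib mult_ac)
      also have "\<dots> \<le> D z"
        unfolding D_def mult.assoc[of _ "M _"] by (intro sum_mono mult_left_mono M) (auto simp: N_def)
      finally show "norm ((cmod (bsum c z))\<^sup>2 * exp (potential z)) \<le> norm (D z)" by simp
    qed
  qed (auto intro!: borel_measurable_continuous_onI continuous_intros cb cp)
qed

text \<open>By |\<open>Qpoly\<close>|^2 exp \<open>potential\<close> \<le> exp (\<alpha> |z|^2) one
  of the two Gaussians on the right of the basic estimate cancels, and the integral of the Fock norm
  is left.\<close>

lemma bsum_estimate:
  "integrable lborel (\<lambda>z. density z * (cmod (bsum c z))\<^sup>2 * exp (potential z))"
  "(LINT z|lborel. density z * (cmod (bsum c z))\<^sup>2 * exp (potential z)) \<le>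
    2 * (LINT z|lborel. (cmod (synth c z))\<^sup>2 * gauss z)"
proof -
  obtain p a r b where B: "wirtinger2 (bsum c) p (\<lambda>z. Qpoly z * (cnj (synth c z) * of_real (gauss z))) a r b"
    using wirtinger2_bsum by blast
  obtain q' a' b' where \<Psi>: "wirtinger2 (\<lambda>z. of_real (potential z)) (\<lambda>z. cnj (q' z)) q' a' (\<lambda>z. of_real (density z)) b'"
    using wirtinger2_potential by blast
  have cp: "continuous_on UNIV potential" using continuous_on_Re[OF wirtinger2D(4)[OF \<Psi>]] by simp
  define q where "q z = Qpoly z * (cnj (synth c z) * of_real (gauss z))" for z
  have cq: "continuous_on UNIV q" using wirtinger2D(6)[OF B] unfolding q_def .
  have q_le: "(cmod (q z))\<^sup>2 * exp (potential z) \<le> (cmod (synth c z))\<^sup>2 * gauss z" for z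
  proof -
    have "(cmod (q z))\<^sup>2 * exp (potential z) = ((cmod (Qpoly z))\<^sup>2 * exp (potential z)) * ((cmod (synth c z))\<^sup>2 * (gauss z * gauss z))"
      by (simp add: q_def norm_mult power_mult_distrib power2_eq_square mult_ac del: of_real_exp)
    also have "\<dots> \<le> exp (\<alpha> * (cmod z)\<^sup>2) * ((cmod (synth c z))\<^sup>2 * (gauss z * gauss z))"
      by (intro mult_right_mono Qpoly_potential_le) auto
    also have "\<dots> = (exp (\<alpha> * (cmod z)\<^sup>2) * gauss z) * ((cmod (synth c z))\<^sup>2 * gauss z)"
      by (simp only: mult_ac)
    also have "exp (\<alpha> * (cmod z)\<^sup>2) * gauss z = 1" by (simp flip: exp_add)
    finally show ?thesis by simp
  qed
  note ints = fock_spaceD(3)[OF synth_space[of c]]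
  have intq: "integrable lborel (\<lambda>z. (cmod (q z))\<^sup>2 * exp (potential z))"
    by (rule Bochner_Integration.integrable_bound[OF ints])
       (use q_le in \<open>auto intro!: borel_measurable_continuous_onI continuous_intros cq cp\<close>)
  note est = dbar_estimate[OF B \<Psi> density_nonneg' integrable_bsum intq[unfolded q_def]]
  show "integrable lborel (\<lambda>z. density z * (cmod (bsum c z))\<^sup>2 * exp (potential z))" by (rule est)
  have "(LINT z|lborel. (cmod (q z))\<^sup>2 * exp (potential z)) \<le> (LINT z|lborel. (cmod (synth c z))\<^sup>2 * gauss z)"
    by (rule integral_mono[OF intq ints q_le])
  with est(2) show "(LINT z|lborel. density z * (cmod (bsum c z))\<^sup>2 * exp (potential z)) \<le>
    2 * (LINT z|lborel. (cmod (synth c z))\<^sup>2 * gauss z)" unfolding q_def by linarith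
qed

end

section \<open>Recovering the coefficients from W\<close>

context weighted_divisor
begin

text \<open>Off \<open>l\<close>, \<open>F\<close> is the conjugate-z derivative of \<phi> G
  \<open>pole\<close>, so its integral is a kind of residue. It is computed by moving
  \<open>l\<close> to 0: F becomes p(u) conj(u)^k K(|u|^2), the k-th Taylor coefficient of
  \<open>p\<close> is a multiple of \<open>c k\<close>, and the radial moment of \<open>K\<close> is
  the integral of a derivative.\<close>

lemma local_identity_same:
  fixes \<phi> \<phi>' :: "real \<Rightarrow> real" and c :: "nat \<Rightarrow> complex" and l :: complex
  assumes \<phi>: "\<And>s. (\<phi> has_real_derivative \<phi>' s) (at s)" and c\<phi>': "continuous_on UNIV \<phi>'"
    and b: "0 < b" "\<And>s. s \<le> b \<Longrightarrow> \<phi> s = 1" "\<And>s. s \<le> b \<Longrightarrow> \<phi>' s = 0"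
    and d: "\<And>s. s \<ge> d \<Longrightarrow> \<phi> s = 0" "\<And>s. s \<ge> d \<Longrightarrow> \<phi>' s = 0"
    and k: "k < n"
  defines "G \<equiv> \<lambda>z. \<Sum>j<n. c j * fock_atom \<alpha> l j z"
  defines "F \<equiv> \<lambda>z. of_real (\<phi> ((cmod (z - l))\<^sup>2)) * G z * (cnj (fock_atom \<alpha> l k z) * of_real (gauss z)) +
      of_real (\<phi>' ((cmod (z - l))\<^sup>2)) * (z - l) * G z * pole l k z"
  shows "integrable lborel F" "(LINT z|lborel. F z) = of_real (pi / \<alpha>) * c k"
proof -
  define r where "r = sqrt (\<alpha> ^ k / fact k)"
  define p where "p u = (\<Sum>j<n. c j * fock_basis \<alpha> j u)" for u
  \<comment> \<open>The division by s^k is harmless because \<phi>' vanishes for s \<le> b.\<close>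
  define K where "K s = r * \<phi> s * exp (- \<alpha> * s) - normal k * \<phi>' s * gamma_tail k (\<alpha> * s) / s ^ k" for s
  have c\<phi>: "continuous_on S \<phi>" for S
    using \<phi> by (meson DERIV_isCont continuous_at_imp_continuous_on)
  have cg: "continuous_on S (\<lambda>s. gamma_tail k (\<alpha> * s))" for S
    using tail_derivs(1) by (meson DERIV_isCont continuous_at_imp_continuous_on)
  have cK: "continuous_on UNIV K"
  proof -
    have "continuous_on ({..<b} \<union> {0<..}) K"
    proof (rule continuous_on_open_Un)
      have "continuous_on {..<b} (\<lambda>s. r * \<phi> s * exp (- \<alpha> * s))" by (intro continuous_intros c\<phi>)
      then show "continuous_on {..<b} K"
        by (rule continuous_on_eq) (auto simp: K_def b)
      show "continuous_on {0<..} K"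
        unfolding K_def by (intro continuous_intros c\<phi> cg continuous_on_subset[OF c\<phi>']) auto
    qed auto
    moreover have "{..<b} \<union> {0<..} = UNIV" using b by auto
    ultimately show ?thesis by simp
  qed
  have K0: "K s = 0" if "s > d" for s using d[of s] that by (simp add: K_def)
  have Gp: "G z * expo l z = p (z - l)" for z
    unfolding G_def p_def sum_distrib_right mult.assoc expo_translation ..
  have F_eq: "F z = p (z - l) * cnj (z - l) ^ k * of_real (K ((cmod (z - l))\<^sup>2))" for z
  proof -
    define s where "s = (cmod (z - l))\<^sup>2"
    have 1: "of_real (\<phi> s) * G z * (cnj (fock_atom \<alpha> l k z) * of_real (gauss z)) =
        p (z - l) * cnj (z - l) ^ k * of_real (r * \<phi> s * exp (- \<alpha> * s))"
      unfolding cnj_atom_gauss r_def s_def Gp[symmetric] of_real_mult by (simp only: mult_ac)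
    have 2: "of_real (\<phi>' s) * (z - l) * G z * pole l k z =
        p (z - l) * cnj (z - l) ^ k * of_real (- (normal k * \<phi>' s * gamma_tail k (\<alpha> * s) / s ^ k))"
    proof (cases "z = l")
      case True
      then show ?thesis using b by (simp add: s_def)
    next
      case False
      have "complex_of_real (s ^ k) = (z - l) ^ k * cnj (z - l) ^ k"
        unfolding s_def by (rule power_mult_power_cnj[symmetric])
      then have cs: "cnj (z - l) ^ k / complex_of_real (s ^ k) = 1 / (z - l) ^ k"
        using False by (simp add: field_simps flip: complex_cnj_diff)
      have "of_real (\<phi>' s) * (z - l) * G z * pole l k z =
          (G z * expo l z) * (1 / (z - l) ^ k) * of_real (- (normal k * \<phi>' s * gamma_tail k (\<alpha> * s)))"
        using False by (simp add: pole_def s_def field_simps)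
      then show ?thesis unfolding Gp cs[symmetric] by simp
    qed
    show ?thesis unfolding F_def s_def[symmetric] 1 2 K_def
      by (simp add: right_diff_distrib)
  qed
  have p: "p holomorphic_on UNIV" unfolding p_def fock_basis_def by (intro holomorphic_intros)
  have cp: "continuous_on UNIV p" using p by (rule holomorphic_on_imp_continuous_on)
  let ?P = "\<lambda>u. p u * cnj u ^ k * of_real (K ((cmod u)\<^sup>2))"
  have "integrable lborel ?P"
    by (rule integrable_mult_radial[OF cK K0]) (auto intro!: continuous_intros cp)
  then show "integrable lborel F"
    unfolding F_eq[abs_def] using integrable_translate[of ?P "- l"] by simp
  have coeff: "(deriv ^^ k) p 0 / fact k = of_real r * c k"
  proof -
    have p_space: "p \<in> fock_space \<alpha>" unfolding p_def
      by (intro fock_space_sum fock_space_scale fock_basis_space[OF \<alpha>])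
    have "fock_inner \<alpha> p (fock_basis \<alpha> k) = (\<Sum>j<n. c j * (if j = k then 1 else 0))"
      unfolding p_def
      by (subst fock_inner_sum_left[OF fock_space_scale[OF fock_basis_space[OF \<alpha>]] fock_basis_space[OF \<alpha>]])
         (simp add: fock_inner_scale_left fock_inner_basis_basis[OF \<alpha>])
    also have "\<dots> = c k" using k by (simp add: if_distrib sum.delta' cong: if_cong)
    finally have "of_real (sqrt (fact k / \<alpha> ^ k)) * ((deriv ^^ k) p 0 / fact k) = c k"
      using fock_inner_basis[OF \<alpha> p_space] by simp
    then have "of_real r * c k = of_real (r * sqrt (fact k / \<alpha> ^ k)) * ((deriv ^^ k) p 0 / fact k)"
      unfolding of_real_mult by (metis mult.assoc)
    also have "r * sqrt (fact k / \<alpha> ^ k) = 1"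
      unfolding r_def real_sqrt_mult[symmetric] using \<alpha> by simp
    finally show ?thesis by simp
  qed
  have moment: "(LINT u|lborel. ((cmod u)\<^sup>2) ^ k * K ((cmod u)\<^sup>2)) = pi * normal k"
  proof -
    \<comment> \<open>The derivative of \<phi> times the tail, so that its integral sees only the
      value 1 of this product at s = 0.\<close>
    define D where "D s = \<phi>' s * gamma_tail k (\<alpha> * s) + tail' k s * \<phi> s" for s
    have "((cmod u)\<^sup>2) ^ k * K ((cmod u)\<^sup>2) = - normal k * D ((cmod u)\<^sup>2)" for u
    proof -
      define s where "s = (cmod u)\<^sup>2"
      have "s ^ k * (normal k * \<phi>' s * gamma_tail k (\<alpha> * s) / s ^ k) = normal k * \<phi>' s * gamma_tail k (\<alpha> * s)"
        using b by (cases "s = 0") auto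
      moreover have "normal k * tail' k s = - (r * s ^ k * exp (- \<alpha> * s))"
        unfolding r_def normal_eq[symmetric] by (simp add: tail'_def power_mult_distrib mult_ac)
      ultimately have "s ^ k * K s = - normal k * D s"
        unfolding K_def D_def by (simp add: algebra_simps)
      then show ?thesis by (simp add: s_def)
    qed
    then have "(LINT u|lborel. ((cmod u)\<^sup>2) ^ k * K ((cmod u)\<^sup>2)) = - normal k * (LINT u::complex|lborel. D ((cmod u)\<^sup>2))"
      by (simp only: integral_mult_right_zero)
    also have "(LINT u::complex|lborel. D ((cmod u)\<^sup>2)) = - pi * (\<phi> 0 * gamma_tail k (\<alpha> * 0))"
    proof (rule integral_radial_derivative)
      show "((\<lambda>s. \<phi> s * gamma_tail k (\<alpha> * s)) has_real_derivative D s) (at s)" for s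
        unfolding D_def by (rule DERIV_mult[OF \<phi> tail_derivs(1)])
      show "continuous_on UNIV D" unfolding D_def by (intro continuous_intros c\<phi>' cg c\<phi> tail_derivs)
      show "\<phi> s * gamma_tail k (\<alpha> * s) = 0" "D s = 0" if "s > d" for s using d[of s] that by (auto simp: D_def)
    qed
    finally show ?thesis using b by simp
  qed
  have "(LINT z|lborel. F z) = integral\<^sup>L lborel ?P"
    unfolding F_eq using integral_translate[of ?P "- l"] by simp
  also have "\<dots> = of_real r * c k * of_real (pi * normal k)"
    using integral_entire_radial[where R=d and \<kappa>=K and k=k, OF cK K0 p] unfolding coeff moment .
  also have "\<dots> = of_real (r * (pi * normal k)) * c k" by simp
  also have "r * (pi * normal k) = pi / \<alpha>"
  proof -
    have "r * sqrt (fact k / \<alpha> ^ k) = 1"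
      unfolding r_def real_sqrt_mult[symmetric] using \<alpha> by simp
    then have "pi * (r * sqrt (fact k / \<alpha> ^ k)) / \<alpha> = pi / \<alpha>" by simp
    then show ?thesis by (simp add: normal_def mult_ac)
  qed
  finally show "(LINT z|lborel. F z) = of_real (pi / \<alpha>) * c k" .
qed

text \<open>The pole at \<open>l'\<close> lies outside the support of the cut-off, so
  \<open>F\<close> is on the whole plane the conjugate-z derivative of a C^1 function of compact
  support.\<close>

lemma local_identity_other:
  fixes \<phi> \<phi>' :: "real \<Rightarrow> real" and l l' :: complex and k :: nat
  assumes \<phi>: "\<And>s. (\<phi> has_real_derivative \<phi>' s) (at s)" and c\<phi>': "continuous_on UNIV \<phi>'"
    and d: "\<And>s. s \<ge> d \<Longrightarrow> \<phi> s = 0" "\<And>s. s \<ge> d \<Longrightarrow> \<phi>' s = 0"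
    and l': "(cmod (l' - l))\<^sup>2 > d" and G: "G holomorphic_on UNIV"
  defines "F \<equiv> \<lambda>z. of_real (\<phi> ((cmod (z - l))\<^sup>2)) * G z * (cnj (fock_atom \<alpha> l' k z) * of_real (gauss z)) +
      of_real (\<phi>' ((cmod (z - l))\<^sup>2)) * (z - l) * G z * pole l' k z"
  shows "integrable lborel F" "(LINT z|lborel. F z) = 0"
proof -
  \<comment> \<open>On \<open>S\<close> everything vanishes because of the cut-off, on
    \<open>T\<close> the pole is smooth; both sets are open, and together they cover the
    plane.\<close>
  define S where "S = {z. (cmod (z - l))\<^sup>2 > d}"
  define T where "T = - {l'}"
  have open_S: "open S" unfolding S_def by (intro open_Collect_less continuous_intros)
  have open_T: "open T" by (simp add: T_def open_Compl)
  have ST: "S \<union> T = UNIV" using l' by (auto simp: S_def T_def)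
  define h where "h z = - of_real (normal k) * expo l' z / (z - l') ^ Suc k" for z
  have h: "h holomorphic_on T" unfolding h_def expo_def T_def by (intro holomorphic_intros) auto
  define X where "X z = of_real (\<phi> ((cmod (z - l))\<^sup>2)) * (G z * pole l' k z)" for z
  define P where "P z = of_real (\<phi>' ((cmod (z - l))\<^sup>2)) * cnj (z - l) * (G z * pole l' k z) +
     of_real (\<phi> ((cmod (z - l))\<^sup>2)) * (deriv G z * pole l' k z + G z *
       (deriv h z * of_real (gamma_tail k (\<alpha> * (cmod (z - l'))\<^sup>2)) + h z * (of_real (tail' k ((cmod (z - l'))\<^sup>2)) * cnj (z - l'))))" for z
  have gT: "pole l' k z = h z * of_real (gamma_tail k (\<alpha> * (cmod (z - l'))\<^sup>2))" for z
    by (simp add: pole_def h_def)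
  have wT: "wirtinger X (P z) (F z) z" if "z \<in> T" for z
  proof -
    have "(h has_field_derivative deriv h z) (at z)"
      using h open_T that by (rule holomorphic_derivI)
    note wh = wirtinger_holomorphic[OF this]
    have w: "wirtinger X (of_real (\<phi>' ((cmod (z - l))\<^sup>2)) * cnj (z - l) * (G z * (h z * of_real (gamma_tail k (\<alpha> * (cmod (z - l'))\<^sup>2)))) +
     of_real (\<phi> ((cmod (z - l))\<^sup>2)) * (deriv G z * (h z * of_real (gamma_tail k (\<alpha> * (cmod (z - l'))\<^sup>2))) + G z *
       (deriv h z * of_real (gamma_tail k (\<alpha> * (cmod (z - l'))\<^sup>2)) + h z * (of_real (tail' k ((cmod (z - l'))\<^sup>2)) * cnj (z - l')))))
      (of_real (\<phi>' ((cmod (z - l))\<^sup>2)) * (z - l) * (G z * (h z * of_real (gamma_tail k (\<alpha> * (cmod (z - l'))\<^sup>2)))) +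
     of_real (\<phi> ((cmod (z - l))\<^sup>2)) * (0 * (h z * of_real (gamma_tail k (\<alpha> * (cmod (z - l'))\<^sup>2))) + G z *
       (0 * of_real (gamma_tail k (\<alpha> * (cmod (z - l'))\<^sup>2)) + h z * (of_real (tail' k ((cmod (z - l'))\<^sup>2)) * (z - l'))))) z"
      unfolding X_def gT
      by (intro wirtinger_mult wirtinger_radial[OF \<phi>] wirtinger_radial[OF tail_derivs(1)] wh wirtinger_holomorphic_deriv[OF G])
    have "h z * (of_real (tail' k ((cmod (z - l'))\<^sup>2)) * (z - l')) = cnj (fock_atom \<alpha> l' k z) * of_real (gauss z)"
    proof -
      have "h z * (of_real (tail' k ((cmod (z - l'))\<^sup>2)) * (z - l')) =
        (- of_real (normal k) * expo l' z * (of_real (tail' k ((cmod (z - l'))\<^sup>2)) * (z - l'))) / (z - l') ^ Suc k"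
        by (simp add: h_def)
      then show ?thesis unfolding dbar_pole_aux using that by (simp add: T_def)
    qed
    with w show ?thesis unfolding P_def F_def gT
      by (simp only: mult_zero_left add_0 add_0_left add_0_right mult.assoc add.commute)
  qed
  have S0: "X z = 0" "P z = 0" "F z = 0" if "z \<in> S" for z
    using d[of "(cmod (z - l))\<^sup>2"] that by (auto simp: S_def X_def P_def F_def)
  have w: "wirtinger X (P z) (F z) z" for z
  proof (cases "z \<in> T")
    case False
    then have z: "z \<in> S" using ST by auto
    have "wirtinger X 0 0 z"
      by (rule wirtinger_transform[OF wirtinger_const[of 0] open_S z]) (simp add: S0)
    then show ?thesis using S0[OF z] by simp
  qed (rule wT)
  have c\<phi>: "continuous_on UNIV \<phi>"
    using \<phi> by (meson DERIV_isCont continuous_at_imp_continuous_on)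
  have cg: "continuous_on UNIV (\<lambda>s. gamma_tail k (\<alpha> * s))"
    using tail_derivs(1) by (meson DERIV_isCont continuous_at_imp_continuous_on)
  have c1: "continuous_on A (\<lambda>z. \<phi> ((cmod (z - l))\<^sup>2))" "continuous_on A (\<lambda>z. \<phi>' ((cmod (z - l))\<^sup>2))"
    "continuous_on A (\<lambda>z. gamma_tail k (\<alpha> * (cmod (z - l'))\<^sup>2))" "continuous_on A (\<lambda>z. tail' k ((cmod (z - l'))\<^sup>2))" for A
    by (rule continuous_on_compose2[OF c\<phi>] continuous_on_compose2[OF c\<phi>'] continuous_on_compose2[OF cg]
        continuous_on_compose2[OF tail_derivs(4)], auto intro!: continuous_intros)+
  have cG: "continuous_on A G" "continuous_on A (deriv G)" for A
    using G holomorphic_deriv[OF G open_UNIV]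
    by (meson continuous_on_subset holomorphic_on_imp_continuous_on subset_UNIV)+
  have ch: "continuous_on T h" "continuous_on T (deriv h)"
    using h holomorphic_deriv[OF h open_T] by (auto intro: holomorphic_on_imp_continuous_on)
  have ca: "continuous_on A (fock_atom \<alpha> l' k)" for A
    using fock_spaceD(2)[OF fock_atom_space[OF \<alpha>]] by (rule continuous_on_subset) simp
  have "continuous_on (S \<union> T) P"
  proof (rule continuous_on_open_Un[OF open_S open_T])
    show "continuous_on S P"
      by (rule continuous_on_eq[OF continuous_on_const[of _ 0]]) (simp add: S0)
    show "continuous_on T P" unfolding P_def gT
      by (intro continuous_on_add continuous_on_mult continuous_on_of_real continuous_on_cnj continuous_on_diff
          continuous_on_id continuous_on_const c1 cG ch)
  qed
  then have cP: "continuous_on UNIV P" by (simp only: ST)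
  have "continuous_on (S \<union> T) F"
  proof (rule continuous_on_open_Un[OF open_S open_T])
    show "continuous_on S F"
      by (rule continuous_on_eq[OF continuous_on_const[of _ 0]]) (simp add: S0)
    show "continuous_on T F" unfolding F_def gT
      by (intro continuous_on_add continuous_on_mult continuous_on_of_real continuous_on_cnj continuous_on_diff
          continuous_on_exp continuous_on_power continuous_on_norm
          continuous_on_id continuous_on_const c1 cG ch ca)
  qed
  then have cF: "continuous_on UNIV F" by (simp only: ST)
  have X0: "X z = 0" if "cmod z > cmod l + max 1 d" for z
  proof (rule S0)
    have "cmod z \<le> cmod (z - l) + cmod l" by (metis diff_add_cancel norm_triangle_ineq)
    then have "cmod (z - l) > max 1 d" using that by linarith
    then have "max 1 d * 1 < cmod (z - l) * cmod (z - l)" by (intro mult_strict_mono) auto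
    then show "z \<in> S" by (simp add: S_def power2_eq_square)
  qed
  show "integrable lborel F" "(LINT z|lborel. F z) = 0"
    using integral_wirtinger_eq_0[OF w cP cF X0] by auto
qed

text \<open>The function W: singular at the points of \<Lambda>, and off them \<open>bsum\<close>
  divided by \<open>Qpoly\<close>.\<close>

definition residual :: "(complex \<Rightarrow> nat \<Rightarrow> complex) \<Rightarrow> complex \<Rightarrow> complex" where
  "residual c z = (\<Sum>(l, k)\<in>index. cnj (c l k) * pole l k z)"

definition local_part :: "(complex \<Rightarrow> nat \<Rightarrow> complex) \<Rightarrow> complex \<Rightarrow> complex \<Rightarrow> complex" where
  "local_part c l z = (\<Sum>j<m l. c l j * fock_atom \<alpha> l j z)"

lemma local_part_space: "local_part c l \<in> fock_space \<alpha>"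
  unfolding local_part_def by (intro fock_space_sum fock_space_scale fock_atom_space[OF \<alpha>])

lemma local_part_norm:
  "(LINT z|lborel. (cmod (local_part c l z))\<^sup>2 * gauss z) = pi / \<alpha> * (\<Sum>k<m l. (cmod (c l k))\<^sup>2)"
proof -
  have 1: "fock_inner \<alpha> (fock_atom \<alpha> l j) (local_part c l) = cnj (c l j)" if "j < m l" for j
  proof -
    have "fock_inner \<alpha> (fock_atom \<alpha> l j) (local_part c l) =
        (\<Sum>k<m l. fock_inner \<alpha> (fock_atom \<alpha> l j) (\<lambda>z. c l k * fock_atom \<alpha> l k z))"
      unfolding local_part_def[abs_def]
      by (rule fock_inner_sum_right[OF fock_space_scale[OF fock_atom_space[OF \<alpha>]] fock_atom_space[OF \<alpha>]])
    also have "\<dots> = (\<Sum>k<m l. cnj (c l k) * (if j = k then 1 else 0))"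
      by (simp only: fock_inner_scale_right fock_atom_orthonormal[OF \<alpha>])
    also have "\<dots> = cnj (c l j)" using that by (simp add: if_distrib sum.delta cong: if_cong)
    finally show ?thesis .
  qed
  have "fock_inner \<alpha> (local_part c l) (local_part c l) =
      (\<Sum>j<m l. fock_inner \<alpha> (\<lambda>z. c l j * fock_atom \<alpha> l j z) (local_part c l))"
    unfolding local_part_def[abs_def]
    by (rule fock_inner_sum_left[OF fock_space_scale[OF fock_atom_space[OF \<alpha>]] local_part_space[unfolded local_part_def[abs_def]]])
  also have "\<dots> = of_real (\<Sum>j<m l. (cmod (c l j))\<^sup>2)"
    unfolding of_real_sum complex_norm_square
    by (intro sum.cong refl) (simp only: fock_inner_scale_left, simp add: 1)
  finally have "(fock_norm \<alpha> (local_part c l))\<^sup>2 = (\<Sum>j<m l. (cmod (c l j))\<^sup>2)"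
    unfolding fock_inner_self[OF \<alpha>] by (simp only: of_real_eq_iff)
  then show ?thesis using \<alpha> by (simp add: fock_norm_power2[OF \<alpha>] field_simps)
qed

text \<open>Testing against the local part at \<open>l\<close> itself makes the terms add up to
  squares: each atom at \<open>l\<close> returns its coefficient, every other atom returns 0. The
  coefficients at \<open>l\<close> are thus controlled by f on the disc and by W where \<phi>' is
  nonzero.\<close>

lemma cutoff_identity:
  fixes \<phi> \<phi>' :: "real \<Rightarrow> real" and c :: "complex \<Rightarrow> nat \<Rightarrow> complex"
  assumes l: "l \<in> \<Lambda>"
    and \<phi>: "\<And>s. (\<phi> has_real_derivative \<phi>' s) (at s)" and c\<phi>': "continuous_on UNIV \<phi>'"
    and b: "0 < b" "\<And>s. s \<le> b \<Longrightarrow> \<phi> s = 1" "\<And>s. s \<le> b \<Longrightarrow> \<phi>' s = 0"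
    and d: "\<And>s. s \<ge> d \<Longrightarrow> \<phi> s = 0" "\<And>s. s \<ge> d \<Longrightarrow> \<phi>' s = 0" "d < radius2 l"
  defines "F \<equiv> \<lambda>z. of_real (\<phi> ((cmod (z - l))\<^sup>2)) * local_part c l z * (cnj (synth c z) * of_real (gauss z)) +
      of_real (\<phi>' ((cmod (z - l))\<^sup>2)) * (z - l) * local_part c l z * residual c z"
  shows "integrable lborel F" "(LINT z|lborel. F z) = of_real (pi / \<alpha> * (\<Sum>k<m l. (cmod (c l k))\<^sup>2))"
proof -
  define T where "T i z = of_real (\<phi> ((cmod (z - l))\<^sup>2)) * local_part c l z * (cnj (fock_atom \<alpha> (fst i) (snd i) z) * of_real (gauss z)) +
      of_real (\<phi>' ((cmod (z - l))\<^sup>2)) * (z - l) * local_part c l z * pole (fst i) (snd i) z" for i :: "complex \<times> nat" and z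
  have F: "F z = (\<Sum>i\<in>index. cnj (c (fst i) (snd i)) * T i z)" for z
    unfolding F_def T_def synth_def residual_def case_prod_beta cnj_sum sum_distrib_left sum_distrib_right
      sum.distrib[symmetric] complex_cnj_mult
    by (intro sum.cong refl) (simp only: distrib_left mult_ac)
  have same: "integrable lborel (T (l, k))" "(LINT z|lborel. T (l, k) z) = of_real (pi / \<alpha>) * c l k" if "k < m l" for k
    using local_identity_same[where c="c l" and l=l, OF \<phi> c\<phi>' b d(1,2) that]
    unfolding T_def[abs_def] local_part_def fst_conv snd_conv by auto
  have other: "integrable lborel (T i)" "(LINT z|lborel. T i z) = 0" if i: "i \<in> index" "fst i \<noteq> l" for i
  proof -
    have fi: "fst i \<in> \<Lambda>" using i by (auto simp: divisor_index_def)
    have "radius2 l \<le> (cmod (fst i - l))\<^sup>2"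
      using i(2) by (intro radius2_unique[OF fi l]) (auto simp: radius2_pos)
    then have "d < (cmod (fst i - l))\<^sup>2" using d(3) by linarith
    from local_identity_other[OF \<phi> c\<phi>' d(1,2) this fock_spaceD(1)[OF local_part_space]]
    show "integrable lborel (T i)" "(LINT z|lborel. T i z) = 0"
      unfolding T_def[abs_def] by auto
  qed
  have intT: "integrable lborel (T i)" if "i \<in> index" for i
  proof (cases "fst i = l")
    case True
    then show ?thesis using that same(1)[of "snd i"] by (auto simp: divisor_index_def)
  qed (use other that in auto)
  show "integrable lborel F"
    unfolding F[abs_def] by (intro Bochner_Integration.integrable_sum integrable_mult_right intT)
  have "(LINT z|lborel. F z) = (\<Sum>i\<in>index. LINT z|lborel. cnj (c (fst i) (snd i)) * T i z)"
    unfolding F by (intro Bochner_Integration.integral_sum integrable_mult_right intT)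
  also have "\<dots> = (\<Sum>i\<in>index. cnj (c (fst i) (snd i)) * (LINT z|lborel. T i z))"
    by (simp only: integral_mult_right_zero)
  also have "\<dots> = (\<Sum>i\<in>Pair l ` {..<m l}. cnj (c (fst i) (snd i)) * (LINT z|lborel. T i z))"
  proof (rule sum.mono_neutral_right[OF finite_index])
    show "Pair l ` {..<m l} \<subseteq> index" using l by (auto simp: divisor_index_def)
    show "\<forall>i\<in>index - Pair l ` {..<m l}. cnj (c (fst i) (snd i)) * (LINT z|lborel. T i z) = 0"
    proof
      fix i assume i: "i \<in> index - Pair l ` {..<m l}"
      then have "fst i \<noteq> l" by (cases i) (auto simp: divisor_index_def)
      with other(2) i show "cnj (c (fst i) (snd i)) * (LINT z|lborel. T i z) = 0" by simp
    qed
  qed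
  also have "\<dots> = (\<Sum>k<m l. cnj (c l k) * (of_real (pi / \<alpha>) * c l k))"
    by (subst sum.reindex) (auto simp: inj_on_def same)
  also have "\<dots> = of_real (pi / \<alpha> * (\<Sum>k<m l. (cmod (c l k))\<^sup>2))"
    unfolding of_real_mult of_real_sum complex_norm_square sum_distrib_left by (intro sum.cong refl) (simp only: mult_ac)
  finally show "(LINT z|lborel. F z) = of_real (pi / \<alpha> * (\<Sum>k<m l. (cmod (c l k))\<^sup>2))" .
qed

lemma bsum_residual:
  assumes "z \<notin> \<Lambda>"
  shows "bsum c z = Qpoly z * residual c z"
  unfolding bsum_def residual_def sum_distrib_left
proof (intro sum.cong refl)
  fix i assume "i \<in> index"
  then have "fst i \<in> \<Lambda>" "snd i < m (fst i)" "z \<noteq> fst i" using assms by (auto simp: divisor_index_def)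
  from reg_eq_pole[OF this] show "(case i of (l, k) \<Rightarrow> cnj (c l k) * reg l k z) =
      Qpoly z * (case i of (l, k) \<Rightarrow> cnj (c l k) * pole l k z)"
    by (simp add: case_prod_beta)
qed

text \<open>64/C^2 is the square of the bound 8/C for the cut-off gradient in
  \<open>local_bound\<close>. In \<open>residual_bound\<close>, 2/\<alpha> comes from the density
  and exp H from the lower bound of the weight.\<close>

definition riesz_const :: real where
  "riesz_const = 64 / C\<^sup>2 * (2 * exp H / \<alpha>)"

lemma riesz_const_nonneg: "riesz_const \<ge> 0"
  using \<alpha> by (simp add: riesz_const_def)

text \<open>In the outer half of the annulus, measured in s, the density is at least \<alpha>/2, and
  all factors of the weight except that of \<open>l\<close> equal 1; so W can be recovered there
  from \<open>bsum\<close> at a bounded cost.\<close>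

lemma residual_bound:
  assumes l: "l \<in> \<Lambda>" and s: "(real (m l) / \<alpha> + radius2 l) / 2 \<le> (cmod (z - l))\<^sup>2" "(cmod (z - l))\<^sup>2 < radius2 l"
  shows "(cmod (residual c z))\<^sup>2 * exp (\<alpha> * (cmod z)\<^sup>2) \<le>
    2 * exp H / \<alpha> * (density z * (cmod (bsum c z))\<^sup>2 * exp (potential z))"
proof -
  define s where "s = (cmod (z - l))\<^sup>2"
  have sm: "real (m l) / \<alpha> \<le> s" using s by (simp add: s_def)
  have "real (m l) / \<alpha> \<ge> 0" using \<alpha> by simp
  then have "0 < (real (m l) / \<alpha> + radius2 l) / 2" using radius2_pos[of l] by (simp add: add_nonneg_pos)
  then have s0: "s > 0" using s(1) unfolding s_def by (rule less_le_trans)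
  have zl: "z \<noteq> l'" if "l' \<in> \<Lambda>" for l'
    using radius2_unique[OF l that, of z] radius2_pos[of l'] s(2) s0 by (cases "l = l'") (auto simp: s_def)
  then have "z \<notin> \<Lambda>" by blast
  note bres = bsum_residual[OF this, of c]
  have "(\<Prod>l'\<in>\<Lambda>. ((cmod (z - l'))\<^sup>2) ^ m l' * exp (\<eta> l' ((cmod (z - l'))\<^sup>2))) = s ^ m l * exp (\<eta> l s)"
  proof -
    have "(\<Prod>l'\<in>\<Lambda> - {l}. ((cmod (z - l'))\<^sup>2) ^ m l' * exp (\<eta> l' ((cmod (z - l'))\<^sup>2))) = 1"
      using radius2_unique[OF l _ _ s(2)] by (intro prod.neutral ballI weight_eq) (auto simp: radius2_def)
    then show ?thesis by (simp add: prod.remove[OF finite_\<Lambda> l] s_def)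
  qed
  also have "\<dots> \<ge> exp (- H)" by (rule weight_ge[OF l sm])
  finally have "exp (\<alpha> * (cmod z)\<^sup>2) * exp (- H) \<le> (cmod (Qpoly z))\<^sup>2 * exp (potential z)"
    unfolding Qpoly_potential by (intro mult_left_mono) auto
  then have 1: "(cmod (residual c z))\<^sup>2 * (exp (\<alpha> * (cmod z)\<^sup>2) * exp (- H)) \<le> (cmod (residual c z))\<^sup>2 * ((cmod (Qpoly z))\<^sup>2 * exp (potential z))"
    by (intro mult_left_mono) auto
  have "\<alpha> / 2 \<le> density z"
    unfolding density_local[OF l s(2)] using s by (intro density_ge l) (auto simp: radius2_def)
  then have "\<alpha> / 2 * ((cmod (bsum c z))\<^sup>2 * exp (potential z)) \<le> density z * ((cmod (bsum c z))\<^sup>2 * exp (potential z))"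
    by (intro mult_right_mono) auto
  then have 2: "(cmod (bsum c z))\<^sup>2 * exp (potential z) \<le> 2 / \<alpha> * (density z * (cmod (bsum c z))\<^sup>2 * exp (potential z))"
    using \<alpha> by (simp add: field_simps)
  have "(cmod (residual c z))\<^sup>2 * exp (\<alpha> * (cmod z)\<^sup>2) = exp H * ((cmod (residual c z))\<^sup>2 * (exp (\<alpha> * (cmod z)\<^sup>2) * exp (- H)))"
    by (simp add: exp_minus)
  also have "\<dots> \<le> exp H * ((cmod (residual c z))\<^sup>2 * ((cmod (Qpoly z))\<^sup>2 * exp (potential z)))"
    by (intro mult_left_mono 1) auto
  also have "\<dots> = exp H * ((cmod (bsum c z))\<^sup>2 * exp (potential z))"
    by (simp add: bres norm_mult power_mult_distrib mult_ac)
  also have "\<dots> \<le> exp H * (2 / \<alpha> * (density z * (cmod (bsum c z))\<^sup>2 * exp (potential z)))"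
    by (intro mult_left_mono 2) auto
  finally show ?thesis by (simp add: mult_ac)
qed

text \<open>Both terms of \<open>cutoff_identity\<close> are split by x y \<le> x^2/4 + y^2. The two
  quarters form half of the left side and are absorbed. The indicator is kept so that the bounds can
  be added over disjoint discs.\<close>

lemma local_bound:
  assumes l: "l \<in> \<Lambda>"
  shows "pi / \<alpha> * (\<Sum>k<m l. (cmod (c l k))\<^sup>2) \<le> 2 * (LINT z|lborel. indicator (ball l (sqrt (real (m l) / \<alpha>) + C)) z *
    ((cmod (synth c z))\<^sup>2 * gauss z + riesz_const * (density z * (cmod (bsum c z))\<^sup>2 * exp (potential z))))"
proof -
  define r where "r = sqrt (real (m l) / \<alpha>)"
  define R where "R = r + C"
  have r0: "r \<ge> 0" using \<alpha> by (simp add: r_def)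
  have r2: "real (m l) / \<alpha> = r\<^sup>2" using \<alpha> by (simp add: r_def)
  have R2: "radius2 l = R\<^sup>2" by (simp add: radius2_def R_def r_def)
  have rR: "R\<^sup>2 - r\<^sup>2 = C * (R + r)" by (simp add: R_def power2_eq_square algebra_simps)
  have R0: "R > 0" using r0 C by (simp add: R_def)
  have "C * (R + r) > 0" using r0 R0 C by (intro mult_pos_pos) auto
  then have rltR: "r\<^sup>2 < R\<^sup>2" using rR by linarith
  \<comment> \<open>The cut-off falls between the middle of [r^2, R^2], where the density bound
    begins, and the three-quarter point, which keeps its support inside the disc.\<close>
  define b where "b = (r\<^sup>2 + R\<^sup>2) / 2"
  define d where "d = (r\<^sup>2 + 3 * R\<^sup>2) / 4"
  have bd: "0 < b" "b < d" "d < R\<^sup>2" "d - b = (R\<^sup>2 - r\<^sup>2) / 4"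
    using rltR add_pos_nonneg[OF zero_less_power[OF R0, of 2] zero_le_power2[of r]]
    by (auto simp: b_def d_def field_simps)
  obtain \<phi> \<phi>' :: "real \<Rightarrow> real" where \<phi>: "\<And>s. (\<phi> has_real_derivative \<phi>' s) (at s)" and c\<phi>': "continuous_on UNIV \<phi>'"
    and \<phi>b: "\<And>s. s \<le> b \<Longrightarrow> \<phi> s = 1" and \<phi>d: "\<And>s. s \<ge> d \<Longrightarrow> \<phi> s = 0"
    and \<phi>'b: "\<And>s. s \<le> b \<Longrightarrow> \<phi>' s = 0" and \<phi>'d: "\<And>s. s \<ge> d \<Longrightarrow> \<phi>' s = 0"
    and \<phi>1: "\<And>s. \<bar>\<phi> s\<bar> \<le> 1" and \<phi>'1: "\<And>s. \<bar>\<phi>' s\<bar> \<le> 2 / (d - b)"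
    using radial_cutoff[OF bd(2)] by metis
  let ?A = "ball l (sqrt (real (m l) / \<alpha>) + C)"
  define G where "G = local_part c l"
  define S where "S = (\<Sum>k<m l. (cmod (c l k))\<^sup>2)"
  define Z where "Z z = (cmod (synth c z))\<^sup>2 * gauss z + riesz_const * (density z * (cmod (bsum c z))\<^sup>2 * exp (potential z))" for z
  define F where "F z = of_real (\<phi> ((cmod (z - l))\<^sup>2)) * G z * (cnj (synth c z) * of_real (gauss z)) +
      of_real (\<phi>' ((cmod (z - l))\<^sup>2)) * (z - l) * G z * residual c z" for z
  have F: "integrable lborel F" "(LINT z|lborel. F z) = of_real (pi / \<alpha> * S)"
    using cutoff_identity[OF l \<phi> c\<phi>' bd(1) \<phi>b \<phi>'b \<phi>d \<phi>'d, of d c] bd(3)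
    unfolding F_def[abs_def] G_def S_def R2 by auto
  have intZ: "integrable lborel Z"
    unfolding Z_def using fock_spaceD(3)[OF synth_space[of c]] bsum_estimate(1)[of c]
    by (intro Bochner_Integration.integrable_add integrable_mult_right)
  have intAZ: "integrable lborel (\<lambda>z. indicator ?A z * Z z)"
    using integrable_mult_indicator[OF _ intZ, of ?A] by simp
  have intG: "integrable lborel (\<lambda>z. (cmod (G z))\<^sup>2 * gauss z)"
    unfolding G_def by (rule fock_spaceD(3)[OF local_part_space])
  have amgm: "x * y \<le> x\<^sup>2 / 4 + y\<^sup>2" for x y :: real
    using zero_le_power2[of "x / 2 - y"] by (simp add: power2_eq_square field_simps)
  have bound: "cmod (F z) \<le> 1 / 2 * ((cmod (G z))\<^sup>2 * gauss z) + indicator ?A z * Z z" for z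
  proof (cases "z \<in> ?A")
    case False
    then have "(cmod (z - l))\<^sup>2 \<ge> radius2 l" using less_radius2_iff[of z l] by (simp add: not_less)
    then have "d \<le> (cmod (z - l))\<^sup>2" using bd R2 by simp
    then show ?thesis using False by (simp add: F_def \<phi>d \<phi>'d)
  next
    case True
    define s where "s = (cmod (z - l))\<^sup>2"
    have sR: "s < R\<^sup>2" using True less_radius2_iff[of z l] by (simp add: R2 s_def)
    \<comment> \<open>The square root of the Gaussian. In the first term each factor receives one g;
      in the second \<open>G\<close> receives g and W receives 1/g.\<close>
    define g where "g = exp (- (\<alpha> / 2) * (cmod z)\<^sup>2)"
    have g: "g > 0" "g * g = gauss z" "(1 / g) * (1 / g) = exp (\<alpha> * (cmod z)\<^sup>2)"
      by (auto simp: g_def exp_minus[symmetric] inverse_eq_divide[symmetric] simp flip: exp_add)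
    have 1: "cmod (of_real (\<phi> s) * G z * (cnj (synth c z) * of_real (gauss z))) \<le>
        1 / 4 * ((cmod (G z))\<^sup>2 * gauss z) + (cmod (synth c z))\<^sup>2 * gauss z"
    proof -
      have "cmod (of_real (\<phi> s) * G z * (cnj (synth c z) * of_real (gauss z))) =
          \<bar>\<phi> s\<bar> * ((cmod (G z) * g) * (cmod (synth c z) * g))"
        unfolding g(2)[symmetric] using g(1) by (simp add: norm_mult)
      also have "\<dots> \<le> 1 * ((cmod (G z) * g)\<^sup>2 / 4 + (cmod (synth c z) * g)\<^sup>2)"
        using g(1) \<phi>1 by (intro mult_mono amgm) auto
      finally show ?thesis using g(2) by (simp add: power_mult_distrib power2_eq_square[of g])
    qed
    have 2: "cmod (of_real (\<phi>' s) * (z - l) * G z * residual c z) \<le>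
        1 / 4 * ((cmod (G z))\<^sup>2 * gauss z) + riesz_const * (density z * (cmod (bsum c z))\<^sup>2 * exp (potential z))"
    proof (cases "s \<le> b")
      case True
      then show ?thesis using \<phi>'b[OF True] density_nonneg'[of z] riesz_const_nonneg by simp
    next
      case False
      \<comment> \<open>The slope is at most 2/(d - b) = 8/(R^2 - r^2), and R^2 - r^2 = C (R + r)
        absorbs the factor |z - l| \<le> R: the bound is independent of the multiplicity.\<close>
      have "\<bar>\<phi>' s\<bar> * cmod (z - l) \<le> 8 / C"
      proof -
        have "cmod (z - l) \<le> R"
          using sR R0 unfolding s_def by (meson less_imp_le power2_less_imp_less)
        moreover have "0 \<le> 2 / (d - b)" using bd(2) by simp
        ultimately have "\<bar>\<phi>' s\<bar> * cmod (z - l) \<le> 2 / (d - b) * R"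
          by (intro mult_mono \<phi>'1) auto
        also have "\<dots> = 8 * R / (C * (R + r))" unfolding bd(4) rR by simp
        also have "\<dots> \<le> 8 * (R + r) / (C * (R + r))"
          using r0 R0 C by (intro divide_right_mono) auto
        also have "\<dots> = 8 / C" using r0 R0 by (intro nonzero_mult_divide_mult_cancel_right) simp
        finally show ?thesis .
      qed
      then have p: "\<bar>\<phi>' s\<bar> * cmod (z - l) * (cmod (residual c z) * (1 / g)) \<le> 8 / C * (cmod (residual c z) * (1 / g))"
        using g(1) by (intro mult_right_mono) auto
      have "cmod (of_real (\<phi>' s) * (z - l) * G z * residual c z) =
          (cmod (G z) * g) * (\<bar>\<phi>' s\<bar> * cmod (z - l) * (cmod (residual c z) * (1 / g)))"
        using g(1) by (simp add: norm_mult)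
      also have "\<dots> \<le> (cmod (G z) * g) * (8 / C * (cmod (residual c z) * (1 / g)))"
        using g(1) by (intro mult_left_mono p) auto
      also have "\<dots> \<le> (cmod (G z) * g)\<^sup>2 / 4 + (8 / C * (cmod (residual c z) * (1 / g)))\<^sup>2"
        by (rule amgm)
      also have "(cmod (G z) * g)\<^sup>2 / 4 = 1 / 4 * ((cmod (G z))\<^sup>2 * gauss z)"
        using g(2) by (simp add: power_mult_distrib power2_eq_square[of g])
      also have "(8 / C * (cmod (residual c z) * (1 / g)))\<^sup>2 = 64 / C\<^sup>2 * ((cmod (residual c z))\<^sup>2 * exp (\<alpha> * (cmod z)\<^sup>2))"
        unfolding g(3)[symmetric] by (simp add: power2_eq_square)
      also have "\<dots> \<le> 64 / C\<^sup>2 * (2 * exp H / \<alpha> * (density z * (cmod (bsum c z))\<^sup>2 * exp (potential z)))"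
        using False sR by (intro mult_left_mono residual_bound[OF l]) (auto simp: r2 R2 b_def s_def)
      finally show ?thesis by (simp add: riesz_const_def mult.assoc)
    qed
    have "cmod (F z) \<le> cmod (of_real (\<phi> s) * G z * (cnj (synth c z) * of_real (gauss z))) +
        cmod (of_real (\<phi>' s) * (z - l) * G z * residual c z)"
      unfolding F_def s_def by (rule norm_triangle_ineq)
    with 1 2 True show ?thesis by (simp add: Z_def)
  qed
  have "pi / \<alpha> * S = cmod (LINT z|lborel. F z)"
    unfolding F(2) using \<alpha> by (simp add: S_def sum_nonneg del: of_real_mult of_real_divide)
  also have "\<dots> \<le> (LINT z|lborel. cmod (F z))" by (rule integral_norm_bound)
  also have "\<dots> \<le> (LINT z|lborel. 1 / 2 * ((cmod (G z))\<^sup>2 * gauss z) + indicator ?A z * Z z)"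
    by (rule integral_mono[OF integrable_norm[OF F(1)] Bochner_Integration.integrable_add[OF integrable_mult_right[OF intG] intAZ] bound])
  also have "\<dots> = 1 / 2 * (LINT z|lborel. (cmod (G z))\<^sup>2 * gauss z) + (LINT z|lborel. indicator ?A z * Z z)"
    by (subst Bochner_Integration.integral_add[OF integrable_mult_right[OF intG] intAZ]) (simp only: integral_mult_right_zero)
  also have "(LINT z|lborel. (cmod (G z))\<^sup>2 * gauss z) = pi / \<alpha> * S"
    unfolding G_def S_def by (rule local_part_norm)
  finally have "pi / \<alpha> * S \<le> 1 / 2 * (pi / \<alpha> * S) + (LINT z|lborel. indicator ?A z * Z z)" .
  then show ?thesis unfolding S_def Z_def by linarith
qed

text \<open>The discs being disjoint, the local integrals add up to at most one integral over the
  plane, so the constant does not grow with the number of points.\<close>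

lemma riesz_lower_bound:
  "(\<Sum>(l, k)\<in>index. (cmod (c l k))\<^sup>2) \<le> 2 * (1 + 2 * riesz_const) * (fock_norm \<alpha> (synth c))\<^sup>2"
proof -
  define Z where "Z z = (cmod (synth c z))\<^sup>2 * gauss z + riesz_const * (density z * (cmod (bsum c z))\<^sup>2 * exp (potential z))" for z
  let ?A = "\<lambda>l. ball l (sqrt (real (m l) / \<alpha>) + C)"
  note ints = fock_spaceD(3)[OF synth_space[of c]] and intb = bsum_estimate(1)[of c]
  have intZ: "integrable lborel Z"
    unfolding Z_def using ints intb by (intro Bochner_Integration.integrable_add integrable_mult_right)
  have intAZ: "integrable lborel (\<lambda>z. indicator (?A l) z * Z z)" for l
    using integrable_mult_indicator[OF _ intZ, of "?A l"] by simp
  have Z0: "Z z \<ge> 0" for z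
    using density_nonneg'[of z] riesz_const_nonneg by (simp add: Z_def)
  have "pi / \<alpha> * (\<Sum>(l, k)\<in>index. (cmod (c l k))\<^sup>2) = (\<Sum>l\<in>\<Lambda>. pi / \<alpha> * (\<Sum>k<m l. (cmod (c l k))\<^sup>2))"
    unfolding divisor_index_def sum_distrib_left[symmetric] using finite_\<Lambda> by (subst sum.Sigma) auto
  also have "\<dots> \<le> (\<Sum>l\<in>\<Lambda>. 2 * (LINT z|lborel. indicator (?A l) z * Z z))"
    using local_bound[of _ c] unfolding Z_def by (intro sum_mono) auto
  also have "\<dots> = 2 * (LINT z|lborel. (\<Sum>l\<in>\<Lambda>. indicator (?A l) z * Z z))"
    unfolding sum_distrib_left[symmetric] using intAZ by (subst Bochner_Integration.integral_sum) auto
  also have "(LINT z|lborel. (\<Sum>l\<in>\<Lambda>. indicator (?A l) z * Z z)) \<le> integral\<^sup>L lborel Z"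
  proof (rule integral_mono[OF _ intZ])
    show "integrable lborel (\<lambda>z. \<Sum>l\<in>\<Lambda>. indicator (?A l) z * Z z)"
      using intAZ by (intro Bochner_Integration.integrable_sum)
    fix z
    have "(\<Sum>l\<in>\<Lambda>. indicator (?A l) z :: real) \<le> 1"
    proof -
      have "(\<Sum>l\<in>\<Lambda>. indicator (?A l) z :: real) = indicator (\<Union>l\<in>\<Lambda>. ?A l) z"
        using disj finite_\<Lambda> by (intro indicator_UN_disjoint[symmetric])
      then show ?thesis by (simp add: indicator_def)
    qed
    then have "(\<Sum>l\<in>\<Lambda>. indicator (?A l) z) * Z z \<le> 1 * Z z" using Z0 by (intro mult_right_mono)
    then show "(\<Sum>l\<in>\<Lambda>. indicator (?A l) z * Z z) \<le> Z z" by (simp add: sum_distrib_right)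
  qed
  also have "integral\<^sup>L lborel Z = (LINT z|lborel. (cmod (synth c z))\<^sup>2 * gauss z) +
      riesz_const * (LINT z|lborel. density z * (cmod (bsum c z))\<^sup>2 * exp (potential z))"
    unfolding Z_def using ints intb
    by (subst Bochner_Integration.integral_add) (auto simp only: integral_mult_right_zero intro: integrable_mult_right)
  also have "\<dots> \<le> (LINT z|lborel. (cmod (synth c z))\<^sup>2 * gauss z) +
      riesz_const * (2 * (LINT z|lborel. (cmod (synth c z))\<^sup>2 * gauss z))"
    using bsum_estimate(2)[of c] riesz_const_nonneg by (intro add_left_mono mult_left_mono)
  also have "\<dots> = (1 + 2 * riesz_const) * (LINT z|lborel. (cmod (synth c z))\<^sup>2 * gauss z)"
    by (simp add: algebra_simps)
  also have "(LINT z|lborel. (cmod (synth c z))\<^sup>2 * gauss z) = pi / \<alpha> * (fock_norm \<alpha> (synth c))\<^sup>2"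
    using \<alpha> by (simp add: fock_norm_power2[OF \<alpha>])
  finally have "pi / \<alpha> * (\<Sum>(l, k)\<in>index. (cmod (c l k))\<^sup>2) \<le>
      pi / \<alpha> * (2 * (1 + 2 * riesz_const) * (fock_norm \<alpha> (synth c))\<^sup>2)"
    by (simp only: mult_ac)
  then show ?thesis using \<alpha> by (subst (asm) mult_le_cancel_left_pos) auto
qed

end

subsection \<open>Touching discs with room to spare give interpolation\<close>

context
  fixes \<alpha> :: real
  assumes \<alpha>: "\<alpha> > 0"
begin

text \<open>Invertibility of the Gram matrix by Gram-Schmidt: \<open>g\<close>, the part of the new
  vector orthogonal to the old ones, corrects the new equation without disturbing the
  others.\<close>

lemma gram_solvable:
  fixes u :: "'i \<Rightarrow> complex \<Rightarrow> complex"
  assumes "finite J" "\<And>i. i \<in> J \<Longrightarrow> u i \<in> fock_space \<alpha>"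
    and "\<And>c. fock_norm \<alpha> (\<lambda>z. \<Sum>i\<in>J. c i * u i z) = 0 \<Longrightarrow> \<forall>i\<in>J. c i = 0"
  shows "\<exists>c. \<forall>i\<in>J. fock_inner \<alpha> (\<lambda>z. \<Sum>j\<in>J. c j * u j z) (u i) = v i"
  using assms
proof (induction J arbitrary: v rule: finite_induct)
  case empty
  then show ?case by simp
next
  case (insert a J)
  have uF: "u i \<in> fock_space \<alpha>" if "i \<in> insert a J" for i using insert.prems(1) that .
  have sumF: "(\<lambda>z. \<Sum>j\<in>J. c j * u j z) \<in> fock_space \<alpha>" for c
    by (intro fock_space_sum fock_space_scale uF) auto
  have "\<exists>c. \<forall>i\<in>J. fock_inner \<alpha> (\<lambda>z. \<Sum>j\<in>J. c j * u j z) (u i) = v i" for v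
  proof (rule insert.IH)
    fix c assume *: "fock_norm \<alpha> (\<lambda>z. \<Sum>i\<in>J. c i * u i z) = 0"
    have "(\<Sum>i\<in>insert a J. (c(a := 0)) i * u i z) = (\<Sum>i\<in>J. c i * u i z)" for z
      using insert.hyps by (auto intro!: sum.cong)
    with * have "fock_norm \<alpha> (\<lambda>z. \<Sum>i\<in>insert a J. (c(a := 0)) i * u i z) = 0" by (simp only:)
    from insert.prems(2)[OF this] show "\<forall>i\<in>J. c i = 0" using insert.hyps by (metis fun_upd_other insertCI)
  qed (use uF in auto)
  then obtain S where S: "\<And>v i. i \<in> J \<Longrightarrow> fock_inner \<alpha> (\<lambda>z. \<Sum>j\<in>J. S v j * u j z) (u i) = v i"
    by metis
  define c1 where "c1 = S (\<lambda>i. fock_inner \<alpha> (u a) (u i))"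
  define p1 where "p1 z = (\<Sum>j\<in>J. c1 j * u j z)" for z
  define g where "g z = u a z + (-1) * p1 z" for z
  have p1F: "p1 \<in> fock_space \<alpha>" unfolding p1_def by (rule sumF)
  have np1F: "(\<lambda>z. (-1) * p1 z) \<in> fock_space \<alpha>" using p1F by (rule fock_space_scale)
  have gF: "g \<in> fock_space \<alpha>" unfolding g_def by (intro fock_space_add np1F uF) auto
  have g_eq: "g z = (\<Sum>j\<in>insert a J. ((\<lambda>j. - c1 j)(a := 1)) j * u j z)" for z
  proof -
    have "(\<Sum>j\<in>J. ((\<lambda>j. - c1 j)(a := 1)) j * u j z) = (\<Sum>j\<in>J. - (c1 j * u j z))"
      using insert.hyps by (intro sum.cong) auto
    then show ?thesis using insert.hyps by (simp add: g_def p1_def sum_negf)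
  qed
  have g_orth: "fock_inner \<alpha> g (u i) = 0" if "i \<in> J" for i
  proof -
    have "fock_inner \<alpha> g (u i) = fock_inner \<alpha> (u a) (u i) + (-1) * fock_inner \<alpha> p1 (u i)"
      unfolding g_def[abs_def] fock_inner_add_left[OF uF[OF insertI1] np1F uF[OF insertI2[OF that]]] fock_inner_scale_left ..
    also have "fock_inner \<alpha> p1 (u i) = fock_inner \<alpha> (u a) (u i)"
      unfolding p1_def[abs_def] c1_def by (rule S[OF that])
    finally show ?thesis by simp
  qed
  have "fock_inner \<alpha> g p1 = 0"
    unfolding p1_def
    by (subst fock_inner_sum_right[OF fock_space_scale[OF uF] gF]) (auto simp: fock_inner_scale_right g_orth)
  then have "fock_inner \<alpha> g (\<lambda>z. (-1) * p1 z) = 0" by (simp only: fock_inner_scale_right mult_zero_right)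
  moreover have "fock_inner \<alpha> g (\<lambda>z. u a z + (-1) * p1 z) = fock_inner \<alpha> g (u a) + fock_inner \<alpha> g (\<lambda>z. (-1) * p1 z)"
    by (rule fock_inner_add_right[OF uF[OF insertI1] np1F gF])
  moreover have "(\<lambda>z. u a z + (-1) * p1 z) = g" by (simp only: g_def[abs_def])
  ultimately have g_a: "fock_inner \<alpha> g (u a) = fock_inner \<alpha> g g" by (simp only: add_0_right)
  have "fock_norm \<alpha> g \<noteq> 0"
  proof
    assume "fock_norm \<alpha> g = 0"
    then have "fock_norm \<alpha> (\<lambda>z. \<Sum>j\<in>insert a J. ((\<lambda>j. - c1 j)(a := 1)) j * u j z) = 0"
      by (simp only: g_eq[symmetric])
    from insert.prems(2)[OF this] show False by simp
  qed
  then have gg: "fock_inner \<alpha> g g \<noteq> 0" unfolding fock_inner_self[OF \<alpha>] by simp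
  define p0 where "p0 z = (\<Sum>j\<in>J. S v j * u j z)" for z
  have p0F: "p0 \<in> fock_space \<alpha>" unfolding p0_def by (rule sumF)
  define t where "t = (v a - fock_inner \<alpha> p0 (u a)) / fock_inner \<alpha> g g"
  have tgF: "(\<lambda>z. t * g z) \<in> fock_space \<alpha>" using gF by (rule fock_space_scale)
  define c where "c j = (if j = a then t else S v j - t * c1 j)" for j
  have "(\<Sum>j\<in>insert a J. c j * u j z) = p0 z + t * g z" for z
  proof -
    have "(\<Sum>j\<in>J. c j * u j z) = (\<Sum>j\<in>J. S v j * u j z - t * (c1 j * u j z))"
      using insert.hyps by (intro sum.cong) (auto simp: c_def algebra_simps)
    then show ?thesis
      using insert.hyps by (simp add: p0_def g_def p1_def c_def sum_subtractf sum_distrib_left[symmetric] algebra_simps)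
  qed
  moreover have "fock_inner \<alpha> (\<lambda>z. p0 z + t * g z) (u i) = v i" if "i \<in> insert a J" for i
  proof -
    have "fock_inner \<alpha> (\<lambda>z. p0 z + t * g z) (u i) = fock_inner \<alpha> p0 (u i) + t * fock_inner \<alpha> g (u i)"
      unfolding fock_inner_add_left[OF p0F tgF uF[OF that]] fock_inner_scale_left ..
    also have "\<dots> = v i"
    proof (cases "i = a")
      case True
      then show ?thesis using gg by (simp add: g_a t_def)
    next
      case False
      then have "i \<in> J" using that by simp
      then show ?thesis using S[of i v] by (simp add: g_orth p0_def[abs_def])
    qed
    finally show ?thesis .
  qed
  ultimately show ?case by (intro exI[of _ c]) simp
qed

text \<open>The solution is sought in the span of the atoms. Then ||f||^2 is the pairing of its
  coefficients with the data, and Cauchy-Schwarz with the Riesz bound gives ||f||^2 \<le> sqrt D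
  ||f||.\<close>

lemma riesz_solvable:
  assumes J: "finite J" and D: "D > 0"
    and riesz: "\<And>c. (\<Sum>(l, k)\<in>J. (cmod (c l k))\<^sup>2) \<le> D * (fock_norm \<alpha> (\<lambda>z. \<Sum>(l, k)\<in>J. c l k * fock_atom \<alpha> l k z))\<^sup>2"
    and v: "(\<Sum>i\<in>J. (cmod (v i))\<^sup>2) \<le> 1"
  shows "fock_solvable \<alpha> J v (sqrt D)"
proof -
  define u where "u i = fock_atom \<alpha> (fst i) (snd i)" for i
  have uF: "u i \<in> fock_space \<alpha>" for i unfolding u_def by (rule fock_atom_space[OF \<alpha>])
  have riesz': "(\<Sum>i\<in>J. (cmod (c i))\<^sup>2) \<le> D * (fock_norm \<alpha> (\<lambda>z. \<Sum>i\<in>J. c i * u i z))\<^sup>2" for c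
    using riesz[of "curry c"] by (simp add: case_prod_beta u_def)
  have "\<exists>c. \<forall>i\<in>J. fock_inner \<alpha> (\<lambda>z. \<Sum>j\<in>J. c j * u j z) (u i) = v i"
  proof (rule gram_solvable[OF J uF])
    fix c assume "fock_norm \<alpha> (\<lambda>z. \<Sum>i\<in>J. c i * u i z) = 0"
    then have "(\<Sum>i\<in>J. (cmod (c i))\<^sup>2) \<le> 0" using riesz'[of c] by simp
    then have "(\<Sum>i\<in>J. (cmod (c i))\<^sup>2) = 0" by (intro antisym sum_nonneg) auto
    then show "\<forall>i\<in>J. c i = 0" using J by (simp add: sum_nonneg_eq_0_iff)
  qed
  then obtain c where c: "\<And>i. i \<in> J \<Longrightarrow> fock_inner \<alpha> (\<lambda>z. \<Sum>j\<in>J. c j * u j z) (u i) = v i" by blast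
  define f where "f z = (\<Sum>j\<in>J. c j * u j z)" for z
  have fF: "f \<in> fock_space \<alpha>" unfolding f_def by (intro fock_space_sum fock_space_scale uF)
  have fu: "fock_inner \<alpha> f (u i) = v i" if "i \<in> J" for i using c[OF that] unfolding f_def[abs_def] .
  have "of_real ((fock_norm \<alpha> f)\<^sup>2) = fock_inner \<alpha> f (\<lambda>z. \<Sum>j\<in>J. c j * u j z)"
    unfolding fock_inner_self[OF \<alpha>, symmetric] f_def ..
  also have "\<dots> = (\<Sum>j\<in>J. fock_inner \<alpha> f (\<lambda>z. c j * u j z))"
    by (rule fock_inner_sum_right[OF fock_space_scale[OF uF] fF])
  also have "\<dots> = (\<Sum>j\<in>J. cnj (c j) * v j)" by (simp add: fock_inner_scale_right fu)
  finally have "(fock_norm \<alpha> f)\<^sup>2 = cmod (\<Sum>j\<in>J. cnj (c j) * v j)"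
    by (metis abs_of_nonneg norm_of_real zero_le_power2)
  also have "\<dots> \<le> (\<Sum>j\<in>J. cmod (c j) * cmod (v j))"
    by (rule order_trans[OF norm_sum]) (simp add: norm_mult)
  also have "\<dots> \<le> L2_set (\<lambda>j. cmod (c j)) J * L2_set (\<lambda>j. cmod (v j)) J"
    using L2_set_mult_ineq[of "\<lambda>j. cmod (c j)" "\<lambda>j. cmod (v j)" J] by simp
  also have "\<dots> \<le> (sqrt D * fock_norm \<alpha> f) * 1"
  proof (rule mult_mono)
    have "sqrt (\<Sum>j\<in>J. (cmod (c j))\<^sup>2) \<le> sqrt (D * (fock_norm \<alpha> f)\<^sup>2)"
      using riesz'[of c] unfolding f_def[abs_def] by (rule real_sqrt_le_mono)
    then show "L2_set (\<lambda>j. cmod (c j)) J \<le> sqrt D * fock_norm \<alpha> f"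
      using fock_norm_nonneg[OF \<alpha>, of f] by (simp add: L2_set_def real_sqrt_mult)
    show "L2_set (\<lambda>j. cmod (v j)) J \<le> 1" using v by (simp add: L2_set_def)
  qed (use D fock_norm_nonneg[OF \<alpha>] in auto)
  finally have "(fock_norm \<alpha> f)\<^sup>2 \<le> sqrt D * fock_norm \<alpha> f" by simp
  then have "fock_norm \<alpha> f \<le> sqrt D"
    using fock_norm_nonneg[OF \<alpha>, of f] D
    by (cases "fock_norm \<alpha> f = 0") (auto simp: power2_eq_square)
  then show ?thesis
    unfolding fock_solvable_def by (intro bexI[OF _ fF]) (use fu in \<open>auto simp: u_def\<close>)
qed

text \<open>A bound, uniform in m \<ge> 1, for the exponent \<alpha> (b - a)^2/(2 a) of
  \<open>radial_weight\<close>: with r = sqrt (m/\<alpha>) one has (b - a)^2/a = (C (2 + C/r))^2,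
  and 1/r \<le> sqrt \<alpha>.\<close>

definition sweep_bound :: "real \<Rightarrow> real" where
  "sweep_bound C = \<alpha> * (C * (2 + C * sqrt \<alpha>))\<^sup>2 / 2"

lemma weight_parameters:
  assumes C: "C > 0" and m: "(m::nat) \<ge> 1"
  defines "a \<equiv> real m / \<alpha>" and "b \<equiv> (sqrt (real m / \<alpha>) + C)\<^sup>2"
  shows "0 < a" "a < b" "real m = \<alpha> * a" "\<alpha> * (b - a)\<^sup>2 / (2 * a) \<le> sweep_bound C"
proof -
  define r where "r = sqrt (real m / \<alpha>)"
  show a0: "0 < a" using m \<alpha> by (simp add: a_def)
  then have r0: "r > 0" by (simp add: r_def a_def)
  have a: "a = r\<^sup>2" using a0 by (simp add: r_def a_def)
  have ba: "b - a = C * (2 * r + C)" unfolding a b_def r_def[symmetric] by (simp add: power2_eq_square algebra_simps)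
  have "C * (2 * r + C) > 0" using C r0 by (intro mult_pos_pos) auto
  then show "a < b" using ba by linarith
  show "real m = \<alpha> * a" using \<alpha> by (simp add: a_def)
  have "sqrt \<alpha> * r = sqrt (real m)" using \<alpha> by (simp add: r_def real_sqrt_mult[symmetric])
  then have "1 \<le> sqrt \<alpha> * r" using m by simp
  then have "1 / r \<le> sqrt \<alpha>" using r0 by (simp add: field_simps)
  then have "C * (1 / r) \<le> C * sqrt \<alpha>" using C by (intro mult_left_mono) auto
  then have "C * (2 + C / r) \<le> C * (2 + C * sqrt \<alpha>)" using C by (intro mult_left_mono) auto
  then have "(C * (2 + C / r))\<^sup>2 \<le> (C * (2 + C * sqrt \<alpha>))\<^sup>2" using C r0 by (intro power_mono) auto
  moreover have "(b - a)\<^sup>2 / a = (C * (2 + C / r))\<^sup>2"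
  proof -
    have "C * (2 * r + C) = (C * (2 + C / r)) * r" using r0 by (simp add: field_simps)
    then have "(b - a)\<^sup>2 = (C * (2 + C / r))\<^sup>2 * a" unfolding ba unfolding a by (simp only: power_mult_distrib)
    then show ?thesis using a0 by simp
  qed
  ultimately have "\<alpha> / 2 * ((b - a)\<^sup>2 / a) \<le> \<alpha> / 2 * (C * (2 + C * sqrt \<alpha>))\<^sup>2"
    using \<alpha> by (intro mult_left_mono) auto
  then show "\<alpha> * (b - a)\<^sup>2 / (2 * a) \<le> sweep_bound C" by (simp add: sweep_bound_def)
qed

lemma weighted_divisor_exists:
  assumes C: "C > 0" and fin: "finite \<Lambda>" and m: "\<And>l. l \<in> \<Lambda> \<Longrightarrow> m l \<ge> 1"
    and disj: "disjoint_family_on (\<lambda>l. ball l (sqrt (real (m l) / \<alpha>) + C)) \<Lambda>"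
  obtains \<eta> e e' where "weighted_divisor \<alpha> C (sweep_bound C) \<Lambda> m \<eta> e e'"
proof -
  \<comment> \<open>One predicate for all properties, since the three functions at a point have to
    be chosen together.\<close>
  define P where "P l \<eta> e e' \<longleftrightarrow>
     (\<forall>s\<ge>0. (\<eta> has_real_derivative e s) (at s)) \<and> (\<forall>s\<ge>0. (e has_real_derivative e' s) (at s)) \<and>
     continuous_on {0..} e' \<and> (\<forall>s\<ge>0. s ^ m l * exp (\<eta> s) \<le> 1) \<and>
     (\<forall>s\<ge>(sqrt (real (m l) / \<alpha>) + C)\<^sup>2. s ^ m l * exp (\<eta> s) = 1) \<and>
     (\<forall>s\<ge>real (m l) / \<alpha>. s ^ m l * exp (\<eta> s) \<ge> exp (- sweep_bound C)) \<and>
     (\<forall>s\<ge>0. 0 \<le> \<alpha> + (e s + s * e' s)) \<and>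
     (\<forall>s\<ge>(sqrt (real (m l) / \<alpha>) + C)\<^sup>2. e s + s * e' s = 0) \<and>
     (\<forall>s\<ge>(real (m l) / \<alpha> + (sqrt (real (m l) / \<alpha>) + C)\<^sup>2) / 2.
        s \<le> (sqrt (real (m l) / \<alpha>) + C)\<^sup>2 \<longrightarrow> \<alpha> / 2 \<le> \<alpha> + (e s + s * e' s))"
    for l and \<eta> e e' :: "real \<Rightarrow> real"
  have "\<exists>\<eta> e e'. P l \<eta> e e'" if l: "l \<in> \<Lambda>" for l
  proof -
    note w = weight_parameters[OF C m[OF l]]
    obtain \<eta> e e' where \<eta>: "\<And>s. s \<ge> 0 \<Longrightarrow> (\<eta> has_real_derivative e s) (at s)"
      "\<And>s. s \<ge> 0 \<Longrightarrow> (e has_real_derivative e' s) (at s)"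
      "continuous_on {0..} e'"
      "\<And>s. s \<ge> 0 \<Longrightarrow> s ^ m l * exp (\<eta> s) \<le> 1"
      "\<And>s. s \<ge> (sqrt (real (m l) / \<alpha>) + C)\<^sup>2 \<Longrightarrow> s ^ m l * exp (\<eta> s) = 1"
      "\<And>s. s \<ge> real (m l) / \<alpha> \<Longrightarrow> s ^ m l * exp (\<eta> s) \<ge>
          exp (- (\<alpha> * ((sqrt (real (m l) / \<alpha>) + C)\<^sup>2 - real (m l) / \<alpha>)\<^sup>2 / (2 * (real (m l) / \<alpha>))))"
      "\<And>s. s \<ge> 0 \<Longrightarrow> 0 \<le> \<alpha> + (e s + s * e' s)"
      "\<And>s. s \<ge> (sqrt (real (m l) / \<alpha>) + C)\<^sup>2 \<Longrightarrow> e s + s * e' s = 0"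
      "\<And>s. (real (m l) / \<alpha> + (sqrt (real (m l) / \<alpha>) + C)\<^sup>2) / 2 \<le> s \<Longrightarrow>
          s \<le> (sqrt (real (m l) / \<alpha>) + C)\<^sup>2 \<Longrightarrow> \<alpha> / 2 \<le> \<alpha> + (e s + s * e' s)"
      using radial_weight[OF \<alpha> w(1,2) m[OF l] w(3)] by blast
    have "exp (- sweep_bound C) \<le>
        exp (- (\<alpha> * ((sqrt (real (m l) / \<alpha>) + C)\<^sup>2 - real (m l) / \<alpha>)\<^sup>2 / (2 * (real (m l) / \<alpha>))))"
      using w(4) by simp
    then have ge: "exp (- sweep_bound C) \<le> s ^ m l * exp (\<eta> s)" if "s \<ge> real (m l) / \<alpha>" for s
      using \<eta>(6)[OF that] by linarith
    have "P l \<eta> e e'" unfolding P_def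
      by (intro conjI allI impI \<eta>(1-5,7-9) ge)
    then show ?thesis by blast
  qed
  then have "\<forall>l\<in>\<Lambda>. \<exists>\<eta> e e'. P l \<eta> e e'" by blast
  from bchoice[OF this] obtain \<eta> where "\<forall>l\<in>\<Lambda>. \<exists>e e'. P l (\<eta> l) e e'" ..
  from bchoice[OF this] obtain e where "\<forall>l\<in>\<Lambda>. \<exists>e'. P l (\<eta> l) (e l) e'" ..
  from bchoice[OF this] obtain e' where "\<forall>l\<in>\<Lambda>. P l (\<eta> l) (e l) (e' l)" ..
  note P = bspec[OF this, unfolded P_def]
  have "weighted_divisor \<alpha> C (sweep_bound C) \<Lambda> m \<eta> e e'"
    by (unfold_locales, fact \<alpha>, fact C, fact fin, fact m, fact disj) (use P in blast)+
  then show thesis by (rule that)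
qed

lemma disjoint_interpolating:
  assumes \<Lambda>: "divisor \<Lambda> m" and C: "C > 0"
    and disj: "disjoint_family_on (\<lambda>l. ball l (sqrt (real (m l) / \<alpha>) + C)) \<Lambda>"
  shows "interpolating \<alpha> \<Lambda> m"
proof -
  \<comment> \<open>This is 2 (1 + 2 \<open>riesz_const\<close>) with H =
    \<open>sweep_bound C\<close>. It is fixed before \<open>J\<close>, as the compactness argument
    requires.\<close>
  define D where "D = 2 * (1 + 2 * (64 / C\<^sup>2 * (2 * exp (sweep_bound C) / \<alpha>)))"
  have D: "D > 0" unfolding D_def using \<alpha> by (intro mult_pos_pos add_pos_nonneg) auto
  have "fock_solvable \<alpha> J v (sqrt D)"
    if J: "finite J" "J \<subseteq> divisor_index \<Lambda> m" and v: "(\<Sum>i\<in>J. (cmod (v i))\<^sup>2) \<le> 1" for J v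
  proof -
    \<comment> \<open>The Riesz bound concerns divisors, so the points of \<open>J\<close> are taken
      with their full multiplicities and the data are extended by 0.\<close>
    define \<Lambda>' where "\<Lambda>' = fst ` J"
    have \<Lambda>': "finite \<Lambda>'" "\<Lambda>' \<subseteq> \<Lambda>" using J by (auto simp: \<Lambda>'_def divisor_index_def)
    have m: "m l \<ge> 1" if "l \<in> \<Lambda>'" for l using \<Lambda> \<Lambda>' that by (auto simp: divisor_def)
    obtain \<eta> e e' where "weighted_divisor \<alpha> C (sweep_bound C) \<Lambda>' m \<eta> e e'"
      using weighted_divisor_exists[OF C \<Lambda>'(1) m disjoint_family_on_mono[OF \<Lambda>'(2) disj]] by blast
    then interpret weighted_divisor \<alpha> C "sweep_bound C" \<Lambda>' m \<eta> e e' .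
    have JI: "J \<subseteq> divisor_index \<Lambda>' m" using J by (force simp: \<Lambda>'_def divisor_index_def)
    define w where "w i = (if i \<in> J then v i else 0)" for i
    have "fock_solvable \<alpha> (divisor_index \<Lambda>' m) w (sqrt D)"
    proof (rule riesz_solvable[OF finite_index D])
      show "(\<Sum>(l, k)\<in>divisor_index \<Lambda>' m. (cmod (c l k))\<^sup>2) \<le>
          D * (fock_norm \<alpha> (\<lambda>z. \<Sum>(l, k)\<in>divisor_index \<Lambda>' m. c l k * fock_atom \<alpha> l k z))\<^sup>2" for c
        using riesz_lower_bound[of c] unfolding D_def riesz_const_def synth_def[abs_def] .
      have "(\<Sum>i\<in>divisor_index \<Lambda>' m. (cmod (w i))\<^sup>2) = (\<Sum>i\<in>J. (cmod (w i))\<^sup>2)"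
        by (rule sum.mono_neutral_right[OF finite_index JI]) (simp add: w_def)
      also have "\<dots> = (\<Sum>i\<in>J. (cmod (v i))\<^sup>2)" by (simp add: w_def)
      finally show "(\<Sum>i\<in>divisor_index \<Lambda>' m. (cmod (w i))\<^sup>2) \<le> 1" using v by simp
    qed
    then show ?thesis by (rule fock_solvable_mono[OF _ JI order_refl]) (simp add: w_def)
  qed
  from bounded_solvability_extends[OF \<alpha> \<Lambda> _ this] D show ?thesis
    unfolding interpolating_def by (meson real_sqrt_gt_zero)
qed

end

theorem theorem1p3:
  fixes \<alpha> :: real
  assumes "\<alpha> > 0"
  shows "(\<exists>C :: real \<Rightarrow> real. (\<forall>M. C M > 0) \<and>
      (\<forall>\<Lambda> m. divisor \<Lambda> m \<longrightarrow> interpolating \<alpha> \<Lambda> m \<longrightarrow>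
        (let c = C (interpolation_constant \<alpha> \<Lambda> m) in
          disjoint_family_on (\<lambda>l. ball l (sqrt (real (m l) / \<alpha>) - c))
            {l \<in> \<Lambda>. real (m l) > \<alpha> * c\<^sup>2})))
    \<and> (\<forall>\<Lambda> m. divisor \<Lambda> m \<longrightarrow>
        (\<exists>C::real. C > 0 \<and>
          disjoint_family_on (\<lambda>l. ball l (sqrt (real (m l) / \<alpha>) + C)) \<Lambda>) \<longrightarrow>
        interpolating \<alpha> \<Lambda> m)"
proof (intro conjI allI impI)
  \<comment> \<open>Solves exp (-\<alpha> C^2/2) = 1/(2 (|M| + 2)), the threshold of
    \<open>interpolating_disjoint\<close>. The logarithm has an argument of at least 4, so C is
    positive for every real M.\<close>
  define C where "C M = sqrt (2 * ln (2 * (\<bar>M\<bar> + 2)) / \<alpha>)" for M :: real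
  have C_pos: "C M > 0" for M using assms by (simp add: C_def)
  have "exp (- (\<alpha> * (C M)\<^sup>2) / 2) = 1 / (2 * (\<bar>M\<bar> + 2))" for M
  proof -
    have "ln (2 * (\<bar>M\<bar> + 2)) > 0" by simp
    then have "(C M)\<^sup>2 = 2 * ln (2 * (\<bar>M\<bar> + 2)) / \<alpha>" using assms by (simp add: C_def)
    then have "- (\<alpha> * (C M)\<^sup>2) / 2 = - ln (2 * (\<bar>M\<bar> + 2))" using assms by simp
    then show ?thesis by (simp only: exp_minus) (simp add: inverse_eq_divide)
  qed
  then have "disjoint_family_on (\<lambda>l. ball l (sqrt (real (m l) / \<alpha>) - C (interpolation_constant \<alpha> \<Lambda> m))) \<Lambda>"
    if "divisor \<Lambda> m" "interpolating \<alpha> \<Lambda> m" for \<Lambda> m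
    using C_pos by (intro interpolating_disjoint[OF assms that]) (auto intro: less_imp_le)
  then have "\<forall>\<Lambda> m. divisor \<Lambda> m \<longrightarrow> interpolating \<alpha> \<Lambda> m \<longrightarrow>
        (let c = C (interpolation_constant \<alpha> \<Lambda> m) in
          disjoint_family_on (\<lambda>l. ball l (sqrt (real (m l) / \<alpha>) - c)) {l \<in> \<Lambda>. real (m l) > \<alpha> * c\<^sup>2})"
    unfolding Let_def by (intro allI impI) (rule disjoint_family_on_mono[rotated], blast+)
  with C_pos show "\<exists>C :: real \<Rightarrow> real. (\<forall>M. C M > 0) \<and>
      (\<forall>\<Lambda> m. divisor \<Lambda> m \<longrightarrow> interpolating \<alpha> \<Lambda> m \<longrightarrow>
        (let c = C (interpolation_constant \<alpha> \<Lambda> m) in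
          disjoint_family_on (\<lambda>l. ball l (sqrt (real (m l) / \<alpha>) - c))
            {l \<in> \<Lambda>. real (m l) > \<alpha> * c\<^sup>2}))"
    by blast
next
  fix \<Lambda> m
  assume "divisor \<Lambda> m" "\<exists>C::real. C > 0 \<and> disjoint_family_on (\<lambda>l. ball l (sqrt (real (m l) / \<alpha>) + C)) \<Lambda>"
  then show "interpolating \<alpha> \<Lambda> m" using disjoint_interpolating[OF assms] by blast
qed

end
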